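(* Let $n$ be a positive integer and let $\ell$ be an integer with $\lceil n/2\rceil\le \ell\le n$. \begin{enumerate} \item[(a)] The set $$\Big\{\tbinom{n}{k}\big(a^{\otimes k}\otimes(a^c)^{\otimes(n-k)}\big)^\vee e^{(n)}_{\ell,\mathbb{H}}\ :\ k\in\{n-\ell,\ldots,\ell\}\Big\}$$ is a complete set of $2\ell-n+1$ primitive orthogonal idempotents in $\mathbb{S}_\ell^{(n)}\mathbb{H}\otimes_\mathbb{R}\mathbb{C}$. \item[(b)] If $n$ is odd, then the elements $$\binom{n}{k}\frac{n-2k}{2^k}\sum_{i=0}^{\frac{n-1}{2}-k}\Big(-\frac12\Big)^i\frac{\binom{n-2k-i}{i}}{n-2k-i}\big(1^{\otimes(n-2k-2i)}\otimes\square^{\otimes(k+i)}\big)^\vee\cdot e^{(n)}_{\ell,\mathbb{H}},$$ for $k\in\{n-\ell,\ldots,\frac{n-1}{2}\}$, form a complete set of $\frac{2\ell-n+1}{2}$ primitive orthogonal idempotents in $\mathbb{S}_\ell^{(n)}\mathbb{H}$. \item[(c)] If $n$ is even, then the element $\big(\tfrac12\big)^{n/2}\binom{n}{n/2}\big(\square^{\otimes \frac n2}\big)^\vee\cdot e^{(n)}_{\ell,\mathbb{H}}$ together with the elements $$\binom{n}{k}\frac{\frac n2-k}{2^k}\sum_{i=0}^{\lfloor \frac n4-\frac k2\rfloor}\Big(-\frac14\Big)^i\frac{\binom{\frac n2-k-i}{i}}{\frac n2-k-i}\big(\square^{\otimes(k+2i)}\otimes(1\otimes1-\square)^{\otimes(\frac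 n2-k-2i)}\big)^\vee\cdot\frac12\big(1^{\otimes n}+\delta\, e_2^{\otimes n}\big)\cdot e^{(n)}_{\ell,\mathbb{H}},$$ for $k\in\{n-\ell,\ldots,\frac n2-1\}$ and $\delta\in\{-1,1\}$, form a complete set of $2\ell-n+1$ primitive orthogonal idempotents in $\mathbb{S}_\ell^{(n)}\mathbb{H}$. \end{enumerate}
   Context: $\mathbb{H}$ is the real quaternion algebra with basis $e_0=1,e_1,e_2,e_3$, $e_1^2=e_2^2=e_3^2=-1$, $e_1e_2=-e_2e_1=e_3$, $e_2e_3=-e_3e_2=e_1$, $e_3e_1=-e_1e_3=e_2$; $\mathbb{R}[e_1]$ is the subalgebra spanned by $1,e_1$. For $F\in\{\mathbb{R},\mathbb{C}\}$ let $\mathbb{H}_F=\mathbb{H}\otimes_\mathbb{R}F$, and let $\mathbb{H}_F^{\otimes n}$ be the $n$-fold tensor power over $F$ with componentwise multiplication $(x_1\otimes\cdots\otimes x_n)(y_1\otimes\cdots\otimes y_n)=x_1y_1\otimes\cdots\otimes x_ny_n$. The symmetric group $\mathfrak S_n$ acts by $\sigma(x_1\otimes\cdots\otimes x_n)=x_{\sigma^{-1}(1)}\otimes\cdots\otimes x_{\sigma^{-1}(n)}$; for $x\in\mathbb{H}_F^{\otimes n}$ put $x^\vee=\frac1{n!}\sum_{\sigma\in\mathfrak S_n}\sigma(x)$. $\mathrm{Sym}^n\mathbb{H}_F$ is the subalgebra of $\mathfrak S_n$-fixed tensors, and $\mathrm{Sym}^n\mathbb{H}_\mathbb{C}=\mathrm{Sym}^n\mathbb{H}\otimes_\mathbb{R}\mathbb{C}$.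 Let $\triangle_\mathbb{H}=\frac14\sum_{i=0}^3 e_i\otimes e_i$, and for $n\ge2$ let $\triangle^{(n)}_\mathbb{H}=(\triangle_\mathbb{H}\otimes1^{\otimes(n-2)})^\vee$ (a central element of $\mathrm{Sym}^n\mathbb{H}_F$). For integers $\lceil n/2\rceil\le m\le n$ let $\beta^{(n)}_{m}=\frac{2(n-m)(2m+2)}{4n(n-1)}$ and $$e^{(n)}_{m,\mathbb{H}}=\prod_{\lceil n/2\rceil\le m'\le n,\ m'\neq m}\frac{\triangle^{(n)}_\mathbb{H}-\beta^{(n)}_{m'}1^{\otimes n}}{\beta^{(n)}_{m}-\beta^{(n)}_{m'}}\quad(n\ge2),\qquad e^{(1)}_{1,\mathbb{H}}=1.$$ These are orthogonal central idempotents of $\mathrm{Sym}^n\mathbb{H}_F$ summing to $1^{\otimes n}$. Put $\mathbb{S}^{(n)}_\ell\mathbb{H}_F=\mathrm{Sym}^n\mathbb{H}_F\cdot e^{(n)}_{\ell,\mathbb{H}}$, a ring with unit $e^{(n)}_{\ell,\mathbb{H}}$; $\mathbb{S}^{(n)}_\ell\mathbb{H}\otimes_\mathbb{R}\mathbb{C}=\mathbb{S}^{(n)}_\ell\mathbb{H}_\mathbb{C}$. Let $a=\frac12(1+\sqrt{-1}e_1)$, $a^c=\frac12(1-\sqrt{-1}e_1)\in\mathbb{H}_\mathbb{C}$, and $\square=\frac12(1\otimes1+e_1\otimes e_1)\in\mathrm{Sym}^2\mathbb{H}$. Tensor products of symmetric tensors such as $\square^{\otimes j}\otimes 1^{\otimes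 r}$ are viewed in $\mathbb{H}_F^{\otimes n}$ before applying $^\vee$. In a unital associative ring $R$: an idempotent is $x$ with $x^2=x$; idempotents $\{x_i\}$ are orthogonal if $x_ix_j=0$ for $i\neq j$; a nonzero idempotent is primitive if it is not a sum of two nonzero orthogonal idempotents; a set of orthogonal idempotents is complete if they sum to $1_R$. *)

theory Defs
  imports Complex_Main "HOL-Combinatorics.Permutations"
begin

text \<open>Coordinates: an element of the n-fold tensor power of H_F is a coefficient
function on words (lists) w of length n with entries in {0,1,2,3}; the coefficient
at w is the coefficient of e_{w_1} (x) ... (x) e_{w_n}.  Coefficient functions are
required to vanish outside the valid words (see tens).  A quaternion over F is a
coefficient function nat => F vanishing outside {0..3}.\<close>

type_synonym 'a tensor = "nat list \<Rightarrow> 'a"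

definition words :: "nat \<Rightarrow> nat list set" where
  "words n = {w. length w = n \<and> set w \<subseteq> {..<4}}"

definition tens :: "nat \<Rightarrow> ('a::zero) tensor set" where
  "tens n = {x. \<forall>w. w \<notin> words n \<longrightarrow> x w = 0}"

text \<open>Quaternion multiplication table: e_i e_j = qsgn i j * e_(qidx i j).\<close>
definition qidx :: "nat \<Rightarrow> nat \<Rightarrow> nat" where
  "qidx i j = (if i = 0 then j else if j = 0 then i else if i = j then 0 else 6 - i - j)"

definition qsgn :: "nat \<Rightarrow> nat \<Rightarrow> 'a::ring_1" where
  "qsgn i j = (if i = 0 \<or> j = 0 then 1 else if i = j then -1
     else if (i, j) \<in> {(1,2),(2,3),(3,1)} then 1 else -1)"

definition wsgn :: "nat list \<Rightarrow> nat list \<Rightarrow> 'a::ring_1" where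
  "wsgn u v = prod_list (map2 qsgn u v)"

definition tmul :: "nat \<Rightarrow> ('a::field) tensor \<Rightarrow> 'a tensor \<Rightarrow> 'a tensor" where
  "tmul n x y = (\<lambda>w. if w \<in> words n then
      (\<Sum>u\<in>words n. \<Sum>v\<in>words n. if map2 qidx u v = w then wsgn u v * x u * y v else 0)
    else 0)"

definition tadd :: "('a::field) tensor \<Rightarrow> 'a tensor \<Rightarrow> 'a tensor" where
  "tadd x y = (\<lambda>w. x w + y w)"

definition smul :: "'a::field \<Rightarrow> 'a tensor \<Rightarrow> 'a tensor" where
  "smul c x = (\<lambda>w. c * x w)"

definition tzero :: "('a::field) tensor" where
  "tzero = (\<lambda>w. 0)"

definition tone :: "nat \<Rightarrow> ('a::field) tensor" where
  "tone n = (\<lambda>w. if w = replicate n 0 then 1 else 0)"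

definition ptens :: "(nat \<Rightarrow> 'a::field) list \<Rightarrow> 'a tensor" where
  "ptens qs = (\<lambda>w. if length w = length qs \<and> set w \<subseteq> {..<4}
      then prod_list (map2 (\<lambda>q j. q j) qs w) else 0)"

definition tconc :: "nat \<Rightarrow> ('a::field) tensor \<Rightarrow> 'a tensor \<Rightarrow> 'a tensor" where
  "tconc p x y = (\<lambda>w. if p \<le> length w then x (take p w) * y (drop p w) else 0)"

fun tpow :: "nat \<Rightarrow> ('a::field) tensor \<Rightarrow> nat \<Rightarrow> 'a tensor" where
  "tpow d x 0 = tone 0"
| "tpow d x (Suc k) = tconc d x (tpow d x k)"

text \<open>Action of a permutation sigma of {0..<n}:
  sigma(x_1 (x) ... (x) x_n) = x_{sigma^-1(1)} (x) ... (x) x_{sigma^-1(n)}.\<close>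
definition perm_act :: "nat \<Rightarrow> (nat \<Rightarrow> nat) \<Rightarrow> ('a::field) tensor \<Rightarrow> 'a tensor" where
  "perm_act n \<sigma> x = (\<lambda>w. if length w = n then x (map (\<lambda>j. w ! \<sigma> j) [0..<n]) else 0)"

definition symz :: "nat \<Rightarrow> ('a::field) tensor \<Rightarrow> 'a tensor" where
  "symz n x = (\<lambda>w. (1 / of_nat (fact n)) *
      (\<Sum>\<sigma>\<in>{\<sigma>. \<sigma> permutes {..<n}}. perm_act n \<sigma> x w))"

definition SymT :: "nat \<Rightarrow> ('a::field) tensor set" where
  "SymT n = {x. x \<in> tens n \<and> (\<forall>\<sigma>. \<sigma> permutes {..<n} \<longrightarrow> perm_act n \<sigma> x = x)}"

definition triH :: "('a::field) tensor" where
  "triH = (\<lambda>w. if \<exists>i<4. w = [i, i] then 1/4 else 0)"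

definition triHn :: "nat \<Rightarrow> ('a::field) tensor" where
  "triHn n = symz n (tconc 2 triH (tone (n - 2)))"

definition betaH :: "nat \<Rightarrow> nat \<Rightarrow> 'a::field" where
  "betaH n m = of_nat (2 * (n - m) * (2 * m + 2)) / of_nat (4 * n * (n - 1))"

definition eH :: "nat \<Rightarrow> nat \<Rightarrow> ('a::field) tensor" where
  "eH n l = (if n = 1 then tone 1 else
     foldr (\<lambda>m acc. tmul n
        (smul (1 / (betaH n l - betaH n m)) (tadd (triHn n) (smul (- betaH n m) (tone n)))) acc)
       (filter (\<lambda>m. m \<noteq> l) [(n + 1) div 2 ..< n + 1]) (tone n))"

definition SlH :: "nat \<Rightarrow> nat \<Rightarrow> ('a::field) tensor set" where
  "SlH n l = {tmul n s (eH n l) | s. s \<in> SymT n}"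

definition idem :: "nat \<Rightarrow> ('a::field) tensor \<Rightarrow> bool" where
  "idem n x \<longleftrightarrow> tmul n x x = x"

definition prim_idem :: "nat \<Rightarrow> ('a::field) tensor set \<Rightarrow> 'a tensor \<Rightarrow> bool" where
  "prim_idem n R x \<longleftrightarrow> x \<in> R \<and> idem n x \<and> x \<noteq> tzero \<and>
     \<not> (\<exists>y z. y \<in> R \<and> z \<in> R \<and> idem n y \<and> idem n z \<and> y \<noteq> tzero \<and> z \<noteq> tzero \<and>
            tmul n y z = tzero \<and> tmul n z y = tzero \<and> x = tadd y z)"

definition complete_POI :: "nat \<Rightarrow> ('a::field) tensor set \<Rightarrow> 'a tensor \<Rightarrow> ('i \<Rightarrow> 'a tensor)
    \<Rightarrow> 'i set \<Rightarrow> nat \<Rightarrow> bool" where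
  "complete_POI n R u f I N \<longleftrightarrow> finite I \<and> inj_on f I \<and> card I = N \<and>
     (\<forall>i\<in>I. prim_idem n R (f i)) \<and>
     (\<forall>i\<in>I. \<forall>j\<in>I. i \<noteq> j \<longrightarrow> tmul n (f i) (f j) = tzero) \<and>
     (\<lambda>w. \<Sum>i\<in>I. f i w) = u"

definition qa :: "nat \<Rightarrow> complex" where
  "qa j = (if j = 0 then 1/2 else if j = 1 then \<i>/2 else 0)"

definition qac :: "nat \<Rightarrow> complex" where
  "qac j = (if j = 0 then 1/2 else if j = 1 then -\<i>/2 else 0)"

definition qe2 :: "nat \<Rightarrow> 'a::field" where
  "qe2 j = (if j = 2 then 1 else 0)"

definition sqH :: "('a::field) tensor" where
  "sqH = (\<lambda>w. if w = [0,0] \<or> w = [1,1] then 1/2 else 0)"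

definition sqHc :: "('a::field) tensor" where
  "sqHc = (\<lambda>w. if w = [0,0] then 1/2 else if w = [1,1] then -1/2 else 0)"

end

theory Submission
  imports Defs "HOL-Computational_Algebra.Polynomial"
begin

text \<open>
  Over the complex numbers \<open>\<i> e\<^sub>1\<close>, \<open>(e\<^sub>2 + \<i> e\<^sub>3)/2\<close> and \<open>(\<i> e\<^sub>3 - e\<^sub>2)/2\<close> form an sl2 triple; summing
  them over the tensor positions gives operators \<open>wt\<close>, \<open>up\<close>, \<open>dn\<close> that generate the symmetric
  tensors.  The element \<open>\<triangle>\<^sup>(\<^sup>n\<^sup>)\<close> is an affine function of their Casimir element, so \<open>e\<^sub>l\<close> projects to
  one Casimir eigenvalue, while \<open>binom n k (a\<^sup>k \<otimes> (a\<^sup>c)\<^sup>n\<^sup>-\<^sup>k)\<close>, symmetrized, projects to the weight \<open>2k - n\<close>.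
  Moving up and down the weight ladder changes an element of \<open>Sym\<^sup>n e\<^sub>l\<close> only by scalars, hence each
  weight projection cuts out a one-dimensional corner and is primitive.

  The products occurring in (b) and (c) are forms in the commuting letters \<open>a\<close>, \<open>a\<^sup>c\<close>, namely
  \<open>1 = a + a\<^sup>c\<close>, \<open>\<box> = 2 a a\<^sup>c\<close> and \<open>1 \<otimes> 1 - \<box> = a\<^sup>2 + (a\<^sup>c)\<^sup>2\<close>, and Waring's formula for power sums
  identifies the given elements with sums of the weight projections \<open>k\<close> and \<open>n - k\<close>.  These two are
  exchanged by \<open>J = e\<^sub>2\<^sup>\<otimes>\<^sup>n\<close>.  For even \<open>n\<close> one has \<open>J\<^sup>2 = 1\<close>, and \<open>(1 \<plusminus> J)/2\<close> splits the sum into two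
  primitive idempotents; for odd \<open>n\<close> one has \<open>J\<^sup>2 = -1\<close>, and the real corner is a copy of the
  quaternions, a division ring.
\<close>

section \<open>The ring of all tensor powers\<close>

text \<open>No modules or eigenspaces are used: weight vectors, ladders and corners are elements of
  one associative ring, and left multiplication plays the action. The letters e_1, e_2, e_3 act on a
  tensor by the sum over its positions, which makes sense in every degree at once; this is why the
  ring holds all degrees, with a central idempotent cutting out degree n, and why many identities
  follow by stripping the first letter. The corner argument works because these three sums generate
  the symmetric tensors, so a statement about all of Sym^n is an induction over three left
  multiplications. The spectrum of the Casimir element has to be found by hand: on a fixed weight,
  going up and back down is multiplication by the Casimir element minus a constant, and iterating
  until the weights run out gives an annihilating product. That the corners are nonzero needs an
  explicit vector, built from n - l antisymmetric pairs. Real tensors are treated inside the complex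
  ring as the fixed points of coefficient conjugation, which interchanges the weight indices k and n
  - k.\<close>

definition valid :: "nat list \<Rightarrow> bool" where
  "valid w \<longleftrightarrow> set w \<subseteq> {..<4}"

lemma valid_simps [simp]: "valid []" "valid (i # w) \<longleftrightarrow> i < 4 \<and> valid w"
  "valid (u @ w) \<longleftrightarrow> valid u \<and> valid w"
  by (auto simp: valid_def)

lemma valid_replicate_0 [simp]: "valid (replicate n 0)"
  by (auto simp: valid_def)

lemma valid_takeD: "valid w \<Longrightarrow> valid (take p w)"
  and valid_dropD: "valid w \<Longrightarrow> valid (drop p w)"
  by (auto simp: valid_def dest: in_set_takeD in_set_dropD)

lemma words_valid: "w \<in> words n \<longleftrightarrow> length w = n \<and> valid w"
  by (auto simp: words_def valid_def)

lemma finite_words [simp]: "finite (words n)"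
proof -
  have "words n = {xs. set xs \<subseteq> {..<4} \<and> length xs = n}" by (auto simp: words_def)
  then show ?thesis by (simp add: finite_lists_length_eq)
qed

lemma less4: "(i::nat) < 4 \<longleftrightarrow> i = 0 \<or> i = Suc 0 \<or> i = 2 \<or> i = 3"
  by auto

lemma sum4: "sum f {..<4::nat} = f 0 + f 1 + f 2 + f 3"
  by (simp add: eval_nat_numeral)

lemma qidx_lt [simp]: "i < 4 \<Longrightarrow> j < 4 \<Longrightarrow> qidx i j < 4"
  by (auto simp: qidx_def)

lemma qidx_self_cancel: "i < 4 \<Longrightarrow> j < 4 \<Longrightarrow> qidx j (qidx j i) = i"
  by (simp only: less4) (elim disjE; simp add: qidx_def)

lemma qidx_eq_iff: "i < 4 \<Longrightarrow> j < 4 \<Longrightarrow> k < 4 \<Longrightarrow> qidx j k = i \<longleftrightarrow> k = qidx j i"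
  by (simp only: less4) (elim disjE; simp add: qidx_def)

lemma qsgn_0 [simp]: "qsgn 0 j = 1" "qsgn i 0 = 1"
  by (auto simp: qsgn_def)

lemma qidx_0 [simp]: "qidx 0 j = j" "qidx i 0 = i"
  by (auto simp: qidx_def)

text \<open>Up to sign the basis quaternions multiply like the Klein four-group, so
  \<open>e_j e_k\<close> meets \<open>e_i\<close> only for \<open>k = qidx j i\<close>. The double
  sum of \<open>tmul\<close> therefore collapses to a single one, and splitting off the first letter
  allows induction on the word, whose length replaces the parameter n.\<close>

fun mulc :: "complex tensor \<Rightarrow> complex tensor \<Rightarrow> complex tensor" where
  "mulc x y [] = x [] * y []"
| "mulc x y (i # w) =
     (\<Sum>j<4. qsgn j (qidx j i) * mulc (\<lambda>u. x (j # u)) (\<lambda>u. y (qidx j i # u)) w)"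

lemma words_0 [simp]: "words 0 = {[]}"
  by (auto simp: words_def)

lemma sum_words_Suc: "(\<Sum>u\<in>words (Suc n). f u) = (\<Sum>j<4. \<Sum>u\<in>words n. f (j # u))"
proof -
  have "words (Suc n) = (\<lambda>(j, u). j # u) ` ({..<4} \<times> words n)"
  proof (intro set_eqI iffI)
    fix w assume "w \<in> words (Suc n)"
    then show "w \<in> (\<lambda>(j, u). j # u) ` ({..<4} \<times> words n)"
      by (cases w) (auto simp: words_valid)
  qed (auto simp: words_valid)
  moreover have "inj_on (\<lambda>(j, u). j # u) ({..<4::nat} \<times> words n)"
    by (auto simp: inj_on_def)
  ultimately show ?thesis
    by (simp add: sum.reindex sum.cartesian_product case_prod_unfold)
qed

lemma mulc_eq_sum:
  "mulc x y w = (\<Sum>u\<in>words (length w). wsgn u (map2 qidx u w) * x u * y (map2 qidx u w))"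
  by (induction w arbitrary: x y)
     (simp_all add: sum_words_Suc wsgn_def sum_distrib_left mult.assoc)

lemma map2_qidx_eq_iff:
  "u \<in> words n \<Longrightarrow> v \<in> words n \<Longrightarrow> w \<in> words n \<Longrightarrow> map2 qidx u v = w \<longleftrightarrow> v = map2 qidx u w"
proof (induction n arbitrary: u v w)
  case (Suc n)
  then obtain a u' b v' c w' where "u = a # u'" "v = b # v'" "w = c # w'"
    by (metis length_Suc_conv words_valid)
  with Suc show ?case by (auto simp: words_valid qidx_eq_iff)
qed simp

lemma map2_qidx_words: "u \<in> words n \<Longrightarrow> w \<in> words n \<Longrightarrow> map2 qidx u w \<in> words n"
proof (induction n arbitrary: u w)
  case (Suc n)
  then obtain a u' c w' where "u = a # u'" "w = c # w'"
    by (metis length_Suc_conv words_valid)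
  with Suc show ?case by (auto simp: words_valid)
qed simp

lemma tmul_eq_mulc:
  assumes "w \<in> words n" shows "tmul n x y w = mulc x y w"
proof -
  have "(\<Sum>v\<in>words n. if map2 qidx u v = w then wsgn u v * x u * y v else 0)
      = wsgn u (map2 qidx u w) * x u * y (map2 qidx u w)" if "u \<in> words n" for u
  proof -
    have "(\<Sum>v\<in>words n. if map2 qidx u v = w then wsgn u v * x u * y v else 0)
       = (\<Sum>v\<in>words n. if v = map2 qidx u w then wsgn u v * x u * y v else 0)"
      using assms that by (intro sum.cong) (auto simp: map2_qidx_eq_iff)
    then show ?thesis using assms that by (simp add: map2_qidx_words)
  qed
  then show ?thesis
    using assms by (simp add: tmul_def mulc_eq_sum words_valid)
qed

lemma mulc_add_left: "mulc (\<lambda>u. x u + y u) z w = mulc x z w + mulc y z w"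
  and mulc_add_right: "mulc z (\<lambda>u. x u + y u) w = mulc z x w + mulc z y w"
  and mulc_scale_left: "mulc (\<lambda>u. c * x u) z w = c * mulc x z w"
  and mulc_scale_right: "mulc z (\<lambda>u. c * x u) w = c * mulc z x w"
  by (simp_all add: mulc_eq_sum sum.distrib [symmetric] sum_distrib_left algebra_simps)

lemma mulc_0_left [simp]: "mulc (\<lambda>u. 0) z w = 0"
  and mulc_0_right [simp]: "mulc z (\<lambda>u. 0) w = 0"
  by (simp_all add: mulc_eq_sum)

lemma mulc_lincomb_left:
  "finite A \<Longrightarrow> mulc (\<lambda>u. \<Sum>k\<in>A. c k * g k u) z w = (\<Sum>k\<in>A. c k * mulc (g k) z w)"
  by (induction A rule: finite_induct) (simp_all add: mulc_add_left mulc_scale_left)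

lemma mulc_lincomb_right:
  "finite A \<Longrightarrow> mulc z (\<lambda>u. \<Sum>k\<in>A. c k * g k u) w = (\<Sum>k\<in>A. c k * mulc z (g k) w)"
  by (induction A rule: finite_induct) (simp_all add: mulc_add_right mulc_scale_right)

lemma mulc_cong:
  assumes "\<And>u. u \<in> words (length w) \<Longrightarrow> x u = x' u" "\<And>u. u \<in> words (length w) \<Longrightarrow> y u = y' u"
    and "valid w"
  shows "mulc x y w = mulc x' y' w"
  unfolding mulc_eq_sum
proof (rule sum.cong[OF refl])
  fix u assume u: "u \<in> words (length w)"
  then have "map2 qidx u w \<in> words (length w)"
    using assms(3) by (intro map2_qidx_words) (simp_all add: words_valid)
  then show "wsgn u (map2 qidx u w) * x u * y (map2 qidx u w) =
      wsgn u (map2 qidx u w) * x' u * y' (map2 qidx u w)"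
    using assms(1,2) u by simp
qed

lemma qidx_table [simp]:
  "qidx (Suc 0) (Suc 0) = 0" "qidx (Suc 0) 2 = 3" "qidx (Suc 0) 3 = 2" 
  "qidx 2 (Suc 0) = 3" "qidx 2 2 = 0" "qidx 2 3 = 1"
  "qidx 3 (Suc 0) = 2" "qidx 3 2 = 1" "qidx 3 3 = 0"
  by (simp_all add: qidx_def)

lemma qsgn_table [simp]:
  "qsgn (Suc 0) (Suc 0) = -1" "qsgn (Suc 0) 2 = 1" "qsgn (Suc 0) 3 = -1" 
  "qsgn 2 (Suc 0) = -1" "qsgn 2 2 = -1" "qsgn 2 3 = 1"
  "qsgn 3 (Suc 0) = 1" "qsgn 3 2 = -1" "qsgn 3 3 = -1"
  by (simp_all add: qsgn_def)

text \<open>Associativity of the quaternions on basis elements: both sides are the sign of a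
  threefold product with middle letter \<open>qidx k j\<close>, bracketed in the two ways.\<close>

lemma qsgn_cocycle:
  "i < 4 \<Longrightarrow> j < 4 \<Longrightarrow> k < 4 \<Longrightarrow>
   qsgn j (qidx j i) * qsgn k (qidx k j) = qsgn k (qidx k i) * (qsgn (qidx k j) (qidx j i) :: complex)"
  by (simp only: less4) (elim disjE; simp)

lemma qidx_cancel_left: "i < 4 \<Longrightarrow> j < 4 \<Longrightarrow> k < 4 \<Longrightarrow> qidx (qidx k j) (qidx k i) = qidx j i"
  by (simp only: less4) (elim disjE; simp)

lemma mulc_assoc: "valid w \<Longrightarrow> mulc (mulc x y) z w = mulc x (mulc y z) w"
proof (induction w arbitrary: x y z)
  case (Cons i w)
  then have i: "i < 4" by simp
  define G where "G a b c = mulc (\<lambda>u. x (a # u)) (mulc (\<lambda>u. y (b # u)) (\<lambda>u. z (c # u))) w" for a b c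
  have "mulc (mulc x y) z (i # w) = (\<Sum>j<4. \<Sum>k<4. (qsgn j (qidx j i) * qsgn k (qidx k j)) *
      G k (qidx k j) (qidx j i))"
    using Cons by (simp add: mulc_lincomb_left sum_distrib_left G_def mult.assoc)
  also have "\<dots> = (\<Sum>k<4. \<Sum>j<4. (qsgn j (qidx j i) * qsgn k (qidx k j)) * G k (qidx k j) (qidx j i))"
    by (rule sum.swap)
  \<comment> \<open>For fixed k the substitution \<open>b = qidx k j\<close> is an involution on the
    letters; b becomes the letter of the middle factor.\<close>
  also have "\<dots> = (\<Sum>k<4. \<Sum>b<4. (qsgn k (qidx k i) * qsgn b (qidx b (qidx k i))) *
      G k b (qidx b (qidx k i)))"
  proof (rule sum.cong[OF refl])
    fix k :: nat assume k: "k \<in> {..<4}"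
    show "(\<Sum>j<4. (qsgn j (qidx j i) * qsgn k (qidx k j)) * G k (qidx k j) (qidx j i)) =
      (\<Sum>b<4. (qsgn k (qidx k i) * qsgn b (qidx b (qidx k i))) * G k b (qidx b (qidx k i)))"
      by (rule sum.reindex_bij_witness[of _ "qidx k" "qidx k"])
         (use i k in \<open>auto simp: qidx_self_cancel qidx_cancel_left qsgn_cocycle\<close>)
  qed
  also have "\<dots> = mulc x (mulc y z) (i # w)"
    using Cons by (simp add: mulc_lincomb_right sum_distrib_left G_def mult.assoc)
  finally show ?case .
qed simp

definition onec :: "complex tensor" where
  "onec w = (if set w \<subseteq> {0} then 1 else 0)"

lemma onec_simps [simp]: "onec [] = 1" "onec (i # w) = (if i = 0 then onec w else 0)"
  by (auto simp: onec_def)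

lemma mulc_one_left: "valid w \<Longrightarrow> mulc onec x w = x w"
proof (induction w arbitrary: x)
  case (Cons i w)
  have *: "(\<lambda>u. onec (j # u)) = (if j = 0 then onec else (\<lambda>u. 0))" for j by auto
  show ?case using Cons by (simp add: * sum4)
qed simp

lemma mulc_one_right: "valid w \<Longrightarrow> mulc x onec w = x w"
proof (induction w arbitrary: x)
  case (Cons i w)
  have *: "(\<lambda>u. onec (j # u)) = (if j = 0 then onec else (\<lambda>u. 0))" for j by auto
  show ?case using Cons by (auto simp: * sum4 less4)
qed simp

text \<open>The ring of all families of tensors, one in each degree, with degreewise multiplication:
  it contains every tensor power at once, so that one type serves all \<open>n\<close>.\<close>

typedef ht = "{x :: complex tensor. \<forall>w. \<not> valid w \<longrightarrow> x w = 0}"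
  morphisms cf Abs_ht
  by (rule exI[of _ "\<lambda>w. 0"]) simp

text \<open>Discarding the coefficients at invalid words makes the map total, so that most
  translation lemmas need no membership premise.\<close>

definition to_ht :: "complex tensor \<Rightarrow> ht" where
  "to_ht x = Abs_ht (\<lambda>w. if valid w then x w else 0)"

lemma cf_mk: "cf (to_ht x) w = (if valid w then x w else 0)"
  by (simp add: to_ht_def Abs_ht_inverse)

lemma cf_mk_valid [simp]: "valid w \<Longrightarrow> cf (to_ht x) w = x w"
  by (simp add: cf_mk)

lemma cf_invalid: "\<not> valid w \<Longrightarrow> cf x w = 0"
  using cf[of x] by auto

lemma ht_eqI: "(\<And>w. valid w \<Longrightarrow> cf x w = cf y w) \<Longrightarrow> x = y"
  by (metis cf_inject cf_invalid ext)

lemma to_ht_cf [simp]: "to_ht (cf x) = x"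
  by (rule ht_eqI) simp

instantiation ht :: ring_1
begin
definition "0 = to_ht (\<lambda>w. 0)"
definition "1 = to_ht onec"
definition "x + y = to_ht (\<lambda>w. cf x w + cf y w)"
definition "x - y = to_ht (\<lambda>w. cf x w - cf y w)"
definition "- x = to_ht (\<lambda>w. - cf x w)"
definition "x * y = to_ht (mulc (cf x) (cf y))"

lemma cf_ring_simps:
  "cf 0 w = 0" "cf (x + y) w = cf x w + cf y w"
  "cf (x - y) w = cf x w - cf y w" "cf (- x) w = - cf x w"
  by (simp_all add: zero_ht_def plus_ht_def minus_ht_def uminus_ht_def cf_mk cf_invalid)

lemma cf_one: "valid w \<Longrightarrow> cf 1 w = onec w"
  by (simp add: one_ht_def)

lemma cf_times: "valid w \<Longrightarrow> cf (x * y) w = mulc (cf x) (cf y) w"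
  by (simp add: times_ht_def)

instance
proof
  fix a b c :: ht
  have cong: "mulc (cf (a * b)) x w = mulc (mulc (cf a) (cf b)) x w" 
      "mulc x (cf (a * b)) w = mulc x (mulc (cf a) (cf b)) w" if "valid w" for a b x w
    using that by (auto intro!: mulc_cong simp: cf_times words_valid)
  show "a * b * c = a * (b * c)"
    by (rule ht_eqI) (simp add: cf_times cong mulc_assoc)
  have cong1: "mulc (cf 1) x w = mulc onec x w" "mulc x (cf 1) w = mulc x onec w" if "valid w" for x w
    using that by (auto intro!: mulc_cong simp: cf_one words_valid)
  show "1 * a = a" "a * 1 = a"
    by (rule ht_eqI; simp add: cf_times cong1 mulc_one_left mulc_one_right)+
  have c: "cf (x + y) = (\<lambda>w. cf x w + cf y w)" for x y by (simp add: cf_ring_simps fun_eq_iff)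
  show "(a + b) * c = a * c + b * c" "a * (b + c) = a * b + a * c"
    by (rule ht_eqI; simp add: cf_times cf_ring_simps c mulc_add_left mulc_add_right)+
  have "cf 0 [] \<noteq> cf 1 []" by (simp add: cf_ring_simps cf_one)
  then show "(0::ht) \<noteq> 1" by metis
qed (auto intro!: ht_eqI simp: cf_ring_simps)
end

lemmas [simp] = cf_ring_simps

lemma cf_sum: "cf (\<Sum>i\<in>A. f i) w = (\<Sum>i\<in>A. cf (f i) w)"
  by (induction A rule: infinite_finite_induct) auto

definition scl :: "complex \<Rightarrow> ht \<Rightarrow> ht" (infixr "*\<^sub>c" 75) where
  "c *\<^sub>c x = to_ht (\<lambda>w. c * cf x w)"

lemma cf_scl [simp]: "cf (c *\<^sub>c x) w = c * cf x w"
  by (simp add: scl_def cf_mk cf_invalid)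

lemma scl_simps [simp]:
  "0 *\<^sub>c x = 0" "c *\<^sub>c (0::ht) = 0" "1 *\<^sub>c x = x" "a *\<^sub>c b *\<^sub>c x = (a * b) *\<^sub>c x"
  "a *\<^sub>c - x = (- a) *\<^sub>c x"
  by (auto intro!: ht_eqI)

lemma scl_distribs:
  "c *\<^sub>c (x + y) = c *\<^sub>c x + c *\<^sub>c y" "c *\<^sub>c (x - y) = c *\<^sub>c x - c *\<^sub>c y"
  "(a + b) *\<^sub>c x = a *\<^sub>c x + b *\<^sub>c x" "(a - b) *\<^sub>c x = a *\<^sub>c x - b *\<^sub>c x"
  by (auto intro!: ht_eqI simp: algebra_simps)

lemma minus_eq_scl: "- x = (- 1) *\<^sub>c x"
  by (auto intro!: ht_eqI)

lemma scl_mult_left [simp]: "(c *\<^sub>c x) * y = c *\<^sub>c (x * y)"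
  and scl_mult_right [simp]: "x * (c *\<^sub>c y) = c *\<^sub>c (x * y)"
proof -
  have c: "cf (c *\<^sub>c x) = (\<lambda>w. c * cf x w)" for x by (simp add: fun_eq_iff)
  show "(c *\<^sub>c x) * y = c *\<^sub>c (x * y)" "x * (c *\<^sub>c y) = c *\<^sub>c (x * y)"
    by (rule ht_eqI; simp add: cf_times c mulc_scale_left mulc_scale_right)+
qed

lemma scl_sum: "c *\<^sub>c (\<Sum>i\<in>A. f i) = (\<Sum>i\<in>A. c *\<^sub>c f i)"
  by (rule ht_eqI) (simp add: cf_sum sum_distrib_left)

lemma scl_eq_0_iff [simp]: "c *\<^sub>c x = 0 \<longleftrightarrow> c = 0 \<or> x = 0"
proof
  assume "c *\<^sub>c x = 0"
  then have "inverse c *\<^sub>c (c *\<^sub>c x) = inverse c *\<^sub>c 0" by (rule arg_cong)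
  then show "c = 0 \<or> x = 0" by (cases "c = 0") simp_all
qed auto

lemma scl_eq_scl_iff: "a *\<^sub>c x = b *\<^sub>c x \<longleftrightarrow> a = b \<or> x = 0"
  using scl_eq_0_iff[of "a - b" x] by (simp add: scl_distribs)

text \<open>Contraction of the first tensor factor with the dual of \<open>e_i\<close>. A family is
  determined by its value at the empty word and its four shifts, and each shift lowers the degree by
  one; this drives the inductions on the degree.\<close>

definition shift :: "nat \<Rightarrow> ht \<Rightarrow> ht" where
  "shift i x = to_ht (\<lambda>w. cf x (i # w))"

lemma cf_sh [simp]: "cf (shift i x) w = cf x (i # w)"
  by (simp add: shift_def cf_mk cf_invalid)

lemma shift_linear [simp]:
  "shift i 0 = 0" "shift i (x + y) = shift i x + shift i y" "shift i (x - y) = shift i x - shift i y"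
  "shift i (c *\<^sub>c x) = c *\<^sub>c shift i x" "shift i (- x) = - shift i x"
  by (auto intro!: ht_eqI)

lemma shift_times: "i < 4 \<Longrightarrow>
  shift i (x * y) = (\<Sum>j<4. qsgn j (qidx j i) *\<^sub>c (shift j x * shift (qidx j i) y))"
proof (rule ht_eqI)
  fix w assume "i < 4" "valid w"
  moreover have "cf (shift j z) = (\<lambda>u. cf z (j # u))" for j z by (simp add: fun_eq_iff)
  ultimately show "cf (shift i (x * y)) w =
      cf (\<Sum>j<4. qsgn j (qidx j i) *\<^sub>c (shift j x * shift (qidx j i) y)) w"
    by (simp add: cf_times cf_sum)
qed

lemma cf_times_Nil [simp]: "cf (x * y) [] = cf x [] * cf y []"
  by (simp add: cf_times)

lemma shift_1: "shift i 1 = (if i = 0 then 1 else 0)"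
proof (rule ht_eqI)
  fix w assume "valid w"
  then show "cf (shift i 1) w = cf (if i = 0 then 1 else 0) w"
    by (cases "i < 4") (simp_all add: cf_one cf_invalid)
qed

lemma ht_eqI_sh: "cf x [] = cf y [] \<Longrightarrow> (\<And>i. i < 4 \<Longrightarrow> shift i x = shift i y) \<Longrightarrow> x = y"
proof (rule ht_eqI)
  fix w assume *: "cf x [] = cf y []" "\<And>i. i < 4 \<Longrightarrow> shift i x = shift i y" "valid w"
  show "cf x w = cf y w"
  proof (cases w)
    case (Cons i u)
    then have "shift i x = shift i y" using * by simp
    then have "cf (shift i x) u = cf (shift i y) u" by simp
    then show ?thesis using Cons by simp
  qed (use * in simp)
qed

section \<open>Power sums of units and concatenation\<close>

text \<open>Stripping a letter multiplies the coefficient by a constant, so by induction on the word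
  every coefficient is a multiple of the one at the empty word.\<close>

lemma eq_0_if_sh_proportional:
  assumes "cf Z [] = 0" "\<And>i. i < 4 \<Longrightarrow> \<exists>c. shift i Z = c *\<^sub>c Z"
  shows "Z = 0"
proof (rule ht_eqI)
  fix w show "valid w \<Longrightarrow> cf Z w = cf 0 w"
  proof (induction w)
    case (Cons i w)
    then obtain c where c: "shift i Z = c *\<^sub>c Z" using assms(2) by auto
    have "cf Z (i # w) = cf (shift i Z) w" by simp
    also have "\<dots> = c * cf Z w" by (simp only: c cf_scl)
    also have "\<dots> = 0" using Cons by simp
    finally show ?case by simp
  qed (use assms in simp)
qed

lemma shift_sum: "shift i (\<Sum>k\<in>A. f k) = (\<Sum>k\<in>A. shift i (f k))"
  by (rule ht_eqI) (simp add: cf_sum)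

fun dcf :: "nat \<Rightarrow> complex tensor" where
  "dcf j [] = 0"
| "dcf j (i # w) = (if i = 0 then dcf j w else if i = j then onec w else 0)"

text \<open>For j = 1, 2, 3 the degree n part is the sum over the n positions of \<open>e_j\<close>
  in that position and 1 elsewhere: the diagonal action of the Lie algebra element
  \<open>e_j\<close>. The letter 0 is tested first in \<open>dcf\<close>, so the degenerate case j =
  0 gives 0.\<close>

definition Esum :: "nat \<Rightarrow> ht" where "Esum j = to_ht (dcf j)"

lemma cf_D_Nil [simp]: "cf (Esum j) [] = 0"
  by (simp add: Esum_def)

lemma shift_D: "j < 4 \<Longrightarrow> shift i (Esum j) = (if i = 0 then Esum j else if i = j then 1 else 0)"
  by (rule ht_eqI) (auto simp: Esum_def cf_mk cf_one)

text \<open>Leibniz rule: the inserted \<open>e_j\<close> meets either a later position or the first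
  one; in the latter case only the first letter \<open>qidx j i\<close> of X produces
  \<open>e_i\<close>.\<close>

lemma shift_D_mult:
  assumes "i < 4" "j < 4" "j \<noteq> 0"
  shows "shift i (Esum j * X) = Esum j * shift i X + qsgn j (qidx j i) *\<^sub>c shift (qidx j i) X"
proof -
  have "j = Suc 0 \<or> j = 2 \<or> j = 3" using assms by auto
  then show ?thesis using assms(1) by (auto simp: shift_times sum4 shift_D)
qed

lemma shift_mult_D:
  assumes "i < 4" "j < 4" "j \<noteq> 0"
  shows "shift i (X * Esum j) = shift i X * Esum j + qsgn (qidx i j) j *\<^sub>c shift (qidx i j) X"
proof -
  have "j = Suc 0 \<or> j = 2 \<or> j = 3" using assms by auto
  moreover have "i = 0 \<or> i = Suc 0 \<or> i = 2 \<or> i = 3" using assms by auto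
  ultimately show ?thesis
    by (elim disjE) (simp_all add: shift_times sum4 shift_D)
qed

text \<open>Letters in different positions commute, so only the terms with both letters in one
  position remain, and there these are the commutators of the quaternion units.\<close>

lemma Esum_commutator:
  "Esum 1 * Esum 2 - Esum 2 * Esum 1 = 2 *\<^sub>c Esum 3"
  "Esum 2 * Esum 3 - Esum 3 * Esum 2 = 2 *\<^sub>c Esum 1"
  "Esum 3 * Esum 1 - Esum 1 * Esum 3 = 2 *\<^sub>c Esum 2"
proof -
  have *: "x - (- 1) *\<^sub>c x = 2 *\<^sub>c x" for x by (rule ht_eqI) simp
  have "Esum 1 * Esum 2 - Esum 2 * Esum 1 - 2 *\<^sub>c Esum 3 = 0"
  proof (rule eq_0_if_sh_proportional)
    fix i :: nat assume "i < 4"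
    then show "\<exists>c. shift i (Esum 1 * Esum 2 - Esum 2 * Esum 1 - 2 *\<^sub>c Esum 3) = c *\<^sub>c (Esum 1 * Esum 2 - Esum 2 * Esum 1 - 2 *\<^sub>c Esum 3)"
      by (intro exI[of _ "if i = 0 then 1 else 0"])
         (auto simp: less4 shift_D_mult shift_D shift_1 *)
  qed simp
  moreover have "Esum 2 * Esum 3 - Esum 3 * Esum 2 - 2 *\<^sub>c Esum 1 = 0"
  proof (rule eq_0_if_sh_proportional)
    fix i :: nat assume "i < 4"
    then show "\<exists>c. shift i (Esum 2 * Esum 3 - Esum 3 * Esum 2 - 2 *\<^sub>c Esum 1) = c *\<^sub>c (Esum 2 * Esum 3 - Esum 3 * Esum 2 - 2 *\<^sub>c Esum 1)"
      by (intro exI[of _ "if i = 0 then 1 else 0"])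
         (auto simp: less4 shift_D_mult shift_D shift_1 *)
  qed simp
  moreover have "Esum 3 * Esum 1 - Esum 1 * Esum 3 - 2 *\<^sub>c Esum 2 = 0"
  proof (rule eq_0_if_sh_proportional)
    fix i :: nat assume "i < 4"
    then show "\<exists>c. shift i (Esum 3 * Esum 1 - Esum 1 * Esum 3 - 2 *\<^sub>c Esum 2) = c *\<^sub>c (Esum 3 * Esum 1 - Esum 1 * Esum 3 - 2 *\<^sub>c Esum 2)"
      by (intro exI[of _ "if i = 0 then 1 else 0"])
         (auto simp: less4 shift_D_mult shift_D shift_1 *)
  qed simp
  ultimately show "Esum 1 * Esum 2 - Esum 2 * Esum 1 = 2 *\<^sub>c Esum 3"
      "Esum 2 * Esum 3 - Esum 3 * Esum 2 = 2 *\<^sub>c Esum 1" "Esum 3 * Esum 1 - Esum 1 * Esum 3 = 2 *\<^sub>c Esum 2"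
    by (simp_all add: right_minus_eq)
qed

text \<open>The unit of the n-th tensor power alone, as opposed to the ring unit, which is 1 in all
  degrees. It is a central idempotent, and multiplication by it extracts the degree n part.\<close>

definition hunit :: "nat \<Rightarrow> ht" where "hunit n = to_ht (tone n)"

lemma cf_pr: "cf (hunit n) w = (if w = replicate n 0 then 1 else 0)"
  by (auto simp: hunit_def cf_mk tone_def)

lemma tone_eq_onec: "length w = n \<Longrightarrow> tone n w = onec w"
  unfolding tone_def onec_def
  by (metis insert_iff replicate_eqI set_replicate_conv_if singletonD subset_iff subsetI empty_iff)

lemma cf_pr_times: "cf (hunit n * X) w = (if length w = n then cf X w else 0)"
proof (cases "valid w")
  case True
  show ?thesis
  proof (cases "length w = n")
    case True
    have "mulc (cf (hunit n)) (cf X) w = mulc onec (cf X) w"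
      using True \<open>valid w\<close> by (intro mulc_cong) (auto simp: hunit_def words_valid tone_eq_onec)
    then show ?thesis using True \<open>valid w\<close> by (simp add: cf_times mulc_one_left)
  next
    case False
    have "mulc (cf (hunit n)) (cf X) w = mulc (\<lambda>_. 0) (cf X) w"
      using False \<open>valid w\<close> by (intro mulc_cong) (auto simp: cf_pr words_valid)
    then show ?thesis using False \<open>valid w\<close> by (simp add: cf_times)
  qed
qed (simp add: cf_invalid)

lemma cf_times_pr: "cf (X * hunit n) w = (if length w = n then cf X w else 0)"
proof (cases "valid w")
  case True
  show ?thesis
  proof (cases "length w = n")
    case True
    have "mulc (cf X) (cf (hunit n)) w = mulc (cf X) onec w"
      using True \<open>valid w\<close> by (intro mulc_cong) (auto simp: hunit_def words_valid tone_eq_onec)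
    then show ?thesis using True \<open>valid w\<close> by (simp add: cf_times mulc_one_right)
  next
    case False
    have "mulc (cf X) (cf (hunit n)) w = mulc (cf X) (\<lambda>_. 0) w"
      using False \<open>valid w\<close> by (intro mulc_cong) (auto simp: cf_pr words_valid)
    then show ?thesis using False \<open>valid w\<close> by (simp add: cf_times)
  qed
qed (simp add: cf_invalid)

lemma hunit_commute: "X * hunit n = hunit n * X"
  by (rule ht_eqI) (simp add: cf_pr_times cf_times_pr)

definition deg :: "nat \<Rightarrow> ht \<Rightarrow> bool" where
  "deg n X \<longleftrightarrow> hunit n * X = X"

lemma deg_iff: "deg n X \<longleftrightarrow> (\<forall>w. length w \<noteq> n \<longrightarrow> cf X w = 0)"
  unfolding deg_def by (metis cf_pr_times ht_eqI)

lemma hunit_idem [simp]: "hunit n * hunit n = hunit n"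
  by (rule ht_eqI) (auto simp: cf_pr_times cf_pr)

lemma deg_pr [simp]: "deg n (hunit n)"
  by (simp add: deg_def)

lemma deg_mult_left [simp]: "deg n X \<Longrightarrow> deg n (X * Y)"
  by (metis deg_def mult.assoc)

lemma deg_mult_right [simp]: "deg n Y \<Longrightarrow> deg n (X * Y)"
  by (metis deg_def mult.assoc hunit_commute)

lemma deg_linear [simp]: "deg n 0" "deg n X \<Longrightarrow> deg n Y \<Longrightarrow> deg n (X + Y)"
  "deg n X \<Longrightarrow> deg n Y \<Longrightarrow> deg n (X - Y)" "deg n X \<Longrightarrow> deg n (c *\<^sub>c X)"
  by (auto simp: deg_iff)

lemma deg_sum: "(\<And>i. i \<in> A \<Longrightarrow> deg n (f i)) \<Longrightarrow> deg n (\<Sum>i\<in>A. f i)"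
  by (simp add: deg_iff cf_sum)

lemma deg_times_pr: "deg n X \<Longrightarrow> X * hunit n = X"
  by (simp add: deg_def hunit_commute)

lemma shift_pr: "shift i (hunit 0) = 0" "shift i (hunit (Suc n)) = (if i = 0 then hunit n else 0)"
  by (rule ht_eqI; auto simp: cf_pr)+

section \<open>Concatenation of tensors\<close>

definition tcat :: "nat \<Rightarrow> ht \<Rightarrow> ht \<Rightarrow> ht" where
  "tcat p X Y = to_ht (tconc p (cf X) (cf Y))"

lemma cf_tc: "cf (tcat p X Y) w = (if p \<le> length w then cf X (take p w) * cf Y (drop p w) else 0)"
proof (cases "valid w")
  case False
  then have "\<not> valid (take p w) \<or> \<not> valid (drop p w)"
    by (metis append_take_drop_id valid_simps(3))
  with False show ?thesis by (auto simp: cf_invalid)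
qed (simp add: tcat_def tconc_def)

lemma tcat_0 [simp]: "tcat 0 X Y = cf X [] *\<^sub>c Y"
  by (rule ht_eqI) (simp add: cf_tc)

lemma shift_tc [simp]: "shift i (tcat (Suc p) X Y) = tcat p (shift i X) Y"
  by (rule ht_eqI) (simp add: cf_tc)

lemma cf_tc_Nil [simp]: "cf (tcat (Suc p) X Y) [] = 0"
  by (simp add: cf_tc)

lemma tcat_linear [simp]:
  "tcat p 0 Y = 0" "tcat p X 0 = 0"
  "tcat p (c *\<^sub>c X) Y = c *\<^sub>c tcat p X Y" "tcat p X (c *\<^sub>c Y) = c *\<^sub>c tcat p X Y"
  by (rule ht_eqI; simp add: cf_tc)+

lemma tcat_add:
  "tcat p (X + X') Y = tcat p X Y + tcat p X' Y" "tcat p X (Y + Y') = tcat p X Y + tcat p X Y'"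
  "tcat p (X - X') Y = tcat p X Y - tcat p X' Y" "tcat p X (Y - Y') = tcat p X Y - tcat p X Y'"
  by (rule ht_eqI; simp add: cf_tc algebra_simps)+

lemma tcat_sum:
  "tcat p (\<Sum>i\<in>A. f i) Y = (\<Sum>i\<in>A. tcat p (f i) Y)" "tcat p X (\<Sum>i\<in>A. f i) = (\<Sum>i\<in>A. tcat p X (f i))"
  by (induction A rule: infinite_finite_induct) (simp_all add: tcat_add)

lemma tcat_mult: "tcat p X Y * tcat p X' Y' = tcat p (X * X') (Y * Y')"
proof (induction p arbitrary: X X')
  case (Suc p)
  show ?case
    by (rule ht_eqI_sh) (simp_all add: shift_times Suc tcat_sum)
qed (simp add: mult_ac)

text \<open>The sum over all positions splits at the cut, so the power sums act as derivations of
  concatenation. This is why weights add up.\<close>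

lemma Esum_tc: "j < 4 \<Longrightarrow> j \<noteq> 0 \<Longrightarrow> Esum j * tcat p X Y = tcat p (Esum j * X) Y + tcat p X (Esum j * Y)"
proof (induction p arbitrary: X)
  case (Suc p)
  show ?case
    by (rule ht_eqI_sh) (simp_all add: shift_D_mult Suc tcat_add)
qed simp

lemma tcat_D: "j < 4 \<Longrightarrow> j \<noteq> 0 \<Longrightarrow> tcat p X Y * Esum j = tcat p (X * Esum j) Y + tcat p X (Y * Esum j)"
proof (induction p arbitrary: X)
  case (Suc p)
  show ?case
    by (rule ht_eqI_sh) (simp_all add: shift_mult_D Suc tcat_add)
qed simp

lemma tcat_assoc: "tcat (p + q) (tcat p X Y) Z = tcat p X (tcat q Y Z)"
proof (induction p arbitrary: X)
  case (Suc p)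
  show ?case
    by (rule ht_eqI_sh) (simp_all add: Suc)
qed simp

lemma deg_tc: "deg q Y \<Longrightarrow> deg (p + q) (tcat p X Y)"
  by (auto simp: deg_iff cf_tc)

lemma tcat_pr: "tcat p (hunit p) (hunit q) = hunit (p + q)"
proof (induction p)
  case (Suc p)
  show ?case
    by (rule ht_eqI_sh) (simp_all add: Suc shift_pr cf_pr)
qed (simp add: cf_pr)

fun tcatpow :: "nat \<Rightarrow> ht \<Rightarrow> nat \<Rightarrow> ht" where
  "tcatpow d X 0 = hunit 0"
| "tcatpow d X (Suc k) = tcat d X (tcatpow d X k)"

lemma deg_tp: "deg (d * k) (tcatpow d X k)"
  by (induction k) (auto simp: deg_tc)

lemma tcat_pr_0: "deg p X \<Longrightarrow> tcat p X (hunit 0) = X"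
  by (rule ht_eqI) (auto simp: cf_tc cf_pr deg_iff)

lemma tcat_tp_add: "tcat (d * k) (tcatpow d X k) (tcatpow d X m) = tcatpow d X (k + m)"
proof (induction k)
  case (Suc k)
  then show ?case by (simp add: tcat_assoc)
qed (simp add: cf_pr)

section \<open>Symmetrization\<close>

abbreviation perms :: "nat \<Rightarrow> (nat \<Rightarrow> nat) set" where
  "perms n \<equiv> {\<sigma>. \<sigma> permutes {..<n}}"

definition permute :: "nat \<Rightarrow> (nat \<Rightarrow> nat) \<Rightarrow> ht \<Rightarrow> ht" where
  "permute n \<sigma> X = to_ht (perm_act n \<sigma> (cf X))"

definition symmetrize :: "nat \<Rightarrow> ht \<Rightarrow> ht" where
  "symmetrize n X = to_ht (symz n (cf X))"

lemma valid_permute_list: "\<sigma> permutes {..<length w} \<Longrightarrow> valid (permute_list \<sigma> w) = valid w"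
  by (simp add: valid_def)

lemma cf_act:
  assumes "\<sigma> permutes {..<n}"
  shows "cf (permute n \<sigma> X) w = (if length w = n then cf X (permute_list \<sigma> w) else 0)"
proof (cases "length w = n")
  case True
  then have "perm_act n \<sigma> (cf X) w = cf X (permute_list \<sigma> w)"
    by (simp add: perm_act_def permute_list_def)
  then show ?thesis
    using True assms by (auto simp: permute_def cf_mk cf_invalid valid_permute_list)
qed (simp add: permute_def cf_mk perm_act_def)

lemma symmetrize_eq: "symmetrize n X = (1 / fact n) *\<^sub>c (\<Sum>\<sigma>\<in>perms n. permute n \<sigma> X)"
  by (rule ht_eqI) (simp add: symmetrize_def symz_def cf_sum permute_def)

lemma card_perms: "card (perms n) = fact n"
  by (simp add: card_permutations)

lemma permute_linear [simp]:
  "permute n \<sigma> 0 = 0" "permute n \<sigma> (X + Y) = permute n \<sigma> X + permute n \<sigma> Y"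
  "permute n \<sigma> (X - Y) = permute n \<sigma> X - permute n \<sigma> Y" "permute n \<sigma> (c *\<^sub>c X) = c *\<^sub>c permute n \<sigma> X"
  by (rule ht_eqI; simp add: permute_def perm_act_def)+

lemma permute_sum: "permute n \<sigma> (\<Sum>i\<in>A. f i) = (\<Sum>i\<in>A. permute n \<sigma> (f i))"
  by (induction A rule: infinite_finite_induct) simp_all

lemma symmetrize_linear [simp]:
  "symmetrize n 0 = 0" "symmetrize n (c *\<^sub>c X) = c *\<^sub>c symmetrize n X"
  by (simp_all add: symmetrize_eq scl_sum mult.commute)

lemma symmetrize_add: "symmetrize n (X + Y) = symmetrize n X + symmetrize n Y" "symmetrize n (X - Y) = symmetrize n X - symmetrize n Y"
  by (simp_all add: symmetrize_eq sum.distrib sum_subtractf scl_distribs)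

lemma symmetrize_sum: "symmetrize n (\<Sum>i\<in>A. f i) = (\<Sum>i\<in>A. symmetrize n (f i))"
  by (induction A rule: infinite_finite_induct) (simp_all add: symmetrize_add)

lemma permute_act:
  assumes "\<sigma> permutes {..<n}" "\<tau> permutes {..<n}"
  shows "permute n \<sigma> (permute n \<tau> X) = permute n (\<sigma> \<circ> \<tau>) X"
  by (rule ht_eqI) (use assms in \<open>auto simp: cf_act permutes_compose permute_list_compose\<close>)

lemma symmetrize_act:
  assumes "\<sigma> permutes {..<n}"
  shows "symmetrize n (permute n \<sigma> X) = symmetrize n X"
proof -
  have "(\<Sum>\<tau>\<in>perms n. permute n \<tau> (permute n \<sigma> X)) = (\<Sum>\<tau>\<in>perms n. permute n (\<tau> \<circ> \<sigma>) X)"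
    using assms by (intro sum.cong) (auto simp: permute_act)
  also have "\<dots> = (\<Sum>\<tau>\<in>perms n. permute n \<tau> X)"
    using sum_permutations_compose_right[OF assms, of "\<lambda>\<tau>. permute n \<tau> X"] by simp
  finally show ?thesis by (simp add: symmetrize_eq)
qed

lemma permute_sy:
  assumes "\<sigma> permutes {..<n}"
  shows "permute n \<sigma> (symmetrize n X) = symmetrize n X"
proof -
  have "(\<Sum>\<tau>\<in>perms n. permute n \<sigma> (permute n \<tau> X)) = (\<Sum>\<tau>\<in>perms n. permute n (\<sigma> \<circ> \<tau>) X)"
    using assms by (intro sum.cong) (auto simp: permute_act)
  also have "\<dots> = (\<Sum>\<tau>\<in>perms n. permute n \<tau> X)"
    using setum_permutations_compose_left[OF assms, of "\<lambda>\<tau>. permute n \<tau> X"] by simp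
  finally show ?thesis by (simp add: symmetrize_eq permute_sum)
qed

lemma wsgn_permute:
  assumes "\<sigma> permutes {..<length u}" "length v = length u"
  shows "wsgn (permute_list \<sigma> u) (permute_list \<sigma> v) = (wsgn u v :: complex)"
proof -
  have "map2 qsgn (permute_list \<sigma> u) (permute_list \<sigma> v) = permute_list \<sigma> (map2 (qsgn :: _ \<Rightarrow> _ \<Rightarrow> complex) u v)"
    using assms by (simp add: permute_list_map permute_list_zip)
  then show ?thesis
    using assms by (simp add: wsgn_def flip: prod_mset_prod_list)
qed

lemma map2_qidx_permute:
  assumes "\<sigma> permutes {..<length u}" "length v = length u"
  shows "map2 qidx (permute_list \<sigma> u) (permute_list \<sigma> v) = permute_list \<sigma> (map2 qidx u v)"
  using assms by (simp add: permute_list_map permute_list_zip)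

lemma bij_betw_permute_list_words:
  assumes "\<sigma> permutes {..<n}"
  shows "bij_betw (permute_list \<sigma>) (words n) (words n)"
proof (rule bij_betw_byWitness[where f' = "permute_list (inv \<sigma>)"])
  have i: "inv \<sigma> permutes {..<n}" using assms by (rule permutes_inv)
  show "\<forall>a\<in>words n. permute_list (inv \<sigma>) (permute_list \<sigma> a) = a"
    using assms i by (auto simp: words_valid permutes_inv_o simp flip: permute_list_compose)
  show "\<forall>a\<in>words n. permute_list \<sigma> (permute_list (inv \<sigma>) a) = a"
    using assms i by (auto simp: words_valid permutes_inv_o simp flip: permute_list_compose)
qed (use assms in \<open>auto simp: words_valid valid_permute_list permutes_inv\<close>)

text \<open>The product is computed letter by letter, so it is compatible with permuting positions;
  the summation word is permuted along.\<close>

lemma permute_mult: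
  assumes "\<sigma> permutes {..<n}"
  shows "permute n \<sigma> (X * Y) = permute n \<sigma> X * permute n \<sigma> Y"
proof (rule ht_eqI)
  fix w assume w: "valid w"
  show "cf (permute n \<sigma> (X * Y)) w = cf (permute n \<sigma> X * permute n \<sigma> Y) w"
  proof (cases "length w = n")
    case True
    have "cf (permute n \<sigma> (X * Y)) w = (\<Sum>u\<in>words n. wsgn u (map2 qidx u (permute_list \<sigma> w)) * cf X u *
        cf Y (map2 qidx u (permute_list \<sigma> w)))"
      using assms w True by (simp add: cf_act cf_times valid_permute_list mulc_eq_sum)
    also have "\<dots> = (\<Sum>u\<in>words n. wsgn (permute_list \<sigma> u) (map2 qidx (permute_list \<sigma> u) (permute_list \<sigma> w)) *
        cf X (permute_list \<sigma> u) * cf Y (map2 qidx (permute_list \<sigma> u) (permute_list \<sigma> w)))"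
      by (rule sum.reindex_bij_betw[OF bij_betw_permute_list_words[OF assms], symmetric])
    also have "\<dots> = (\<Sum>u\<in>words n. wsgn u (map2 qidx u w) * cf (permute n \<sigma> X) u * cf (permute n \<sigma> Y) (map2 qidx u w))"
      using assms True
      by (intro sum.cong) (auto simp: words_valid map2_qidx_permute wsgn_permute cf_act)
    finally show ?thesis using True w by (simp add: cf_times mulc_eq_sum)
  next
    case False
    have "mulc (cf (permute n \<sigma> X)) (cf (permute n \<sigma> Y)) w = mulc (\<lambda>_. 0) (\<lambda>_. 0) w"
      using False w assms by (intro mulc_cong) (auto simp: cf_act words_valid)
    then show ?thesis using False w assms by (simp add: cf_times cf_act)
  qed
qed

definition symm :: "nat \<Rightarrow> ht \<Rightarrow> bool" where
  "symm n X \<longleftrightarrow> deg n X \<and> (\<forall>\<sigma>. \<sigma> permutes {..<n} \<longrightarrow> permute n \<sigma> X = X)"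

lemma symm_deg: "symm n X \<Longrightarrow> deg n X"
  by (simp add: symm_def)

lemma deg_act: "\<sigma> permutes {..<n} \<Longrightarrow> deg n (permute n \<sigma> X)"
  by (simp add: deg_iff cf_act)

lemma deg_sy: "deg n (symmetrize n X)"
  unfolding symmetrize_eq by (intro deg_linear deg_sum) (simp add: deg_act)

lemma symm_sy [simp]: "symm n (symmetrize n X)"
  by (simp add: symm_def deg_sy permute_sy)

lemma of_nat_mult_eq_scl: "of_nat k * X = of_nat k *\<^sub>c (X::ht)"
  by (induction k) (simp_all add: scl_distribs distrib_right)

lemma symmetrize_symm: "symm n X \<Longrightarrow> symmetrize n X = X"
  by (simp add: symmetrize_eq symm_def of_nat_mult_eq_scl card_perms)

lemma symm_mult: "symm n X \<Longrightarrow> symm n Y \<Longrightarrow> symm n (X * Y)"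
  by (simp add: symm_def permute_mult)

lemma symm_linear [simp]: "symm n 0" "symm n X \<Longrightarrow> symm n Y \<Longrightarrow> symm n (X + Y)"
  "symm n X \<Longrightarrow> symm n Y \<Longrightarrow> symm n (X - Y)" "symm n X \<Longrightarrow> symm n (c *\<^sub>c X)"
  by (auto simp: symm_def)

text \<open>Permuting positions preserves the multiset of letters, so invariance can be read off
  from coefficients that depend only on this multiset.\<close>

lemma symmI_mset:
  assumes "\<And>w. length w \<noteq> n \<Longrightarrow> cf X w = 0"
    and "\<And>w w'. length w = n \<Longrightarrow> valid w \<Longrightarrow> mset w = mset w' \<Longrightarrow> cf X w = cf X w'"
  shows "symm n X"
  unfolding symm_def
proof (intro conjI allI impI)
  show "deg n X" using assms by (simp add: deg_iff)
  fix \<sigma> assume \<sigma>: "\<sigma> permutes {..<n}"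
  show "permute n \<sigma> X = X"
  proof (rule ht_eqI)
    fix w assume w: "valid w"
    show "cf (permute n \<sigma> X) w = cf X w"
    proof (cases "length w = n")
      case True
      then have "cf X w = cf X (permute_list \<sigma> w)"
        using w \<sigma> by (intro assms(2)) simp_all
      then show ?thesis using True \<sigma> by (simp add: cf_act)
    qed (use \<sigma> assms(1) in \<open>simp add: cf_act\<close>)
  qed
qed

lemma symm_pr [simp]: "symm n (hunit n)"
proof (rule symmI_mset)
  fix w w' :: "nat list" assume *: "length w = n" "valid w" "mset w = mset w'"
  have "tone n w = onec w" "tone n w' = onec w'"
    using * by (auto simp: tone_eq_onec dest: mset_eq_length)
  moreover have "valid w'" "set w = set w'" using * by (auto simp: valid_def dest: mset_eq_setD)
  ultimately show "cf (hunit n) w = cf (hunit n) w'"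
    using * by (simp add: hunit_def onec_def)
qed (auto simp: cf_pr)

text \<open>Recasts the recursion in a form that depends only on the multiset of letters, as
  \<open>symmI_mset\<close> requires.\<close>

lemma dcf_eq: "j \<noteq> 0 \<Longrightarrow> dcf j w = (if filter_mset (\<lambda>i. i \<noteq> 0) (mset w) = {#j#} then 1 else 0)"
proof (induction w)
  case (Cons i w)
  have "filter_mset (\<lambda>i. i \<noteq> 0) (mset w) = {#} \<longleftrightarrow> set w \<subseteq> {0}"
    by (induction w) auto
  with Cons show ?case by (auto simp: onec_def)
qed simp

lemma symm_D: 
  assumes "j \<noteq> 0" shows "symm n (hunit n * Esum j)"
proof (rule symmI_mset)
  fix w w' :: "nat list" assume *: "length w = n" "valid w" "mset w = mset w'"
  moreover have "valid w'" "length w' = n" using * by (auto simp: valid_def dest: mset_eq_setD mset_eq_length)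
  ultimately show "cf (hunit n * Esum j) w = cf (hunit n * Esum j) w'"
    using assms by (simp add: cf_pr_times Esum_def dcf_eq)
qed (simp add: cf_pr_times)

lemma symmetrize_pr_mult: "symmetrize n (hunit n * X) = symmetrize n X"
proof -
  have "permute n \<sigma> (hunit n * X) = permute n \<sigma> X" if "\<sigma> permutes {..<n}" for \<sigma>
    by (rule ht_eqI) (use that in \<open>simp add: cf_act cf_pr_times\<close>)
  then show ?thesis by (simp add: symmetrize_eq)
qed

lemma symm_mult_sy: 
  assumes "symm n S" shows "S * symmetrize n X = symmetrize n (S * X)" "symmetrize n X * S = symmetrize n (X * S)"
  using assms by (simp_all add: symmetrize_eq sum_distrib_left sum_distrib_right permute_mult symm_def)

lemma Esum_sy: 
  assumes "j \<noteq> 0" shows "Esum j * symmetrize n X = symmetrize n (Esum j * X)" "symmetrize n X * Esum j = symmetrize n (X * Esum j)"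
proof -
  have "Esum j * symmetrize n X = (hunit n * Esum j) * symmetrize n X"
    using deg_sy[of n X] by (simp add: deg_def mult.assoc flip: hunit_commute)
  also have "\<dots> = symmetrize n (Esum j * X)"
    using symm_mult_sy(1)[OF symm_D[OF assms]] by (simp add: symmetrize_pr_mult mult.assoc)
  finally show "Esum j * symmetrize n X = symmetrize n (Esum j * X)" .
  have "symmetrize n X * Esum j = symmetrize n X * (hunit n * Esum j)"
    using deg_times_pr[OF deg_sy] by (simp flip: mult.assoc)
  also have "\<dots> = symmetrize n (X * Esum j)"
    using symm_mult_sy(2)[OF symm_D[OF assms]] symmetrize_pr_mult[of n "X * Esum j"]
    by (simp add: hunit_commute flip: mult.assoc)
  finally show "symmetrize n X * Esum j = symmetrize n (X * Esum j)" .
qed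

lemma permutes_lessThan_mono: "\<sigma> permutes {..<p} \<Longrightarrow> p \<le> n \<Longrightarrow> \<sigma> permutes {..<(n::nat)}"
  by (rule permutes_subset) auto

lemma permute_list_take_drop:
  assumes "\<sigma> permutes {..<p}" "p \<le> length w"
  shows "take p (permute_list \<sigma> w) = permute_list \<sigma> (take p w)"
    and "drop p (permute_list \<sigma> w) = drop p w"
proof -
  have letter: "\<sigma> i < p" if "i < p" for i using assms(1) that permutes_in_image by fastforce
  show "take p (permute_list \<sigma> w) = permute_list \<sigma> (take p w)"
    using assms letter by (intro nth_equalityI) (auto simp: permute_list_def)
  have fixed: "\<sigma> i = i" if "\<not> i < p" for i using assms(1) that by (auto simp: permutes_def)
  show "drop p (permute_list \<sigma> w) = drop p w"
    using assms fixed by (intro nth_equalityI) (auto simp: permute_list_def)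
qed

text \<open>A permutation of the first p positions extends to all n positions and is absorbed by the
  outer symmetrization; the inner one is an average of such permutations.\<close>

lemma symmetrize_tc_left:
  assumes "p \<le> n" shows "symmetrize n (tcat p (symmetrize p X) Y) = symmetrize n (tcat p X Y)"
proof -
  have *: "symmetrize n (tcat p (permute p \<sigma> X) Y) = symmetrize n (tcat p X Y)" if \<sigma>: "\<sigma> permutes {..<p}" for \<sigma>
  proof -
    have \<sigma>n: "\<sigma> permutes {..<n}" using \<sigma> assms by (rule permutes_lessThan_mono)
    have "hunit n * tcat p (permute p \<sigma> X) Y = permute n \<sigma> (tcat p X Y)"
      by (rule ht_eqI)
         (use assms in \<open>auto simp: cf_pr_times cf_act[OF \<sigma>] cf_act[OF \<sigma>n] cf_tc permute_list_take_drop[OF \<sigma>]\<close>)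
    then have "symmetrize n (tcat p (permute p \<sigma> X) Y) = symmetrize n (permute n \<sigma> (tcat p X Y))"
      using symmetrize_pr_mult[of n "tcat p (permute p \<sigma> X) Y"] by simp
    then show ?thesis by (simp add: symmetrize_act \<sigma>n)
  qed
  have "symmetrize n (tcat p (symmetrize p X) Y) = (1 / fact p) *\<^sub>c (\<Sum>\<sigma>\<in>perms p. symmetrize n (tcat p (permute p \<sigma> X) Y))"
    by (simp add: symmetrize_eq[of p] tcat_sum symmetrize_sum)
  also have "\<dots> = symmetrize n (tcat p X Y)"
    by (simp add: * of_nat_mult_eq_scl card_perms)
  finally show ?thesis .
qed

lemma rotation_permutes: "(\<lambda>i. if i < n then (i + p) mod n else i) permutes {..<n::nat}"
proof (rule bij_imp_permutes)
  let ?f = "\<lambda>i. if i < n then (i + p) mod n else i"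
  have "inj_on ?f {..<n}"
  proof (rule inj_onI)
    fix i j assume ij: "i \<in> {..<n}" "j \<in> {..<n}" "?f i = ?f j"
    then have "(i + p) mod n = (j + p) mod n" by simp
    then have "int (i + p) mod int n = int (j + p) mod int n"
      by (simp only: zmod_int[symmetric])
    then have "int n dvd int i - int j" by (simp only: mod_eq_dvd_iff) simp
    then show "i = j" using ij dvd_imp_le_int[of "int i - int j" "int n"] by fastforce
  qed
  moreover have "?f ` {..<n} \<subseteq> {..<n}" by auto
  ultimately show "bij_betw ?f {..<n} {..<n}"
    unfolding bij_betw_def by (intro conjI endo_inj_surj) simp_all
qed auto

text \<open>Rotation by p interchanges the two blocks, and symmetrization forgets it.\<close>

lemma symmetrize_tc_comm:
  assumes "n = p + q" shows "symmetrize n (tcat p X Y) = symmetrize n (tcat q Y X)"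
proof -
  define f where "f i = (if i < n then (i + p) mod n else i)" for i
  have f: "f permutes {..<n}" unfolding f_def by (rule rotation_permutes)
  have "permute_list f w = drop p w @ take p w" if w: "length w = n" for w :: "nat list"
  proof (rule nth_equalityI)
    fix i assume "i < length (permute_list f w)"
    then have i: "i < n" using w by simp
    show "permute_list f w ! i = (drop p w @ take p w) ! i"
    proof (cases "i < q")
      case True
      then show ?thesis using i w assms by (simp add: permute_list_def f_def nth_append add.commute)
    next
      case False
      then have "(i + p) mod n = i - q" using i assms by (simp add: mod_if)
      then show ?thesis using i w assms False by (simp add: permute_list_def f_def nth_append)
    qed
  qed (use w in simp)
  then have "hunit n * tcat p X Y = permute n f (tcat q Y X)"
    by (intro ht_eqI) (use assms in \<open>auto simp: cf_pr_times cf_act[OF f[unfolded assms]] cf_tc\<close>)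
  then have "symmetrize n (tcat p X Y) = symmetrize n (permute n f (tcat q Y X))"
    using symmetrize_pr_mult[of n "tcat p X Y"] by simp
  then show ?thesis by (simp only: symmetrize_act[OF f])
qed

lemma symmetrize_tc_right:
  assumes "n = p + q" shows "symmetrize n (tcat p X (symmetrize q Y)) = symmetrize n (tcat p X Y)"
proof -
  have "symmetrize n (tcat p X (symmetrize q Y)) = symmetrize n (tcat q (symmetrize q Y) X)" using assms by (rule symmetrize_tc_comm)
  also have "\<dots> = symmetrize n (tcat q Y X)" using assms by (simp add: symmetrize_tc_left)
  also have "\<dots> = symmetrize n (tcat p X Y)" using assms by (intro symmetrize_tc_comm) simp
  finally show ?thesis .
qed

section \<open>Generation of the symmetric tensors and the sl2 triple\<close>

definition letter :: "(nat \<Rightarrow> complex) \<Rightarrow> ht" where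
  "letter q = to_ht (ptens [q])"

lemma cf_lt_Nil [simp]: "cf (letter q) [] = 0"
  by (simp add: letter_def ptens_def)

lemma shift_lt: "i < 4 \<Longrightarrow> shift i (letter q) = q i *\<^sub>c hunit 0"
  by (rule ht_eqI) (auto simp: letter_def ptens_def cf_pr)

lemma deg_lt [simp]: "deg (Suc 0) (letter q)"
  by (auto simp: deg_iff letter_def cf_mk ptens_def)

lemma letter_cong: "(\<And>i. i < 4 \<Longrightarrow> q i = q' i) \<Longrightarrow> letter q = letter q'"
  by (rule ht_eqI_sh) (simp_all add: shift_lt)

lemma letter_linear: "c *\<^sub>c letter q = letter (\<lambda>i. c * q i)" "letter q + letter q' = letter (\<lambda>i. q i + q' i)"
  "letter q - letter q' = letter (\<lambda>i. q i - q' i)"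
  by (rule ht_eqI_sh; simp add: shift_lt scl_distribs)+

lemma letter_0: "letter (\<lambda>i. 0) = 0"
  by (rule ht_eqI_sh) (simp_all add: shift_lt)

lemma mult_pr_0: "X * hunit 0 = cf X [] *\<^sub>c hunit 0"
  by (rule ht_eqI) (auto simp: cf_times_pr cf_pr)

lemma Esum_pr_0 [simp]: "Esum j * hunit 0 = 0" "hunit 0 * Esum j = 0"
  by (simp_all add: mult_pr_0 flip: hunit_commute)

lemma Esum_lt:
  "j < 4 \<Longrightarrow> j \<noteq> 0 \<Longrightarrow> Esum j * letter q = letter (\<lambda>i. qsgn j (qidx j i) * q (qidx j i))"
  "j < 4 \<Longrightarrow> j \<noteq> 0 \<Longrightarrow> letter q * Esum j = letter (\<lambda>i. qsgn (qidx i j) j * q (qidx i j))"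
  by (rule ht_eqI_sh; simp add: shift_lt shift_D_mult shift_mult_D)+

abbreviation uletter :: "nat \<Rightarrow> ht" where
  "uletter j \<equiv> letter (\<lambda>i. if i = j then 1 else 0)"

lemma uletter_0: "uletter 0 = hunit (Suc 0)"
  by (rule ht_eqI_sh) (auto simp: shift_lt shift_pr cf_pr)

lemma Esum_pr_1: "j < 4 \<Longrightarrow> j \<noteq> 0 \<Longrightarrow> Esum j * hunit (Suc 0) = uletter j"
  unfolding uletter_0[symmetric]
  by (subst Esum_lt, simp, simp, rule letter_cong, simp only: less4) (elim disjE; simp add: less4)

text \<open>Together with associativity of concatenation this makes symmetrized products behave like
  monomials in commuting factors. The prefix can be swapped because an inner block may be
  symmetrized first.\<close>

lemma symmetrize_tc_swap:
  assumes "n = p + q + r"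
  shows "symmetrize n (tcat p X (tcat q Y Z)) = symmetrize n (tcat q Y (tcat p X Z))"
proof -
  have "symmetrize n (tcat p X (tcat q Y Z)) = symmetrize n (tcat (p + q) (symmetrize (p + q) (tcat p X Y)) Z)"
    using assms by (simp add: symmetrize_tc_left tcat_assoc)
  also have "symmetrize (p + q) (tcat p X Y) = symmetrize (q + p) (tcat q Y X)"
    using symmetrize_tc_comm[OF refl, of p q X Y] by (simp add: add.commute)
  also have "symmetrize n (tcat (p + q) (symmetrize (q + p) (tcat q Y X)) Z) = symmetrize n (tcat q Y (tcat p X Z))"
    using assms by (simp add: symmetrize_tc_left tcat_assoc add.commute[of p q])
  finally show ?thesis .
qed

text \<open>After symmetrization the m positions of \<open>e_j\<close> contribute equally. Read
  backwards, a single inserted letter is expressed by a power sum, which is what generation of the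
  symmetric tensors needs.\<close>

lemma symmetrize_D_pr:
  assumes "j < 4" "j \<noteq> 0"
  shows "symmetrize m (Esum j * hunit m) = of_nat m *\<^sub>c symmetrize m (tcat 1 (uletter j) (hunit (m - 1)))"
proof (induction m)
  case (Suc m)
  have "Esum j * hunit (Suc m) = tcat 1 (uletter j) (hunit m) + tcat 1 (hunit 1) (Esum j * hunit m)"
    using Esum_tc[OF assms, of 1 "hunit 1" "hunit m"] assms tcat_pr[of 1 m] by (simp add: Esum_pr_1)
  moreover have "symmetrize (Suc m) (tcat 1 (hunit 1) (Esum j * hunit m)) = of_nat m *\<^sub>c symmetrize (Suc m) (tcat 1 (uletter j) (hunit m))"
  proof (cases m)
    case (Suc k)
    have "symmetrize (Suc m) (tcat 1 (hunit 1) (Esum j * hunit m)) = symmetrize (Suc m) (tcat 1 (hunit 1) (symmetrize m (Esum j * hunit m)))"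
      by (rule symmetrize_tc_right[symmetric]) simp
    also have "\<dots> = of_nat m *\<^sub>c symmetrize (Suc m) (tcat 1 (hunit 1) (symmetrize m (tcat 1 (uletter j) (hunit (m - 1)))))"
      by (simp only: Suc.IH tcat_linear symmetrize_linear)
    also have "symmetrize (Suc m) (tcat 1 (hunit 1) (symmetrize m (tcat 1 (uletter j) (hunit (m - 1))))) =
        symmetrize (Suc m) (tcat 1 (hunit 1) (tcat 1 (uletter j) (hunit (m - 1))))"
      by (rule symmetrize_tc_right) simp
    also have "\<dots> = symmetrize (Suc m) (tcat 1 (uletter j) (tcat 1 (hunit 1) (hunit (m - 1))))"
      by (rule symmetrize_tc_swap[of _ _ _ k]) (simp add: Suc)
    also have "tcat 1 (hunit 1) (hunit (m - 1)) = hunit m"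
      using tcat_pr[of 1 k] by (simp add: Suc)
    finally show ?thesis .
  qed simp
  ultimately show ?case by (simp add: symmetrize_add scl_distribs)
qed simp

lemma tcat_Suc_expand:
  "tcat (Suc r) X Z = (\<Sum>j<4. tcat 1 (uletter j) (tcat r (shift j X) Z))"
proof (rule ht_eqI_sh)
  fix i :: nat assume i: "i < 4"
  have "shift i (tcat 1 (uletter j) (tcat r (shift j X) Z)) = (if i = j then tcat r (shift j X) Z else 0)" for j
    using i shift_tc[of i 0 "uletter j"] by (simp add: shift_lt cf_pr)
  then show "shift i (tcat (Suc r) X Z) = shift i (\<Sum>j<4. tcat 1 (uletter j) (tcat r (shift j X) Z))"
    using i by (simp add: shift_sum)
qed (simp add: cf_sum)

text \<open>In other words, the power sums of \<open>e\<^sub>1\<close>, \<open>e\<^sub>2\<close>, \<open>e\<^sub>3\<close> generate the algebra of symmetric tensors.\<close>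

lemma symm_induct [consumes 1, case_names add scale Esum one]:
  assumes X: "symm n X"
    and add: "\<And>x y. N x \<Longrightarrow> N y \<Longrightarrow> N (x + y)"
    and scale: "\<And>c x. N x \<Longrightarrow> N (c *\<^sub>c x)"
    and Esum: "\<And>j x. j < 4 \<Longrightarrow> j \<noteq> 0 \<Longrightarrow> N x \<Longrightarrow> N (Esum j * x)"
    and one: "N (hunit n)"
  shows "N X"
proof -
  have N_sum: "N (\<Sum>i\<in>A. f i)" if "\<And>i. i \<in> A \<Longrightarrow> N (f i)" for A :: "nat set" and f
    using that by (induction A rule: infinite_finite_induct) (auto intro: add scale[OF one, of 0, simplified])
  have diff: "N (x - y)" if "N x" "N y" for x y
    using add[OF that(1) scale[OF that(2), of "-1"]] by (simp flip: minus_eq_scl)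
  \<comment> \<open>Induction on the number r of arbitrary leading letters, the other n - r
    positions being filled with 1; r = n gives the symmetrization of any X.\<close>
  have "r \<le> n \<Longrightarrow> N (symmetrize n (tcat r X (hunit (n - r))))" for r X
  proof (induction r arbitrary: X)
    case 0
    then show ?case using scale[OF one] by (simp add: symmetrize_symm)
  next
    case (Suc r)
    define m where "m = n - r"
    have m: "m > 0" "n - Suc r = m - 1" "n = r + m" "n - r = m" using Suc.prems by (auto simp: m_def)
    have IH: "N (symmetrize n (tcat r Y (hunit m)))" for Y using Suc m by simp
    have "N (symmetrize n (tcat 1 (uletter j) (tcat r Y (hunit (m - 1)))))" if j: "j < 4" for j Y
    proof -
      have sw: "symmetrize n (tcat 1 (uletter j) (tcat r Y (hunit (m - 1)))) = symmetrize n (tcat r Y (tcat 1 (uletter j) (hunit (m - 1))))"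
        by (rule symmetrize_tc_swap[of _ _ _ "m - 1"]) (use m in simp)
      show ?thesis
      proof (cases "j = 0")
        case True
        have "tcat 1 (uletter j) (hunit (m - 1)) = hunit m"
          using tcat_pr[of 1 "m - 1"] m by (simp add: True uletter_0)
        then show ?thesis unfolding sw using IH by simp
      next
        case False
        \<comment> \<open>The new letter lies in the padding of length m, where it amounts to
          \<open>1 / m\<close> times \<open>Esum j\<close>. The Leibniz rule trades this for
          \<open>Esum j\<close> acting from outside minus \<open>Esum j\<close> acting on the r
          leading letters, and the induction hypothesis covers both.\<close>
        have "symmetrize n (tcat r Y (tcat 1 (uletter j) (hunit (m - 1)))) = symmetrize n (tcat r Y (symmetrize m (tcat 1 (uletter j) (hunit (m - 1)))))"
          by (rule symmetrize_tc_right[symmetric]) (fact m)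
        also have "\<dots> = (1 / of_nat m) *\<^sub>c symmetrize n (tcat r Y (symmetrize m (Esum j * hunit m)))"
          using m by (simp add: symmetrize_D_pr[OF j False])
        also have "symmetrize n (tcat r Y (symmetrize m (Esum j * hunit m))) = symmetrize n (tcat r Y (Esum j * hunit m))"
          by (rule symmetrize_tc_right) (fact m)
        also have "\<dots> = Esum j * symmetrize n (tcat r Y (hunit m)) - symmetrize n (tcat r (Esum j * Y) (hunit m))"
          by (simp add: Esum_sy False Esum_tc j symmetrize_add)
        finally show ?thesis unfolding sw using IH by (auto intro!: scale diff Esum j False)
      qed
    qed
    then show ?case unfolding tcat_Suc_expand symmetrize_sum m by (intro N_sum) simp
  qed
  from this[of n X] X show ?thesis
    by (simp add: tcat_pr_0 symm_deg symmetrize_symm)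
qed

section \<open>The sl2 triple and its action on single letters\<close>

definition wt :: ht where "wt = \<i> *\<^sub>c Esum 1"
definition up :: ht where "up = (1/2) *\<^sub>c (Esum 2 + \<i> *\<^sub>c Esum 3)"
definition dn :: ht where "dn = (1/2) *\<^sub>c (\<i> *\<^sub>c Esum 3 - Esum 2)"

lemma Esum_eq: "Esum 1 = (- \<i>) *\<^sub>c wt" "Esum 2 = up - dn" "Esum 3 = (- \<i>) *\<^sub>c (up + dn)"
  by (rule ht_eqI; simp add: wt_def up_def dn_def algebra_simps)+

lemma wt_up: "wt * up = up * wt + 2 *\<^sub>c up"
  and wt_dn: "wt * dn = dn * wt - 2 *\<^sub>c dn"
  and up_dn: "up * dn = dn * up + wt"
proof -
  have c: "Esum (Suc 0) * Esum 2 = Esum 2 * Esum (Suc 0) + 2 *\<^sub>c Esum 3" "Esum 2 * Esum 3 = Esum 3 * Esum 2 + 2 *\<^sub>c Esum (Suc 0)"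
    "Esum (Suc 0) * Esum 3 = Esum 3 * Esum (Suc 0) - 2 *\<^sub>c Esum 2"
    using Esum_commutator by (simp_all add: algebra_simps)
  show "wt * up = up * wt + 2 *\<^sub>c up" "wt * dn = dn * wt - 2 *\<^sub>c dn" "up * dn = dn * up + wt"
    unfolding wt_def up_def dn_def
    by (rule ht_eqI; simp add: distrib_left distrib_right left_diff_distrib right_diff_distrib c;
        simp add: algebra_simps)+
qed

lemma tcat_derivations:
  "wt * tcat p X Y = tcat p (wt * X) Y + tcat p X (wt * Y)"
  "up * tcat p X Y = tcat p (up * X) Y + tcat p X (up * Y)"
  "dn * tcat p X Y = tcat p (dn * X) Y + tcat p X (dn * Y)"
  "tcat p X Y * wt = tcat p (X * wt) Y + tcat p X (Y * wt)"
  by (rule ht_eqI; simp add: wt_def up_def dn_def Esum_tc tcat_D tcat_add distrib_right left_diff_distrib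
      scl_distribs; simp add: algebra_simps)+

lemma wt_sy: "wt * symmetrize n X = symmetrize n (wt * X)" "symmetrize n X * wt = symmetrize n (X * wt)"
  by (simp_all add: wt_def Esum_sy)

lemma step_pr_0 [simp]: "wt * hunit 0 = 0" "up * hunit 0 = 0" "dn * hunit 0 = 0" "hunit 0 * wt = 0"
  by (simp_all add: wt_def up_def dn_def distrib_right left_diff_distrib)

definition la :: ht where "la = letter qa"
definition lc :: ht where "lc = letter qac"
text \<open>\<open>la\<close> and \<open>lf\<close>, of weights 1 and -1, form a basis of the left
  ideal generated by a, the standard two-dimensional module of the sl2 triple.\<close>

definition lf :: ht where "lf = dn * la"

lemma lf_eq: "lf = letter (\<lambda>i. if i = 2 then - 1/2 else if i = 3 then \<i>/2 else 0)"
  unfolding lf_def dn_def la_def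
  by (simp add: Esum_lt letter_linear left_diff_distrib, rule letter_cong, simp only: less4)
     (elim disjE; simp add: qa_def)

lemma letter_simps:
  "wt * la = la" "la * wt = la" "wt * lc = (- 1) *\<^sub>c lc" "lc * wt = (- 1) *\<^sub>c lc"
  "up * la = 0" "up * lf = la" "wt * lf = (- 1) *\<^sub>c lf"
proof -
  show "wt * la = la" "la * wt = la" "wt * lc = (- 1) *\<^sub>c lc" "lc * wt = (- 1) *\<^sub>c lc"
    unfolding wt_def la_def lc_def
    by (simp add: Esum_lt letter_linear, rule letter_cong, simp only: less4, elim disjE; simp add: qa_def qac_def)+
  show "up * la = 0"
    unfolding up_def la_def letter_0[symmetric]
    by (simp add: Esum_lt letter_linear distrib_right, rule letter_cong, simp only: less4, elim disjE; simp add: qa_def)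
  show "up * lf = la"
    unfolding up_def la_def lf_eq
    by (simp add: Esum_lt letter_linear distrib_right, rule letter_cong, simp only: less4, elim disjE; simp add: qa_def)
  show "wt * lf = (- 1) *\<^sub>c lf"
    unfolding wt_def lf_eq
    by (simp add: Esum_lt letter_linear distrib_right, rule letter_cong, simp only: less4, elim disjE; simp)
qed

lemma deg_letters [simp]: "deg (Suc 0) la" "deg (Suc 0) lc" "deg (Suc 0) lf"
  by (simp_all add: la_def lc_def lf_def)

lemma wt_tp: "wt * X = c *\<^sub>c X \<Longrightarrow> wt * tcatpow d X k = (of_nat k * c) *\<^sub>c tcatpow d X k"
  and tcatpow_wt: "X * wt = c *\<^sub>c X \<Longrightarrow> tcatpow d X k * wt = (of_nat k * c) *\<^sub>c tcatpow d X k"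
  by (induction k) (simp_all add: tcat_derivations scl_distribs distrib_right)

section \<open>Forms in the two primitive idempotents\<close>

text \<open>The binomial factor is left out so that these elements multiply like monomials under
  symmetrized concatenation; with it, \<open>wproj\<close> is an idempotent.\<close>

definition wmono :: "nat \<Rightarrow> nat \<Rightarrow> ht" where
  "wmono n k = symmetrize n (tcat k (tcatpow 1 la k) (tcatpow 1 lc (n - k)))"

lemma wt_mo:
  assumes "k \<le> n"
  shows "wt * wmono n k = (2 * of_nat k - of_nat n) *\<^sub>c wmono n k"
    and "wmono n k * wt = (2 * of_nat k - of_nat n) *\<^sub>c wmono n k"
proof -
  have 1: "wt * la = 1 *\<^sub>c la" "la * wt = 1 *\<^sub>c la" by (simp_all add: letter_simps)
  note wt_tp[OF 1(1)] tcatpow_wt[OF 1(2)] wt_tp[OF letter_simps(3)] tcatpow_wt[OF letter_simps(4)]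
  moreover have "of_nat k + - of_nat (n - k) = 2 * of_nat k - (of_nat n :: complex)"
    using assms by (simp add: of_nat_diff)
  ultimately show "wt * wmono n k = (2 * of_nat k - of_nat n) *\<^sub>c wmono n k"
    "wmono n k * wt = (2 * of_nat k - of_nat n) *\<^sub>c wmono n k"
    unfolding wmono_def by (simp_all add: wt_sy tcat_derivations symmetrize_add flip: scl_distribs)
qed

text \<open>\<open>z ^ k\<close> stands for the form \<open>a^k (a^c)^(n-k)\<close>; coefficients
  above degree n are ignored, hence the degree bound in \<open>rep\<close>.\<close>

definition psi :: "nat \<Rightarrow> complex poly \<Rightarrow> ht" where
  "psi n f = (\<Sum>k\<le>n. coeff f k *\<^sub>c wmono n k)"

lemma psi_linear: "psi n (f + g) = psi n f + psi n g" "psi n (smult c f) = c *\<^sub>c psi n f" "psi n 0 = 0"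
  by (simp_all add: psi_def sum.distrib scl_distribs scl_sum)

lemma psi_sum: "psi n (\<Sum>i\<in>A. f i) = (\<Sum>i\<in>A. psi n (f i))"
  by (induction A rule: infinite_finite_induct) (simp_all add: psi_linear)

lemma psi_monom: "k \<le> n \<Longrightarrow> psi n (monom c k) = c *\<^sub>c wmono n k"
proof -
  assume k: "k \<le> n"
  have "psi n (monom c k) = (\<Sum>i\<le>n. if k = i then c *\<^sub>c wmono n i else 0)"
    unfolding psi_def by (intro sum.cong) auto
  then show ?thesis using k by simp
qed

text \<open>Letters commute under symmetrization, so exponents add. Only the two middle blocks,
  \<open>lc\<close> from the left factor and \<open>la\<close> from the right one, have to change
  places.\<close>

lemma wmono_tc:
  assumes "k \<le> p" "j \<le> q"
  shows "symmetrize (p + q) (tcat p (wmono p k) (wmono q j)) = wmono (p + q) (k + j)"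
proof -
  let ?A = "tcatpow 1 la" and ?B = "tcatpow 1 lc"
  have pow: "tcat a (?A a) (?A b) = ?A (a + b)" "tcat a (?B a) (?B b) = ?B (a + b)" for a b
    using tcat_tp_add[of 1] by simp_all
  have "symmetrize (p + q) (tcat p (wmono p k) (wmono q j)) =
      symmetrize (p + q) (tcat (k + (p - k)) (tcat k (?A k) (?B (p - k))) (tcat j (?A j) (?B (q - j))))"
    using assms unfolding wmono_def by (simp add: symmetrize_tc_left symmetrize_tc_right)
  also have "\<dots> = symmetrize (p + q) (tcat k (?A k) (tcat (p - k) (?B (p - k)) (tcat j (?A j) (?B (q - j)))))"
    by (simp only: tcat_assoc)
  also have "\<dots> = symmetrize (p + q) (tcat k (?A k) (symmetrize (p - k + q) (tcat (p - k) (?B (p - k)) (tcat j (?A j) (?B (q - j))))))"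
    by (rule symmetrize_tc_right[symmetric]) (use assms in simp)
  also have "symmetrize (p - k + q) (tcat (p - k) (?B (p - k)) (tcat j (?A j) (?B (q - j)))) =
      symmetrize (p - k + q) (tcat j (?A j) (tcat (p - k) (?B (p - k)) (?B (q - j))))"
    by (rule symmetrize_tc_swap[of _ _ _ "q - j"]) (use assms in simp)
  also have "symmetrize (p + q) (tcat k (?A k) (symmetrize (p - k + q) (tcat j (?A j) (tcat (p - k) (?B (p - k)) (?B (q - j)))))) =
      symmetrize (p + q) (tcat k (?A k) (tcat j (?A j) (tcat (p - k) (?B (p - k)) (?B (q - j)))))"
    by (rule symmetrize_tc_right) (use assms in simp)
  also have "\<dots> = symmetrize (p + q) (tcat (k + j) (tcat k (?A k) (?A j)) (?B (p - k + (q - j))))"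
    by (simp only: tcat_assoc pow(2))
  also have "\<dots> = wmono (p + q) (k + j)"
    unfolding pow using assms by (simp add: wmono_def)
  finally show ?thesis .
qed

text \<open>\<open>rep n X f\<close>: the symmetrization of \<open>X\<close> is the homogeneous form of degree \<open>n\<close> in the commuting
  letters \<open>a\<close> and \<open>a\<^sup>c\<close> whose dehomogenization at \<open>a\<^sup>c = 1\<close> is \<open>f\<close>.\<close>

definition rep :: "nat \<Rightarrow> ht \<Rightarrow> complex poly \<Rightarrow> bool" where
  "rep n X f \<longleftrightarrow> degree f \<le> n \<and> symmetrize n X = psi n f"

text \<open>Concatenation of tensors becomes multiplication of polynomials; this is how the forms in
  (b) and (c) are computed.\<close>

lemma rep_tc:
  assumes "rep p X f" "rep q Y g"
  shows "rep (p + q) (tcat p X Y) (f * g)"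
  unfolding rep_def
proof
  show "degree (f * g) \<le> p + q"
    using assms degree_mult_le[of f g] unfolding rep_def by linarith
  have "symmetrize (p + q) (tcat p X Y) = symmetrize (p + q) (tcat p (symmetrize p X) (symmetrize q Y))"
    by (simp add: symmetrize_tc_left symmetrize_tc_right)
  also have "\<dots> = (\<Sum>k\<le>p. \<Sum>j\<le>q. (coeff f k * coeff g j) *\<^sub>c wmono (p + q) (k + j))"
    using assms
    by (subst sum.swap) (simp add: rep_def psi_def tcat_sum symmetrize_sum wmono_tc scl_sum mult.commute)
  also have "\<dots> = psi (p + q) ((\<Sum>k\<le>p. monom (coeff f k) k) * (\<Sum>j\<le>q. monom (coeff g j) j))"
    by (simp add: sum_distrib_left sum_distrib_right psi_sum mult_monom psi_monom)
       (rule sum.swap)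
  also have "\<dots> = psi (p + q) (f * g)"
    using assms unfolding rep_def by (simp add: poly_as_sum_of_monoms')
  finally show "symmetrize (p + q) (tcat p X Y) = psi (p + q) (f * g)" .
qed

lemma rep_tp:
  assumes "rep d X f" shows "rep (d * k) (tcatpow d X k) (f ^ k)"
proof (induction k)
  case 0
  have "symmetrize 0 (hunit 0) = psi 0 1"
    by (simp add: psi_def wmono_def cf_pr)
  then show ?case by (simp add: rep_def)
next
  case (Suc k)
  then show ?case using rep_tc[OF assms Suc] by simp
qed

lemma rep_pr: "rep n (hunit n) ([:1, 1:] ^ n)"
proof -
  have e: "hunit 1 = la + lc"
    unfolding la_def lc_def One_nat_def uletter_0[symmetric] letter_linear
    by (rule letter_cong, simp only: less4) (elim disjE; simp add: qa_def qac_def)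
  have "symmetrize 1 (hunit 1) = psi 1 [:1, 1:]"
    unfolding e by (simp add: psi_def wmono_def tcat_pr_0 symmetrize_add cf_pr)
  then have "rep 1 (hunit 1) [:1, 1:]" by (simp add: rep_def)
  from rep_tp[OF this, of n] have "rep n (tcatpow 1 (hunit 1) n) ([:1, 1:] ^ n)" by simp
  moreover have "tcatpow 1 (hunit 1) n = hunit n"
  proof (induction n)
    case (Suc n)
    then show ?case using tcat_pr[of 1 n] by simp
  qed simp
  ultimately show ?thesis by simp
qed

lemma rep_sqH: "rep 2 (to_ht sqH) [:0, 2:]" and rep_sqHc: "rep 2 (to_ht sqHc) [:1, 0, 1:]"
proof -
  have tcat: "shift j (shift i (tcat 1 (letter q) (letter r))) = (q i * r j) *\<^sub>c hunit 0" if "i < 4" "j < 4" for i j q r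
    using that shift_tc[of i 0 "letter q"] by (simp add: shift_lt cf_pr)
  \<comment> \<open>All tensors here have degree two, so after stripping two letters only scalar
    multiples of \<open>hunit 0\<close> remain to be compared.\<close>
  have e1: "to_ht sqH = tcat 1 la lc + tcat 1 lc la" and e2: "to_ht sqHc = tcat 1 la la + tcat 1 lc lc"
  proof -
    have s: "shift j (shift i (to_ht sqH)) = (if i = j \<and> i < 2 then 1/2 else 0) *\<^sub>c hunit 0"
      "shift j (shift i (to_ht sqHc)) = (if i = j \<and> i < 2 then (if i = 0 then 1/2 else -1/2) else 0) *\<^sub>c hunit 0"
      if "i < 4" "j < 4" for i j
      using that by (auto intro!: ht_eqI simp: sqH_def sqHc_def cf_pr)
    have z: "cf (shift i (to_ht sqH)) [] = 0" "cf (shift i (to_ht sqHc)) [] = 0" if "i < 4" for i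
      using that by (auto simp: sqH_def sqHc_def)
    have z': "cf (tcat 1 (letter q) (letter r)) [i] = 0" for i q r by (simp add: cf_tc)
    show "to_ht sqH = tcat 1 la lc + tcat 1 lc la"
    proof (rule ht_eqI_sh)
      fix i :: nat assume i: "i < 4"
      show "shift i (to_ht sqH) = shift i (tcat 1 la lc + tcat 1 lc la)"
      proof (rule ht_eqI_sh)
        fix j :: nat assume j: "j < 4"
        have "(if i = j \<and> i < 2 then 1/2 else 0) = qa i * qac j + qac i * qa j"
          using i j by (simp only: less4) (elim disjE; simp add: qa_def qac_def)
        then show "shift j (shift i (to_ht sqH)) = shift j (shift i (tcat 1 la lc + tcat 1 lc la))"
          using i j by (simp only: shift_linear la_def lc_def tcat s scl_distribs)
      qed (use i z z' in \<open>simp add: la_def lc_def\<close>)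
    qed (simp add: sqH_def)
    show "to_ht sqHc = tcat 1 la la + tcat 1 lc lc"
    proof (rule ht_eqI_sh)
      fix i :: nat assume i: "i < 4"
      show "shift i (to_ht sqHc) = shift i (tcat 1 la la + tcat 1 lc lc)"
      proof (rule ht_eqI_sh)
        fix j :: nat assume j: "j < 4"
        have "(if i = j \<and> i < 2 then (if i = 0 then 1/2 else -1/2) else 0) = qa i * qa j + qac i * qac j"
          using i j by (simp only: less4) (elim disjE; simp add: qa_def qac_def)
        then show "shift j (shift i (to_ht sqHc)) = shift j (shift i (tcat 1 la la + tcat 1 lc lc))"
          using i j by (simp only: shift_linear la_def lc_def tcat s scl_distribs)
      qed (use i z z' in \<open>simp add: la_def lc_def\<close>)
    qed (simp add: sqHc_def)
  qed
  have m: "wmono 2 1 = symmetrize 2 (tcat 1 la lc)" "wmono 2 0 = symmetrize 2 (tcat 1 lc lc)" "wmono 2 2 = symmetrize 2 (tcat 1 la la)"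
  proof -
    show "wmono 2 1 = symmetrize 2 (tcat 1 la lc)" by (simp add: wmono_def tcat_pr_0)
    show "wmono 2 0 = symmetrize 2 (tcat 1 lc lc)" by (simp add: wmono_def tcat_pr_0 cf_pr numeral_2_eq_2)
    have "deg 2 (tcat 1 la la)" using deg_tc[of 1 la 1 la] by (simp add: numeral_2_eq_2)
    then show "wmono 2 2 = symmetrize 2 (tcat 1 la la)"
      by (simp add: wmono_def tcat_pr_0 numeral_2_eq_2)
  qed
  have "symmetrize 2 (tcat 1 lc la) = symmetrize 2 (tcat 1 la lc)" by (rule symmetrize_tc_comm) simp
  then have "symmetrize 2 (to_ht sqH) = 2 *\<^sub>c wmono 2 1"
    unfolding e1 m by (simp add: symmetrize_add flip: scl_distribs(3)[of 1 1, simplified])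
  moreover have "[:0, 2:] = monom (2::complex) 1" by (simp add: monom_altdef)
  moreover have "degree [:0, 2::complex:] \<le> 2" by simp
  ultimately show "rep 2 (to_ht sqH) [:0, 2:]" unfolding rep_def by (simp add: psi_monom)
  have "psi 2 [:1, 0, 1:] = wmono 2 0 + wmono 2 2"
    by (simp add: psi_def numeral_2_eq_2)
  then show "rep 2 (to_ht sqHc) [:1, 0, 1:]"
    using m by (simp add: rep_def e2 symmetrize_add add.commute)
qed


section \<open>Waring's formula for power sums of two variables\<close>

definition waring :: "nat \<Rightarrow> nat \<Rightarrow> complex" where
  "waring N i = of_nat N * (of_nat ((N - i) choose i) / of_nat (N - i))"

lemma waring_0 [simp]: "N > 0 \<Longrightarrow> waring N 0 = 1"
  by (simp add: waring_def)

lemma waring_eq_0: "N < 2 * i \<Longrightarrow> waring N i = 0"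
  unfolding waring_def by (subst binomial_eq_0) auto

text \<open>The quotient is in fact a sum of two binomial coefficients, a form to which Pascal's
  rule applies.\<close>

lemma waring_Suc:
  assumes "N > Suc i" shows "waring N (Suc i) = of_nat ((N - Suc i) choose Suc i) + of_nat ((N - i - 2) choose i)"
proof -
  obtain m where m: "N = m + i + 2" using assms that[of "N - i - 2"] by simp
  have "Suc m * (m choose i) = (Suc m choose Suc i) * Suc i" by (rule Suc_times_binomial_eq)
  then have "of_nat (Suc m) * of_nat (m choose i) = (of_nat (Suc m choose Suc i) * of_nat (Suc i) :: complex)"
    by (metis of_nat_mult)
  moreover have "of_nat (Suc m) \<noteq> (0::complex)" by (simp only: of_nat_eq_0_iff)
  moreover have "N - Suc i = Suc m" "N - i - 2 = m" "of_nat N = of_nat (Suc m) + (of_nat (Suc i) :: complex)"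
    using m by simp_all
  ultimately show ?thesis
    unfolding waring_def by (simp add: field_simps del: of_nat_Suc binomial_Suc_Suc)
qed

text \<open>Pascal's rule in each of the two binomials. N = 0 is excluded because
  \<open>waring 0 0\<close> evaluates to 0, whereas the recursion would need 2, the value of x^0 +
  y^0.\<close>

lemma waring_rec:
  assumes "N > 0" shows "waring (N + 2) (Suc i) = waring (N + 1) (Suc i) + waring N i"
proof (cases "N < 2 * i")
  case True
  then show ?thesis by (simp add: waring_eq_0)
next
  case False
  show ?thesis
  proof (cases i)
    case 0
    then show ?thesis using assms by (cases N) (simp_all add: waring_Suc)
  next
    case (Suc j)
    then obtain m where m: "N = m + j + 2" using False that[of "N - j - 2"] by simp
    show ?thesis unfolding m Suc by (simp add: waring_Suc)
  qed
qed

text \<open>Both sides satisfy the recursion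
  \<open>S (N + 2) = (x + y) * S (N + 1) - x * y * S N\<close> of power sums; the base cases are N =
  1 and N = 2.\<close>

lemma waring_formula:
  fixes x y :: complex
  assumes "N > 0"
  shows "(\<Sum>i\<le>N div 2. waring N i * (- (x * y)) ^ i * (x + y) ^ (N - 2 * i)) = x ^ N + y ^ N"
proof -
  define S where "S N = (\<Sum>i\<le>N. waring N i * (- (x * y)) ^ i * (x + y) ^ (N - 2 * i))" for N
  \<comment> \<open>The coefficients vanish beyond \<open>N div 2\<close>, so the summation range
    can be chosen to fit the recursion.\<close>
  have S_eq: "S N = (\<Sum>i\<le>M. waring N i * (- (x * y)) ^ i * (x + y) ^ (N - 2 * i))" if "N div 2 \<le> M" for N M
    unfolding S_def
  proof -
    have "(\<Sum>i\<le>L. waring N i * (- (x * y)) ^ i * (x + y) ^ (N - 2 * i)) =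
      (\<Sum>i\<le>N div 2. waring N i * (- (x * y)) ^ i * (x + y) ^ (N - 2 * i))" if "N div 2 \<le> L" for L
      using that by (intro sum.mono_neutral_right) (auto simp: waring_eq_0)
    from this[of N] this[of M] that show "(\<Sum>i\<le>N. waring N i * (- (x * y)) ^ i * (x + y) ^ (N - 2 * i)) =
      (\<Sum>i\<le>M. waring N i * (- (x * y)) ^ i * (x + y) ^ (N - 2 * i))" by simp
  qed
  have rec: "S (N + 2) = (x + y) * S (N + 1) - x * y * S N" if N: "N > 0" for N
  proof -
    \<comment> \<open>Where truncated subtraction breaks
      \<open>N + 2 - 2 * Suc i = Suc (N + 1 - 2 * Suc i)\<close>, the coefficient is 0.\<close>
    have t: "waring (N + 1) (Suc i) * (x + y) ^ (N + 2 - 2 * Suc i) =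
        waring (N + 1) (Suc i) * ((x + y) * (x + y) ^ (N + 1 - 2 * Suc i))" for i
    proof (cases "N + 1 < 2 * Suc i")
      case False
      then have "N + 2 - 2 * Suc i = Suc (N + 1 - 2 * Suc i)" by simp
      then show ?thesis by simp
    qed (simp add: waring_eq_0)
    have "S (N + 2) = (x + y) ^ (N + 2) + (\<Sum>i\<le>N. waring (N + 2) (Suc i) * (- (x * y)) ^ Suc i * (x + y) ^ (N + 2 - 2 * Suc i))"
      by (subst S_eq[of _ "Suc N"]) (simp, simp add: sum.atMost_Suc_shift del: sum.atMost_Suc)
    also have "\<dots> = (x + y) ^ (N + 2) + (\<Sum>i\<le>N. (x + y) * (waring (N + 1) (Suc i) * (- (x * y)) ^ Suc i * (x + y) ^ (N + 1 - 2 * Suc i))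
        - x * y * (waring N i * (- (x * y)) ^ i * (x + y) ^ (N - 2 * i)))"
    proof -
      have "waring (N + 2) (Suc i) * (- (x * y)) ^ Suc i * (x + y) ^ (N + 2 - 2 * Suc i) =
          (x + y) * (waring (N + 1) (Suc i) * (- (x * y)) ^ Suc i * (x + y) ^ (N + 1 - 2 * Suc i))
        - x * y * (waring N i * (- (x * y)) ^ i * (x + y) ^ (N - 2 * i))" for i
      proof -
        have "waring (N + 2) (Suc i) * (- (x * y)) ^ Suc i * (x + y) ^ (N + 2 - 2 * Suc i) =
          (- (x * y)) ^ Suc i * (waring (N + 1) (Suc i) * (x + y) ^ (N + 2 - 2 * Suc i)
           + waring N i * (x + y) ^ (N - 2 * i))"
          unfolding waring_rec[OF N] by (simp add: algebra_simps)
        then show ?thesis unfolding t by (simp add: algebra_simps)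
      qed
      then show ?thesis by simp
    qed
    also have "\<dots> = (x + y) * ((x + y) ^ (N + 1) + (\<Sum>i\<le>N. waring (N + 1) (Suc i) * (- (x * y)) ^ Suc i * (x + y) ^ (N + 1 - 2 * Suc i)))
        - x * y * S N"
      by (simp add: S_def sum_subtractf sum_distrib_left distrib_left)
    also have "(x + y) ^ (N + 1) + (\<Sum>i\<le>N. waring (N + 1) (Suc i) * (- (x * y)) ^ Suc i * (x + y) ^ (N + 1 - 2 * Suc i)) = S (N + 1)"
      by (subst S_eq[of _ "Suc N"]) (simp, simp add: sum.atMost_Suc_shift del: sum.atMost_Suc)
    finally show ?thesis .
  qed
  have "S (Suc k) = x ^ Suc k + y ^ Suc k \<and> S (Suc (Suc k)) = x ^ Suc (Suc k) + y ^ Suc (Suc k)" for k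
  proof (induction k)
    case 0
    have "S 1 = x + y" using S_eq[of 1 0] by simp
    moreover have "2 * S 2 = 2 * (x ^ 2 + y ^ 2)"
      using S_eq[of 2 1] by (simp add: waring_def power2_eq_square algebra_simps)
    then have "S 2 = x ^ 2 + y ^ 2" by (simp only: mult_cancel_left) simp
    ultimately show ?case by (simp add: numeral_2_eq_2)
  next
    case (Suc k)
    then show ?case using rec[of "Suc k"] by (simp add: algebra_simps)
  qed
  with assms have "S N = x ^ N + y ^ N" by (cases N) auto
  then show ?thesis using S_eq[of N "N div 2"] by simp
qed


definition wproj :: "nat \<Rightarrow> nat \<Rightarrow> ht" where
  "wproj n k = of_nat (n choose k) *\<^sub>c wmono n k"

text \<open>The binomial theorem for the n-th power of \<open>1 = a + a^c\<close>.\<close>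

lemma sum_P: "(\<Sum>k\<le>n. wproj n k) = hunit n"
proof -
  have "psi n ([:1, 1:] ^ n) = hunit n"
    using rep_pr[of n] by (simp add: rep_def symmetrize_symm)
  then show ?thesis by (simp add: psi_def wproj_def coeff_linear_poly_power)
qed

text \<open>Polynomials are equal if they agree at all complex points, so the identities of
  symmetrized tensors behind (b) and (c) reduce to identities of numbers.\<close>

lemma symmetrize_lincomb_eq_mo:
  assumes "\<And>i. i \<in> I \<Longrightarrow> rep n (X i) (f i)" and "k \<le> n" "k' \<le> n"
    and "\<And>z. (\<Sum>i\<in>I. c i * poly (f i) z) = z ^ k + z ^ k'"
  shows "(\<Sum>i\<in>I. c i *\<^sub>c symmetrize n (X i)) = wmono n k + wmono n k'"
proof -
  have "(\<Sum>i\<in>I. c i *\<^sub>c symmetrize n (X i)) = psi n (\<Sum>i\<in>I. smult (c i) (f i))"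
    using assms(1) by (simp add: psi_sum psi_linear rep_def)
  also have "(\<Sum>i\<in>I. smult (c i) (f i)) = monom 1 k + monom 1 k'"
    using assms(4) by (simp add: poly_sum poly_monom fun_eq_iff flip: poly_eq_poly_eq_iff)
  finally show ?thesis using assms(2,3) by (simp add: psi_linear psi_monom)
qed

text \<open>Waring's formula with x = z and y = 1, multiplied by \<open>z ^ k\<close>. The powers of
  1/2 cancel against the 2 in \<open>[:0, 2:]\<close>, the polynomial of the square tensor.\<close>

lemma odd_formula:
  assumes "2 * k < n"
  defines "N \<equiv> n - 2 * k"
  shows "(\<Sum>i\<le>N div 2. (waring N i * (1 / 2 ^ k) * (- 1 / 2) ^ i) *\<^sub>c
      symmetrize n (tcat (N - 2 * i) (hunit (N - 2 * i)) (tcatpow 2 (to_ht sqH) (k + i)))) = wmono n k + wmono n (n - k)"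
proof (rule symmetrize_lincomb_eq_mo)
  fix i assume i: "i \<in> {..N div 2}"
  have "n = N - 2 * i + 2 * (k + i)" using i assms by auto
  then show "rep n (tcat (N - 2 * i) (hunit (N - 2 * i)) (tcatpow 2 (to_ht sqH) (k + i)))
      ([:1, 1:] ^ (N - 2 * i) * [:0, 2:] ^ (k + i))"
    using rep_tc[OF rep_pr[of "N - 2 * i"] rep_tp[OF rep_sqH, of "k + i"]] by simp
next
  fix z :: complex
  have "(\<Sum>i\<le>N div 2. waring N i * (1 / 2 ^ k) * (- 1 / 2) ^ i * poly ([:1, 1:] ^ (N - 2 * i) * [:0, 2:] ^ (k + i)) z)
    = (\<Sum>i\<le>N div 2. z ^ k * (waring N i * (- (z * 1)) ^ i * (z + 1) ^ (N - 2 * i)))"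
    by (intro sum.cong refl)
       (simp add: power_add power_mult_distrib power_divide power_minus[of z] power_minus[of "1/2"] field_simps)
  also have "\<dots> = z ^ k * (z ^ N + 1 ^ N)"
    using assms unfolding sum_distrib_left[symmetric] by (subst waring_formula) auto
  also have "\<dots> = z ^ k + z ^ (n - k)"
    using assms by (simp add: algebra_simps flip: power_add)
  finally show "(\<Sum>i\<le>N div 2. waring N i * (1 / 2 ^ k) * (- 1 / 2) ^ i * poly ([:1, 1:] ^ (N - 2 * i) * [:0, 2:] ^ (k + i)) z)
    = z ^ k + z ^ (n - k)" .
qed (use assms in auto)

text \<open>Waring's formula with x = z^2, y = 1 and half the degree, multiplied by
  \<open>z ^ k\<close>. Each step in i raises the power of 2z by two, which is why -1/4 appears in
  place of -1/2.\<close>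

lemma even_formula:
  assumes "n = 2 * h" "k < h"
  defines "N \<equiv> h - k"
  shows "(\<Sum>i\<le>N div 2. (waring N i * (1 / 2 ^ k) * (- 1 / 4) ^ i) *\<^sub>c
      symmetrize n (tcat (2 * (k + 2 * i)) (tcatpow 2 (to_ht sqH) (k + 2 * i)) (tcatpow 2 (to_ht sqHc) (N - 2 * i)))) = wmono n k + wmono n (n - k)"
proof (rule symmetrize_lincomb_eq_mo)
  fix i assume i: "i \<in> {..N div 2}"
  have "n = 2 * (k + 2 * i) + 2 * (N - 2 * i)" using i assms by auto
  then show "rep n (tcat (2 * (k + 2 * i)) (tcatpow 2 (to_ht sqH) (k + 2 * i)) (tcatpow 2 (to_ht sqHc) (N - 2 * i)))
      ([:0, 2:] ^ (k + 2 * i) * [:1, 0, 1:] ^ (N - 2 * i))"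
    using rep_tc[OF rep_tp[OF rep_sqH, of "k + 2 * i"] rep_tp[OF rep_sqHc, of "N - 2 * i"]] by simp
next
  fix z :: complex
  have "(\<Sum>i\<le>N div 2. waring N i * (1 / 2 ^ k) * (- 1 / 4) ^ i * poly ([:0, 2:] ^ (k + 2 * i) * [:1, 0, 1:] ^ (N - 2 * i)) z)
    = (\<Sum>i\<le>N div 2. z ^ k * (waring N i * (- (z\<^sup>2 * 1)) ^ i * (z\<^sup>2 + 1) ^ (N - 2 * i)))"
  proof (intro sum.cong refl)
    fix i
    have "(- 1 / 4) ^ i * (2 * z) ^ (k + 2 * i) = 2 ^ k * z ^ k * ((- 1 / 4) * (2 * z)\<^sup>2) ^ i"
      unfolding power_add power_mult by (simp only: power_mult_distrib mult_ac)
    also have "(- 1 / 4) * (2 * z)\<^sup>2 = - (z\<^sup>2 * 1)" by (simp add: power_mult_distrib)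
    finally have *: "(- 1 / 4) ^ i * (2 * z) ^ (k + 2 * i) = 2 ^ k * z ^ k * (- (z\<^sup>2 * 1)) ^ i" .
    have "waring N i * (1 / 2 ^ k) * (- 1 / 4) ^ i * poly ([:0, 2:] ^ (k + 2 * i) * [:1, 0, 1:] ^ (N - 2 * i)) z
      = waring N i * (1 / 2 ^ k) * ((- 1 / 4) ^ i * (2 * z) ^ (k + 2 * i)) * (z\<^sup>2 + 1) ^ (N - 2 * i)"
      by (simp add: power2_eq_square add.commute mult.commute)
    also have "\<dots> = z ^ k * (waring N i * (- (z\<^sup>2 * 1)) ^ i * (z\<^sup>2 + 1) ^ (N - 2 * i))"
      unfolding * by simp
    finally show "waring N i * (1 / 2 ^ k) * (- 1 / 4) ^ i * poly ([:0, 2:] ^ (k + 2 * i) * [:1, 0, 1:] ^ (N - 2 * i)) z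
      = z ^ k * (waring N i * (- (z\<^sup>2 * 1)) ^ i * (z\<^sup>2 + 1) ^ (N - 2 * i))" .
  qed
  also have "\<dots> = z ^ k * ((z\<^sup>2) ^ N + 1 ^ N)"
    using assms unfolding sum_distrib_left[symmetric] by (subst waring_formula) auto
  also have "\<dots> = z ^ k + z ^ (k + 2 * N)"
    unfolding power_add power_mult by (simp add: algebra_simps)
  also have "k + 2 * N = n - k" using assms by simp
  finally show "(\<Sum>i\<le>N div 2. waring N i * (1 / 2 ^ k) * (- 1 / 4) ^ i * poly ([:0, 2:] ^ (k + 2 * i) * [:1, 0, 1:] ^ (N - 2 * i)) z)
    = z ^ k + z ^ (n - k)" .
qed (use assms in auto)

lemma middle_formula: "(1 / 2) ^ h *\<^sub>c symmetrize (2 * h) (tcatpow 2 (to_ht sqH) h) = wmono (2 * h) h"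
proof -
  have "[:0, 2:] ^ h = monom (2 ^ h :: complex) h"
    by (simp flip: poly_eq_poly_eq_iff add: fun_eq_iff poly_monom power_mult_distrib mult.commute)
  then have "symmetrize (2 * h) (tcatpow 2 (to_ht sqH) h) = 2 ^ h *\<^sub>c wmono (2 * h) h"
    using rep_tp[OF rep_sqH, of h] by (simp add: rep_def psi_monom)
  then show ?thesis by (simp flip: power_mult_distrib)
qed

section \<open>Weight projections and the Casimir element\<close>

lemma deg_mo [simp]: "deg n (wmono n k)"
  by (simp add: wmono_def deg_sy)

lemma deg_P [simp]: "deg n (wproj n k)"
  by (simp add: wproj_def)

lemma symm_P [simp]: "symm n (wproj n k)"
  by (simp add: wproj_def wmono_def)

lemma wproj_eq_0: "n < k \<Longrightarrow> wproj n k = 0"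
  by (simp add: wproj_def)

lemma wt_P: "wt * wproj n k = (2 * of_nat k - of_nat n) *\<^sub>c wproj n k"
  and wproj_wt: "wproj n k * wt = (2 * of_nat k - of_nat n) *\<^sub>c wproj n k"
proof -
  show "wt * wproj n k = (2 * of_nat k - of_nat n) *\<^sub>c wproj n k"
    by (cases "k \<le> n") (simp_all add: wproj_def wt_mo mult.commute binomial_eq_0)
  show "wproj n k * wt = (2 * of_nat k - of_nat n) *\<^sub>c wproj n k"
    by (cases "k \<le> n") (simp_all add: wproj_def wt_mo mult.commute binomial_eq_0)
qed

lemma deg_eq_sum_P: "deg n X \<Longrightarrow> X = (\<Sum>k\<le>n. wproj n k * X)"
  by (simp add: sum_P deg_def flip: sum_distrib_right)

text \<open>Computing \<open>wproj n j * wt * X\<close> in two ways shows that projections of other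
  weights annihilate X; as the projections sum to \<open>hunit n\<close>, the remaining one fixes
  X.\<close>

lemma wproj_mult_weight_vector:
  assumes "deg n X" "wt * X = c *\<^sub>c X"
  shows "wproj n k * X = (if c = 2 * of_nat k - of_nat n then X else 0)"
proof -
  have ne: "wproj n j * X = 0" if "c \<noteq> 2 * of_nat j - of_nat n" for j
  proof -
    have "wproj n j * (wt * X) = (wproj n j * wt) * X" by (simp only: mult.assoc)
    then have "c *\<^sub>c (wproj n j * X) = (2 * of_nat j - of_nat n) *\<^sub>c (wproj n j * X)"
      by (simp add: assms(2) wproj_wt)
    with that show ?thesis by (simp add: scl_eq_scl_iff)
  qed
  show ?thesis
  proof (cases "c = 2 * of_nat k - of_nat n")
    case True
    have "X = (\<Sum>j\<le>n. wproj n j * X)" using assms(1) by (rule deg_eq_sum_P)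
    also have "\<dots> = (\<Sum>j\<le>n. if j = k then wproj n j * X else 0)"
      using ne True by (intro sum.cong) auto
    also have "\<dots> = wproj n k * X" by (simp add: wproj_eq_0)
    finally show ?thesis using True by simp
  qed (simp add: ne)
qed

lemma weight_vector_eq_0:
  assumes "deg n X" "wt * X = c *\<^sub>c X" "\<And>k. k \<le> n \<Longrightarrow> c \<noteq> 2 * of_nat k - of_nat n"
  shows "X = 0"
  using deg_eq_sum_P[OF assms(1)] assms by (simp add: wproj_mult_weight_vector)

lemma wproj_mult_P: "wproj n j * wproj n k = (if j = k then wproj n k else 0)"
  by (auto simp: wproj_mult_weight_vector[OF _ wt_P])

text \<open>Splitting the unit to the right of Y into weight projections, only the summand that Y
  carries to weight index k survives. An index i above n is allowed and makes both sides 0.\<close>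

lemma wproj_mult_intertwine:
  assumes "\<And>j. j \<le> n \<Longrightarrow> wt * (Y * wproj n j) = c j *\<^sub>c (Y * wproj n j)"
    and "\<And>j. j \<le> n \<Longrightarrow> c j = 2 * of_nat k - of_nat n \<longleftrightarrow> j = i"
  shows "wproj n k * Y = Y * wproj n i"
proof -
  have "wproj n k * Y = hunit n * (wproj n k * Y)" by (metis deg_P deg_def deg_mult_left)
  also have "\<dots> = (\<Sum>j\<le>n. wproj n k * (Y * wproj n j))"
    by (simp add: mult.assoc sum_P flip: hunit_commute sum_distrib_left)
  also have "\<dots> = (\<Sum>j\<le>n. if j = i then Y * wproj n j else 0)"
    using assms by (intro sum.cong refl) (simp add: wproj_mult_weight_vector[OF _ assms(1)])
  also have "\<dots> = Y * wproj n i" by (simp add: wproj_eq_0)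
  finally show ?thesis .
qed

lemma wt_up_P: "wt * (up * wproj n j) = (2 * of_nat (Suc j) - of_nat n) *\<^sub>c (up * wproj n j)"
proof -
  have "wt * (up * wproj n j) = up * (wt * wproj n j) + 2 *\<^sub>c (up * wproj n j)"
    by (simp add: wt_up distrib_right flip: mult.assoc)
  then show ?thesis by (simp add: wt_P algebra_simps flip: scl_distribs)
qed

lemma wt_dn_P: "wt * (dn * wproj n j) = (2 * of_nat j - of_nat n - 2) *\<^sub>c (dn * wproj n j)"
proof -
  have "wt * (dn * wproj n j) = dn * (wt * wproj n j) - 2 *\<^sub>c (dn * wproj n j)"
    by (simp add: wt_dn left_diff_distrib flip: mult.assoc)
  then show ?thesis by (simp add: wt_P flip: scl_distribs)
qed

lemma wproj_up: "wproj n (Suc k) * up = up * wproj n k"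
  by (rule wproj_mult_intertwine[OF wt_up_P]) simp

lemma wproj_dn: "wproj n k * dn = dn * wproj n (Suc k)"
proof (rule wproj_mult_intertwine[OF wt_dn_P])
  fix j
  have "(2 * of_nat j - of_nat n - 2 = 2 * of_nat k - (of_nat n :: complex)) \<longleftrightarrow>
      of_nat (2 * j) = (of_nat (2 * k + 2) :: complex)"
    by (auto simp: algebra_simps)
  then show "(2 * of_nat j - of_nat n - 2 = 2 * of_nat k - (of_nat n :: complex)) = (j = Suc k)"
    unfolding of_nat_eq_iff by auto
qed

lemma dn_P_0: "dn * wproj n 0 = 0"
proof (rule weight_vector_eq_0[OF _ wt_dn_P])
  fix k
  show "2 * of_nat 0 - of_nat n - 2 \<noteq> 2 * of_nat k - (of_nat n :: complex)"
  proof
    assume eq: "2 * of_nat 0 - of_nat n - 2 = 2 * of_nat k - (of_nat n :: complex)"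
    have "of_nat (2 * k + 2) = 2 * of_nat k - of_nat n + (of_nat n + (2::complex))" by simp
    also have "\<dots> = of_nat 0" unfolding eq[symmetric] by simp
    finally show False unfolding of_nat_eq_iff by simp
  qed
qed simp

lemma wproj_0_up: "wproj n 0 * up = 0"
proof -
  \<comment> \<open>No weight is raised to -n, which is expressed by an index outside the
    range.\<close>
  have "wproj n 0 * up = up * wproj n (Suc n)"
  proof (rule wproj_mult_intertwine[OF wt_up_P])
    fix j assume "j \<le> n"
    moreover have "2 * of_nat (Suc j) - of_nat n = 2 * of_nat 0 - (of_nat n :: complex) \<longleftrightarrow>
        of_nat (2 * j + 2) = (of_nat 0 :: complex)"
      by (auto simp: algebra_simps)
    ultimately show "(2 * of_nat (Suc j) - of_nat n = 2 * of_nat 0 - (of_nat n :: complex)) = (j = Suc n)"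
      unfolding of_nat_eq_iff by auto
  qed
  then show ?thesis by (simp add: wproj_eq_0)
qed

section \<open>The Casimir element and its spectrum\<close>

definition casimir :: ht where "casimir = dn * up + (1/2) *\<^sub>c wt + (1/4) *\<^sub>c (wt * wt)"

text \<open>With w = 2m - n this is w(w + 2)/4, the scalar by which the Casimir element acts on a
  vector of weight w killed by \<open>up\<close>.\<close>

definition casval :: "nat \<Rightarrow> nat \<Rightarrow> complex" where
  "casval n m = (2 * of_nat m - of_nat n) * (2 * of_nat m - of_nat n + 2) / 4"

lemma casval_diff: "casval n l - casval n m = (of_nat l - of_nat m) * (of_nat l + of_nat m + 1 - of_nat n)"
  by (simp add: casval_def field_simps)

text \<open>In the factorization of the difference the second factor vanishes only for
  \<open>l + m + 1 = n\<close>, which is impossible when both l and m are at least n/2.\<close>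

lemma casval_neq:
  assumes "(n + 1) div 2 \<le> l" "(n + 1) div 2 \<le> m" "l \<noteq> m"
  shows "casval n l \<noteq> casval n m"
proof
  assume "casval n l = casval n m"
  then have "(of_nat l - of_nat m) * (of_nat l + of_nat m + 1 - of_nat n) = (0::complex)"
    using casval_diff[of n l m] by simp
  then have "(of_nat l :: complex) = of_nat m \<or> of_nat (l + m + 1) = (of_nat n :: complex)"
    unfolding mult_eq_0_iff by (simp add: add_ac)
  then show False using assms unfolding of_nat_eq_iff by auto
qed

text \<open>Rewrite rules for the normal order \<open>dn\<close>, \<open>up\<close>,
  \<open>wt\<close>, in the shape that right-nested products require.\<close>

lemma step_normal_order:
  "wt * (up * x) = up * (wt * x) + 2 *\<^sub>c (up * x)"
  "wt * (dn * x) = dn * (wt * x) - 2 *\<^sub>c (dn * x)"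
  "up * (dn * x) = dn * (up * x) + wt * x"
  by (simp_all add: wt_up wt_dn up_dn distrib_right left_diff_distrib flip: mult.assoc)

lemma casimir_up: "casimir * up = up * casimir" and casimir_dn: "casimir * dn = dn * casimir" and casimir_wt: "casimir * wt = wt * casimir"
  unfolding casimir_def
  by (rule ht_eqI; simp add: distrib_left distrib_right left_diff_distrib right_diff_distrib mult.assoc
      step_normal_order wt_up wt_dn up_dn scl_distribs; simp add: algebra_simps)+

lemma casimir_P: "casimir * wproj n k = wproj n k * casimir"
proof -
  have "wproj n k * (dn * up) = (dn * up) * wproj n k"
    by (simp add: wproj_dn wproj_up mult.assoc flip: mult.assoc[of "wproj n k"])
  moreover have "wproj n k * (wt * wt) = (wt * wt) * wproj n k"
    by (simp add: wproj_wt wt_P mult.assoc flip: mult.assoc[of "wproj n k"])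
  ultimately show ?thesis by (simp add: casimir_def distrib_left distrib_right wt_P wproj_wt)
qed

definition casfac :: "nat \<Rightarrow> nat \<Rightarrow> ht" where "casfac n m = casimir - casval n m *\<^sub>c 1"

definition casprod :: "nat \<Rightarrow> nat list \<Rightarrow> ht" where "casprod n ms = prod_list (map (casfac n) ms)"

lemma casprod_simps [simp]: "casprod n [] = 1" "casprod n (m # ms) = casfac n m * casprod n ms" "casprod n (xs @ ys) = casprod n xs * casprod n ys"
  by (simp_all add: casprod_def)

lemma casfac_commute: "casimir * x = x * casimir \<Longrightarrow> casfac n m * x = x * casfac n m"
  by (simp add: casfac_def left_diff_distrib right_diff_distrib)

lemma casprod_commute: "casimir * x = x * casimir \<Longrightarrow> casprod n ms * x = x * casprod n ms"
proof (induction ms)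
  case (Cons m ms)
  then show ?case by (metis casprod_simps(2) casfac_commute mult.assoc)
qed simp

lemma casfac_fac: "casfac n m * casfac n m' = casfac n m' * casfac n m"
  by (rule casfac_commute) (simp add: casfac_def left_diff_distrib right_diff_distrib)

lemma casfac_R: "casfac n m * casprod n ms = casprod n ms * casfac n m"
  by (rule casprod_commute[symmetric]) (simp add: casfac_def left_diff_distrib right_diff_distrib)

text \<open>At weight 2k - n the terms of the Casimir element in \<open>wt\<close> become the
  constant \<open>casval n k\<close>, so a detour through the next higher weight is multiplication
  by \<open>casfac n k\<close>.\<close>

lemma dn_up_P: "dn * (up * wproj n k) = casfac n k * wproj n k"
proof -
  have "casfac n k * wproj n k = dn * (up * wproj n k) + (1/2) *\<^sub>c (wt * wproj n k) + (1/4) *\<^sub>c (wt * (wt * wproj n k)) - casval n k *\<^sub>c wproj n k"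
    by (simp add: casfac_def casimir_def distrib_right left_diff_distrib mult.assoc)
  also have "\<dots> = dn * (up * wproj n k)"
    unfolding wt_P by (rule ht_eqI) (simp add: wt_P casval_def field_simps)
  finally show ?thesis ..
qed

text \<open>The same for a detour through the next lower weight; reflection of weights replaces k by
  n - k.\<close>

lemma up_dn_P: "k \<le> n \<Longrightarrow> up * (dn * wproj n k) = casfac n (n - k) * wproj n k"
proof -
  assume k: "k \<le> n"
  have "up * (dn * wproj n k) = dn * (up * wproj n k) + wt * wproj n k" by (simp add: step_normal_order)
  also have "\<dots> = casfac n (n - k) * wproj n k"
    unfolding dn_up_P wt_P by (rule ht_eqI) (use k in \<open>simp add: casfac_def casval_def left_diff_distrib of_nat_diff field_simps\<close>)
  finally show ?thesis .
qed

text \<open>At weight index k the factor \<open>casfac n k\<close> passes through index k + 1, where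
  the remaining factors annihilate by induction; beyond n there is no weight left.\<close>

lemma casprod_P_eq_0: "k \<le> Suc n \<Longrightarrow> casprod n [k..<Suc n] * wproj n k = 0"
proof (induction k rule: inc_induct)
  case base
  then show ?case by (simp add: wproj_eq_0)
next
  case (step k)
  have "casprod n [k..<Suc n] * wproj n k = casprod n [Suc k..<Suc n] * (casfac n k * wproj n k)"
    using step by (simp add: upt_conv_Cons casfac_R mult.assoc del: upt_Suc)
  also have "\<dots> = dn * (casprod n [Suc k..<Suc n] * wproj n (Suc k)) * up"
    unfolding dn_up_P[symmetric] wproj_up[symmetric]
    by (simp add: casprod_commute[OF casimir_dn] del: upt_Suc flip: mult.assoc)
  finally show ?case using step by simp
qed

text \<open>The mirror image: each factor passes through the next lower index, until
  \<open>dn\<close> annihilates index 0.\<close>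

lemma casprod_P_eq_0': "k \<le> n \<Longrightarrow> casprod n [n - k..<Suc n] * wproj n k = 0"
proof (induction k)
  case 0
  have "casfac n n * wproj n 0 = 0" using up_dn_P[of 0 n] by (simp add: dn_P_0)
  then show ?case by simp
next
  case (Suc k)
  have "[n - Suc k..<Suc n] = (n - Suc k) # [n - k..<Suc n]"
    using Suc.prems by (subst upt_conv_Cons) (simp_all add: Suc_diff_Suc del: upt_Suc)
  then have "casprod n [n - Suc k..<Suc n] * wproj n (Suc k) = casprod n [n - k..<Suc n] * (casfac n (n - Suc k) * wproj n (Suc k))"
    by (simp only: casprod_simps casfac_R mult.assoc)
  also have "\<dots> = up * (casprod n [n - k..<Suc n] * wproj n k) * dn"
    unfolding up_dn_P[OF Suc.prems, symmetric] wproj_dn[symmetric]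
    by (simp add: casprod_commute[OF casimir_up] del: upt_Suc flip: mult.assoc)
  finally show ?case using Suc by simp
qed

section \<open>Projection to one Casimir eigenvalue\<close>

definition idx :: "nat \<Rightarrow> nat \<Rightarrow> nat list" where
  "idx n l = filter (\<lambda>m. m \<noteq> l) [(n + 1) div 2..<n + 1]"

text \<open>Lagrange interpolation at the eigenvalue \<open>casval n l\<close>, in terms of the
  Casimir element; \<open>to_ht_eH\<close> identifies it with the given idempotent.\<close>

definition isoproj :: "nat \<Rightarrow> nat \<Rightarrow> ht" where
  "isoproj n l = prod_list (map (\<lambda>m. 1 / (casval n l - casval n m)) (idx n l)) *\<^sub>c (casprod n (idx n l) * hunit n)"

lemma deg_el [simp]: "deg n (isoproj n l)"
  by (simp add: isoproj_def)

lemma isoproj_commute: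
  assumes "casimir * x = x * casimir" shows "isoproj n l * x = x * isoproj n l"
proof -
  have "casprod n ms * hunit n * x = x * (casprod n ms * hunit n)" for ms
    using casprod_commute[OF assms, of n ms] hunit_commute[of x n] by (metis mult.assoc)
  then show ?thesis by (simp add: isoproj_def)
qed

lemma casfac_R_filter:
  "distinct ms \<Longrightarrow> l \<in> set ms \<Longrightarrow> casfac n l * casprod n (filter (\<lambda>m. m \<noteq> l) ms) = casprod n ms"
proof (induction ms)
  case (Cons m ms)
  show ?case
  proof (cases "m = l")
    case True
    then have "filter (\<lambda>m. m \<noteq> l) ms = ms" using Cons.prems by (auto simp: filter_id_conv)
    then show ?thesis using True by simp
  next
    case False
    then have "casfac n l * casprod n (filter (\<lambda>m. m \<noteq> l) (m # ms)) = casfac n m * (casfac n l * casprod n (filter (\<lambda>m. m \<noteq> l) ms))"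
      by (simp add: casfac_fac[of n l m] flip: mult.assoc)
    then show ?thesis using False Cons by simp
  qed
qed simp

lemma casprod_range_eq_0:
  assumes "k \<le> n" shows "casprod n [(n + 1) div 2..<n + 1] * wproj n k = 0"
proof -
  \<comment> \<open>One of the two annihilating products for index k starts at this m, which is at
    least n/2, so it is a tail of the full product.\<close>
  define m where "m = max k (n - k)"
  have "(n + 1) div 2 \<le> m" "m \<le> n + 1" using assms by (auto simp: m_def)
  then have "[(n + 1) div 2..<n + 1] = [(n + 1) div 2..<m] @ [m..<n + 1]"
    using upt_add_eq_append[of "(n + 1) div 2" m "n + 1 - m"] by simp
  moreover have "casprod n [m..<n + 1] * wproj n k = 0"
    using casprod_P_eq_0[of k n] casprod_P_eq_0'[of k n] assms by (simp add: m_def max_def)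
  ultimately show ?thesis by (simp add: mult.assoc del: upt_Suc)
qed

text \<open>The factor omitted in \<open>isoproj\<close> completes the product over all eigenvalues,
  which annihilates degree n.\<close>

lemma casfac_el:
  assumes "(n + 1) div 2 \<le> l" "l \<le> n" shows "casfac n l * isoproj n l = 0"
proof -
  have "casfac n l * casprod n (idx n l) = casprod n [(n + 1) div 2..<n + 1]"
    unfolding idx_def using assms by (intro casfac_R_filter) auto
  then have "casfac n l * (casprod n (idx n l) * hunit n) = (\<Sum>k\<le>n. casprod n [(n + 1) div 2..<n + 1] * wproj n k)"
    by (simp add: sum_P del: upt_Suc flip: mult.assoc sum_distrib_left)
  also have "\<dots> = 0"
  proof (intro sum.neutral ballI)
    fix k assume "k \<in> {..n}"
    then show "casprod n [(n + 1) div 2..<n + 1] * wproj n k = 0" by (intro casprod_range_eq_0) simp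
  qed
  finally show ?thesis by (simp add: isoproj_def)
qed

lemma casimir_el: "(n + 1) div 2 \<le> l \<Longrightarrow> l \<le> n \<Longrightarrow> casimir * isoproj n l = casval n l *\<^sub>c isoproj n l"
  using casfac_el[of n l] by (simp add: casfac_def left_diff_distrib)

text \<open>On an eigenvector each factor is a number, cancelled by the normalizing constant because
  the eigenvalues are distinct.\<close>

lemma isoproj_eigen:
  assumes "casimir * x = casval n l *\<^sub>c x" "deg n x" "(n + 1) div 2 \<le> l"
  shows "isoproj n l * x = x"
proof -
  have "casprod n ms * x = prod_list (map (\<lambda>m. casval n l - casval n m) ms) *\<^sub>c x" for ms
  proof (induction ms)
    case (Cons m ms)
    have "casfac n m * x = (casval n l - casval n m) *\<^sub>c x"
      by (simp add: casfac_def left_diff_distrib assms(1) scl_distribs)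
    then show ?case using Cons by (simp add: mult.assoc mult.commute)
  qed simp
  then have "isoproj n l * x = (prod_list (map (\<lambda>m. 1 / (casval n l - casval n m)) (idx n l)) *
     prod_list (map (\<lambda>m. casval n l - casval n m) (idx n l))) *\<^sub>c x"
    using assms(2) by (simp add: isoproj_def mult.assoc deg_def)
  also have "prod_list (map (\<lambda>m. 1 / (casval n l - casval n m)) ms) * prod_list (map (\<lambda>m. casval n l - casval n m) ms) = 1"
    if "\<And>m. m \<in> set ms \<Longrightarrow> casval n l \<noteq> casval n m" for ms
    using that by (induction ms) auto
  then have "prod_list (map (\<lambda>m. 1 / (casval n l - casval n m)) (idx n l)) *
     prod_list (map (\<lambda>m. casval n l - casval n m) (idx n l)) = 1"
  proof this
    fix m assume "m \<in> set (idx n l)"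
    then show "casval n l \<noteq> casval n m"
      using assms(3) by (intro casval_neq) (auto simp: idx_def simp del: upt_Suc)
  qed
  finally show ?thesis by simp
qed

lemma isoproj_idem: "(n + 1) div 2 \<le> l \<Longrightarrow> l \<le> n \<Longrightarrow> isoproj n l * isoproj n l = isoproj n l"
  by (simp add: isoproj_eigen casimir_el)

lemma isoproj_P: "isoproj n l * wproj n k = wproj n k * isoproj n l"
  by (rule isoproj_commute) (rule casimir_P)

text \<open>The tail starting at k, or at n - k, annihilates this weight and lies above l, so it
  survives the omission of the factor for l.\<close>

lemma wproj_el_eq_0:
  assumes "(n + 1) div 2 \<le> l" "l \<le> n" "k \<le> n" "l < k \<or> k < n - l"
  shows "wproj n k * isoproj n l = 0"
proof -
  define m where "m = (if l < k then k else n - k)"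
  have m: "l < m" "m \<le> n" using assms by (auto simp: m_def)
  then have "[(n + 1) div 2..<n + 1] = [(n + 1) div 2..<m] @ [m..<n + 1]"
    using assms upt_add_eq_append[of "(n + 1) div 2" m "n + 1 - m"] by simp
  moreover have "filter (\<lambda>i. i \<noteq> l) [m..<n + 1] = [m..<n + 1]"
    using m by (auto simp: filter_id_conv simp del: upt_Suc)
  ultimately have "casprod n (idx n l) = casprod n (filter (\<lambda>i. i \<noteq> l) [(n + 1) div 2..<m]) * casprod n [m..<n + 1]"
    unfolding idx_def by (simp del: upt_Suc)
  moreover have "casprod n [m..<n + 1] * wproj n k = 0"
    using casprod_P_eq_0[of k n] casprod_P_eq_0'[of k n] assms by (simp add: m_def)
  ultimately have "casprod n (idx n l) * wproj n k = 0" by (simp add: mult.assoc del: upt_Suc)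
  then have "isoproj n l * wproj n k = 0" by (simp add: isoproj_def mult.assoc hunit_commute[of "wproj n k", symmetric])
     (simp flip: mult.assoc)
  then show ?thesis by (simp add: isoproj_P)
qed

lemma tcat_neq_0: 
  assumes "X \<noteq> 0" "deg p X" "Y \<noteq> 0" shows "tcat p X Y \<noteq> 0"
proof -
  from assms(1) obtain u where u: "cf X u \<noteq> 0" using ht_eqI[of X 0] by auto
  from assms(3) obtain v where v: "cf Y v \<noteq> 0" using ht_eqI[of Y 0] by auto
  have "length u = p" using u assms(2) by (auto simp: deg_iff)
  then have "cf (tcat p X Y) (u @ v) = cf X u * cf Y v" by (simp add: cf_tc)
  then show ?thesis using u v by auto
qed

lemma tcatpow_neq_0: "X \<noteq> 0 \<Longrightarrow> deg d X \<Longrightarrow> tcatpow d X k \<noteq> 0"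
proof (induction k)
  case 0
  have "cf (hunit 0) [] = 1" by (simp add: cf_pr)
  then show ?case by auto
qed (simp add: tcat_neq_0)

text \<open>The vector consists of n - l copies of an antisymmetric pair s, which has weight 0 and
  is killed by \<open>up\<close>, followed by 2l - n copies of a, each of weight 1.\<close>

lemma highest_weight_vector:
  assumes "(n + 1) div 2 \<le> l" "l \<le> n"
  obtains v where "v \<noteq> 0" "deg n v" "up * v = 0" "wt * v = (2 * of_nat l - of_nat n) *\<^sub>c v"
proof
  define s where "s = tcat 1 la lf - tcat 1 lf la"
  have cf1: "cf (letter q) [i] = q i" if "i < 4" for q i
    using that by (simp add: letter_def ptens_def)
  \<comment> \<open>\<open>lf\<close> has no component along 1, so at this word only
    \<open>la\<close> followed by \<open>lf\<close> contributes.\<close>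
  have "cf s [0, 2] = qa 0 * (- 1 / 2) - 0"
    unfolding s_def la_def lf_eq by (simp add: cf_tc cf1 qa_def)
  then have s0: "s \<noteq> 0" by (auto simp: qa_def)
  have sd: "deg 2 s" using deg_tc[of 1 lf 1 la] deg_tc[of 1 la 1 lf] by (simp add: s_def numeral_2_eq_2)
  have su: "up * s = 0" by (simp add: s_def right_diff_distrib tcat_derivations letter_simps)
  have sw: "wt * s = 0 *\<^sub>c s" 
    by (rule ht_eqI) (simp add: s_def right_diff_distrib tcat_derivations letter_simps)
  have la0: "la \<noteq> 0" using cf1[of 0 qa] by (auto simp: la_def qa_def)
  have upt: "up * tcatpow d X k = 0" if "up * X = 0" for d X k
    using that by (induction k) (simp_all add: tcat_derivations)
  define v where "v = tcat (2 * (n - l)) (tcatpow 2 s (n - l)) (tcatpow 1 la (2 * l - n))"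
  have nl: "2 * (n - l) + (2 * l - n) = n" using assms by auto
  show "v \<noteq> 0" unfolding v_def
    by (intro tcat_neq_0 tcatpow_neq_0 deg_tp) (use s0 sd la0 in auto)
  show "deg n v" unfolding v_def
    using deg_tc[OF deg_tp[of 1 "2 * l - n" la], of "2 * (n - l)"] nl by simp
  show "up * v = 0" unfolding v_def by (simp add: tcat_derivations upt su letter_simps)
  have "of_nat (2 * l - n) = 2 * of_nat l - (of_nat n :: complex)"
    using assms by (subst of_nat_diff) auto
  then show "wt * v = (2 * of_nat l - of_nat n) *\<^sub>c v" unfolding v_def
    using wt_tp[OF sw, of 2 "n - l"] wt_tp[of la 1 1 "2 * l - n"]
    by (simp add: tcat_derivations letter_simps)
qed

text \<open>Descent from the highest weight: putting \<open>up\<close> to the left and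
  \<open>dn\<close> to the right of the element at k gives the one at k + 1 times
  \<open>(l - k) * (l + k + 1 - n)\<close>, which is nonzero in this range. Hence the element at k
  cannot vanish.\<close>

lemma wproj_el_neq_0:
  assumes l: "(n + 1) div 2 \<le> l" "l \<le> n" and "n - l \<le> k" "k \<le> l"
  shows "wproj n k * isoproj n l \<noteq> 0"
  using assms(4,3)
proof (induction k rule: inc_induct)
  case base
  obtain v where v: "v \<noteq> 0" "deg n v" "up * v = 0" "wt * v = (2 * of_nat l - of_nat n) *\<^sub>c v"
    using highest_weight_vector[OF l] .
  have "casimir * v = casval n l *\<^sub>c v"
    by (rule ht_eqI) (simp add: casimir_def distrib_right v mult.assoc casval_def field_simps)
  then have "isoproj n l * v = v" using v l by (simp add: isoproj_eigen)
  moreover have "wproj n l * v = v" using v by (simp add: wproj_mult_weight_vector)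
  ultimately have "wproj n l * isoproj n l * v = v" by (simp add: mult.assoc)
  then show ?case using v by auto
next
  case (step k)
  have "wproj n (Suc k) * isoproj n l \<noteq> 0" using step by simp
  moreover have "up * (wproj n k * isoproj n l) * dn = (casval n l - casval n (n - Suc k)) *\<^sub>c (wproj n (Suc k) * isoproj n l)"
  proof -
    have "up * (wproj n k * isoproj n l) * dn = up * (wproj n k * dn) * isoproj n l"
      using isoproj_commute[OF casimir_dn, of n l] by (simp add: mult.assoc)
    also have "\<dots> = casfac n (n - Suc k) * wproj n (Suc k) * isoproj n l"
      using step l by (simp add: wproj_dn up_dn_P)
    also have "\<dots> = casfac n (n - Suc k) * isoproj n l * wproj n (Suc k)"
      by (simp add: mult.assoc isoproj_P)
    also have "\<dots> = (casval n l - casval n (n - Suc k)) *\<^sub>c (isoproj n l * wproj n (Suc k))"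
      using l by (simp add: casfac_def left_diff_distrib casimir_el scl_distribs)
    finally show ?thesis by (simp add: isoproj_P)
  qed
  moreover have "casval n l - casval n (n - Suc k) \<noteq> 0"
  proof -
    have "casval n l - casval n (n - Suc k) = of_nat (l + k + 1 - n) * of_nat (l - k)"
      unfolding casval_diff using step l by (simp add: of_nat_diff algebra_simps)
    moreover have "l + k + 1 - n \<noteq> 0" "l - k \<noteq> 0" using step l by auto
    ultimately show ?thesis by (metis mult_eq_0_iff of_nat_eq_0_iff)
  qed
  ultimately show ?case by auto
qed

section \<open>Corner algebras\<close>

lemma symm_induct_steps [consumes 1, case_names add scale wt up dn one]:
  assumes X: "symm n X"
    and add: "\<And>x y. N x \<Longrightarrow> N y \<Longrightarrow> N (x + y)"
    and scale: "\<And>c x. N x \<Longrightarrow> N (c *\<^sub>c x)"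
    and wt: "\<And>x. N x \<Longrightarrow> N (wt * x)"
    and up: "\<And>x. N x \<Longrightarrow> N (up * x)"
    and dn: "\<And>x. N x \<Longrightarrow> N (dn * x)"
    and one: "N (hunit n)"
  shows "N X"
  using X
proof (induction rule: symm_induct)
  case (Esum j x)
  have "N ((- \<i>) *\<^sub>c (wt * x))" "N (up * x + (- 1) *\<^sub>c (dn * x))" "N ((- \<i>) *\<^sub>c (up * x + dn * x))"
    using Esum by (auto intro!: add scale wt up dn)
  moreover have "Esum 1 * x = (- \<i>) *\<^sub>c (wt * x)" "Esum 2 * x = up * x + (- 1) *\<^sub>c (dn * x)"
    "Esum 3 * x = (- \<i>) *\<^sub>c (up * x + dn * x)"
    unfolding Esum_eq by (simp_all add: distrib_right left_diff_distrib flip: minus_eq_scl)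
  moreover have "j = 1 \<or> j = 2 \<or> j = 3" using Esum by auto
  ultimately show ?case by auto
qed (use assms in auto)

text \<open>The Casimir element commutes with the generators \<open>wt\<close>, \<open>up\<close>,
  \<open>dn\<close>, and \<open>isoproj n l\<close> is a polynomial in it within degree n.\<close>

lemma isoproj_central: "symm n s \<Longrightarrow> isoproj n l * s = s * isoproj n l"
proof (induction rule: symm_induct_steps)
  case (wt x)
  then show ?case using isoproj_commute[OF casimir_wt, of n l] by (metis mult.assoc)
next
  case (up x)
  then show ?case using isoproj_commute[OF casimir_up, of n l] by (metis mult.assoc)
next
  case (dn x)
  then show ?case using isoproj_commute[OF casimir_dn, of n l] by (metis mult.assoc)
next
  case one
  show ?case by (rule hunit_commute)
qed (simp_all add: distrib_left distrib_right)

lemma symm_D_mult: "j \<noteq> 0 \<Longrightarrow> symm n x \<Longrightarrow> symm n (Esum j * x)"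
  using symm_mult[OF symm_D[of j n], of x] symm_deg[of n x]
  by (metis deg_def mult.assoc hunit_commute)

lemma symm_steps: assumes "symm n x" shows "symm n (wt * x)" "symm n (up * x)" "symm n (dn * x)"
  using assms by (simp_all add: wt_def up_def dn_def distrib_right left_diff_distrib symm_D_mult)

lemma symm_R: "symm n x \<Longrightarrow> symm n (casprod m ms * x)"
  by (induction ms) (simp_all add: casfac_def casimir_def distrib_right left_diff_distrib mult.assoc symm_steps)

lemma symm_el [simp]: "symm n (isoproj n l)"
  by (simp add: isoproj_def symm_R)

text \<open>The weight \<open>j\<close> part of \<open>Sym\<^sup>n \<cdot> p\<^sub>k e\<^sub>l\<close> is spanned by this single element.\<close>

definition lad :: "nat \<Rightarrow> nat \<Rightarrow> nat \<Rightarrow> nat \<Rightarrow> ht" where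
  "lad n l k j = (if k \<le> j then up ^ (j - k) else dn ^ (k - j)) * (wproj n k * isoproj n l)"

lemma up_power_P: "up ^ t * wproj n k = wproj n (k + t) * up ^ t"
proof (induction t)
  case (Suc t)
  have "up ^ Suc t * wproj n k = up * (wproj n (k + t) * up ^ t)" using Suc by (simp add: mult.assoc)
  also have "\<dots> = wproj n (k + Suc t) * up ^ Suc t"
    using wproj_up[of n "k + t"] by (simp add: mult.assoc[symmetric])
  finally show ?case .
qed simp

lemma dn_power_P: "dn ^ t * wproj n (j + t) = wproj n j * dn ^ t"
proof (induction t arbitrary: j)
  case (Suc t)
  have "dn ^ Suc t * wproj n (j + Suc t) = dn * (wproj n (Suc j) * dn ^ t)"
    using Suc[of "Suc j"] by (simp add: mult.assoc)
  also have "\<dots> = wproj n j * dn ^ Suc t"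
    using wproj_dn[of n j] by (simp add: mult.assoc[symmetric])
  finally show ?case .
qed simp

lemma wproj_lad: "wproj n j * lad n l k j = lad n l k j"
proof (cases "k \<le> j")
  case True
  have "wproj n j * up ^ (j - k) * (wproj n k * isoproj n l) = up ^ (j - k) * wproj n k * (wproj n k * isoproj n l)"
    using True up_power_P[of "j - k" n k] by simp
  also have "\<dots> = up ^ (j - k) * (wproj n k * wproj n k) * isoproj n l" by (simp only: mult.assoc)
  finally show ?thesis using True by (simp add: lad_def wproj_mult_P mult.assoc)
next
  case False
  have "wproj n j * dn ^ (k - j) * (wproj n k * isoproj n l) = dn ^ (k - j) * wproj n k * (wproj n k * isoproj n l)"
    using False dn_power_P[of "k - j" n j] by simp
  also have "\<dots> = dn ^ (k - j) * (wproj n k * wproj n k) * isoproj n l" by (simp only: mult.assoc)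
  finally show ?thesis using False by (simp add: lad_def wproj_mult_P mult.assoc)
qed

lemma casimir_lad:
  assumes "(n + 1) div 2 \<le> l" "l \<le> n" shows "casimir * lad n l k j = casval n l *\<^sub>c lad n l k j"
proof -
  have pw: "casimir * x ^ t = x ^ t * casimir" if "casimir * x = x * casimir" for x t
    using that by (metis power_commuting_commutes)
  have "casimir * (z * (wproj n k * isoproj n l)) = z * (wproj n k * (casimir * isoproj n l))" if "casimir * z = z * casimir" for z
    using that casimir_P[of n k] by (metis mult.assoc)
  then show ?thesis
    using assms by (simp add: lad_def casimir_el pw casimir_up casimir_dn)
qed

lemma casfac_lad:
  assumes "(n + 1) div 2 \<le> l" "l \<le> n" shows "casfac n m * lad n l k j = (casval n l - casval n m) *\<^sub>c lad n l k j"
  using assms by (simp add: casfac_def left_diff_distrib casimir_lad scl_distribs)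

lemma dn_up_lad:
  assumes "(n + 1) div 2 \<le> l" "l \<le> n" shows "\<exists>c. dn * (up * lad n l k j) = c *\<^sub>c lad n l k j"
proof -
  have "dn * (up * lad n l k j) = (dn * (up * wproj n j)) * lad n l k j" by (simp add: mult.assoc wproj_lad)
  then show ?thesis using assms by (auto simp: dn_up_P mult.assoc wproj_lad casfac_lad)
qed

lemma up_dn_lad:
  assumes "(n + 1) div 2 \<le> l" "l \<le> n" shows "\<exists>c. up * (dn * lad n l k j) = c *\<^sub>c lad n l k j"
proof (cases "j \<le> n")
  case True
  have "up * (dn * lad n l k j) = (up * (dn * wproj n j)) * lad n l k j" by (simp add: mult.assoc wproj_lad)
  then show ?thesis using assms True by (auto simp: up_dn_P mult.assoc wproj_lad casfac_lad)
next
  case False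
  \<comment> \<open>\<open>up_dn_P\<close> covers indices up to n; above n the ladder is 0.\<close>
  then have "lad n l k j = 0" using wproj_lad[of n j l k] by (simp add: wproj_eq_0)
  then show ?thesis by simp
qed

text \<open>From k upwards the ladder grows by one power of \<open>up\<close>; below k,
  \<open>up\<close> meets the last \<open>dn\<close>, and their product is a scalar by the Casimir
  eigenvalue.\<close>

lemma up_lad:
  assumes "(n + 1) div 2 \<le> l" "l \<le> n" shows "\<exists>c. up * lad n l k j = c *\<^sub>c lad n l k (Suc j)"
proof (cases "k \<le> j")
  case True
  then have "up * lad n l k j = 1 *\<^sub>c lad n l k (Suc j)"
    by (simp add: lad_def Suc_diff_le mult.assoc)
  then show ?thesis by blast
next
  case False
  then have "k - j = Suc (k - Suc j)" by simp
  with False have "lad n l k j = dn * lad n l k (Suc j)"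
    by (auto simp: lad_def mult.assoc)
  then show ?thesis using up_dn_lad[OF assms] by simp
qed

lemma dn_lad:
  assumes "(n + 1) div 2 \<le> l" "l \<le> n" shows "\<exists>c. dn * lad n l k (Suc j) = c *\<^sub>c lad n l k j"
proof (cases "k \<le> j")
  case True
  then have "lad n l k (Suc j) = up * lad n l k j"
    by (simp add: lad_def Suc_diff_le mult.assoc)
  then show ?thesis using dn_up_lad[OF assms] by simp
next
  case False
  then have "k - j = Suc (k - Suc j)" by simp
  with False have "dn * lad n l k (Suc j) = 1 *\<^sub>c lad n l k j"
    by (auto simp: lad_def mult.assoc)
  then show ?thesis by blast
qed

text \<open>Induction over the generators, for all j at once: \<open>wt\<close> contributes a scalar
  at weight index j, while \<open>up\<close> and \<open>dn\<close> reduce the claim to a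
  neighbouring index and one rung of the ladder.\<close>

lemma wproj_symm_lad:
  assumes "(n + 1) div 2 \<le> l" "l \<le> n" "symm n s"
  shows "\<exists>c. wproj n j * (s * (wproj n k * isoproj n l)) = c *\<^sub>c lad n l k j"
  using assms(3)
proof (induction arbitrary: j rule: symm_induct_steps)
  case (add x y)
  obtain a b where "wproj n j * (x * (wproj n k * isoproj n l)) = a *\<^sub>c lad n l k j" "wproj n j * (y * (wproj n k * isoproj n l)) = b *\<^sub>c lad n l k j"
    using add by metis
  then have "wproj n j * ((x + y) * (wproj n k * isoproj n l)) = (a + b) *\<^sub>c lad n l k j"
    by (simp add: distrib_left distrib_right scl_distribs)
  then show ?case by blast
next
  case (scale c x)
  obtain a where "wproj n j * (x * (wproj n k * isoproj n l)) = a *\<^sub>c lad n l k j" using scale by metis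
  then show ?case by auto
next
  case (wt x)
  obtain a where "wproj n j * (x * (wproj n k * isoproj n l)) = a *\<^sub>c lad n l k j" using wt by metis
  moreover have "wproj n j * (wt * x * (wproj n k * isoproj n l)) = (wproj n j * wt) * (x * (wproj n k * isoproj n l))"
    by (simp only: mult.assoc)
  ultimately show ?case by (auto simp: wproj_wt)
next
  case (up x)
  show ?case
  proof (cases j)
    case 0
    have "wproj n 0 * (up * x * (wproj n k * isoproj n l)) = (wproj n 0 * up) * (x * (wproj n k * isoproj n l))"
      by (simp only: mult.assoc)
    also have "\<dots> = 0 *\<^sub>c lad n l k j" by (simp add: wproj_0_up)
    finally show ?thesis using 0 by blast
  next
    case (Suc i)
    obtain a where a: "wproj n i * (x * (wproj n k * isoproj n l)) = a *\<^sub>c lad n l k i" using up by metis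
    have "wproj n j * (up * x * (wproj n k * isoproj n l)) = (wproj n (Suc i) * up) * (x * (wproj n k * isoproj n l))"
      by (simp only: mult.assoc Suc)
    also have "\<dots> = up * (wproj n i * (x * (wproj n k * isoproj n l)))"
      by (simp only: wproj_up mult.assoc)
    finally show ?thesis using a up_lad[OF assms(1,2), of k i] by (auto simp: Suc)
  qed
next
  case (dn x)
  obtain a where a: "wproj n (Suc j) * (x * (wproj n k * isoproj n l)) = a *\<^sub>c lad n l k (Suc j)" using dn by metis
  have "wproj n j * (dn * x * (wproj n k * isoproj n l)) = (wproj n j * dn) * (x * (wproj n k * isoproj n l))"
    by (simp only: mult.assoc)
  also have "\<dots> = dn * (wproj n (Suc j) * (x * (wproj n k * isoproj n l)))"
    by (simp only: wproj_dn mult.assoc)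
  finally show ?case using a dn_lad[OF assms(1,2), of k j] by auto
next
  case one
  have "wproj n j * (hunit n * (wproj n k * isoproj n l)) = wproj n j * wproj n k * isoproj n l"
    by (simp add: mult.assoc deg_def[THEN iffD1])
  also have "\<dots> = (if j = k then 1 else 0) *\<^sub>c lad n l k j"
    by (simp add: wproj_mult_P lad_def)
  finally show ?case by blast
qed

text \<open>The ladder at \<open>j = k\<close> is the corner element itself, so the corner consists
  of its multiples; all primitivity proofs rest on this.\<close>

lemma corner_scalar:
  assumes "(n + 1) div 2 \<le> l" "l \<le> n" "symm n s"
  shows "\<exists>c. wproj n k * s * (wproj n k * isoproj n l) = c *\<^sub>c (wproj n k * isoproj n l)"
  using wproj_symm_lad[OF assms, of k k] by (simp add: lad_def mult.assoc)

section \<open>The tensor power of e_2 and complex conjugation\<close>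

definition e2pow :: "nat \<Rightarrow> ht" where "e2pow n = tcatpow 1 (uletter 2) n"

lemma cf_jn: "cf (e2pow n) w = (if w = replicate n 2 then 1 else 0)"
proof (induction n arbitrary: w)
  case 0
  then show ?case by (auto simp: e2pow_def cf_pr)
next
  case (Suc n)
  have "e2pow (Suc n) = tcat 1 (uletter 2) (e2pow n)" by (simp add: e2pow_def)
  moreover have "cf (uletter 2) [i] = (if i = 2 then 1 else 0)" for i
    by (simp add: letter_def cf_mk ptens_def)
  ultimately show ?case by (cases w) (auto simp: cf_tc Suc)
qed

lemma symm_jn [simp]: "symm n (e2pow n)"
proof (rule symmI_mset)
  fix w w' :: "nat list" assume *: "length w = n" "valid w" "mset w = mset w'"
  have "set w = set w'" "length w' = n" using * by (auto dest: mset_eq_setD mset_eq_length)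
  moreover have "v = replicate n 2 \<longleftrightarrow> set v \<subseteq> {2::nat}" if "length v = n" for v :: "nat list"
  proof
    assume "v = replicate n 2"
    then show "set v \<subseteq> {2}" by auto
  next
    assume "set v \<subseteq> {2}"
    then show "v = replicate n 2" using that by (intro replicate_eqI) auto
  qed
  ultimately show "cf (e2pow n) w = cf (e2pow n) w'" using * by (simp add: cf_jn)
qed (auto simp: cf_jn)

text \<open>\<open>e_1\<close> and \<open>e_2\<close> anticommute, and each term of the sum over
  positions contains a single \<open>e_1\<close>.\<close>

lemma wt_jn: "wt * e2pow n = (- 1) *\<^sub>c (e2pow n * wt)"
proof (induction n)
  case (Suc n)
  have "wt * uletter 2 = (- 1) *\<^sub>c (uletter 2 * wt)"
    unfolding wt_def
    by (simp add: Esum_lt letter_linear, rule letter_cong, simp only: less4, elim disjE; simp)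
  then show ?case using Suc by (simp add: e2pow_def tcat_derivations scl_distribs)
qed (simp add: e2pow_def)

lemma e2pow_sq: "e2pow n * e2pow n = (- 1) ^ n *\<^sub>c hunit n"
proof (induction n)
  case (Suc n)
  have "uletter 2 * uletter 2 = Esum 2 * (hunit 1 * uletter 2)" by (simp add: Esum_pr_1 flip: mult.assoc)
  also have "\<dots> = Esum 2 * uletter 2" using deg_lt[of "\<lambda>i. if i = 2 then 1 else 0"] by (simp add: deg_def)
  also have "\<dots> = (- 1) *\<^sub>c hunit 1"
    unfolding One_nat_def uletter_0[symmetric]
    by (simp add: Esum_lt letter_linear, rule letter_cong, simp only: less4, elim disjE; simp)
  finally show ?case using Suc tcat_pr[of 1 n] by (simp add: e2pow_def tcat_mult)
qed (simp add: e2pow_def)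

text \<open>Since \<open>e2pow n\<close> anticommutes with \<open>wt\<close>, it negates weights,
  that is, it sends index j to n - j.\<close>

lemma wproj_jn: "k \<le> n \<Longrightarrow> wproj n k * e2pow n = e2pow n * wproj n (n - k)"
proof (rule wproj_mult_intertwine)
  fix j
  have "wt * (e2pow n * wproj n j) = (- 1) *\<^sub>c (e2pow n * (wt * wproj n j))"
    by (simp add: wt_jn flip: mult.assoc)
  then show "wt * (e2pow n * wproj n j) = (of_nat n - 2 * of_nat j) *\<^sub>c (e2pow n * wproj n j)"
    by (simp add: wt_P)
  assume "k \<le> n" "j \<le> n"
  have "of_nat n - 2 * of_nat j = 2 * of_nat k - (of_nat n :: complex) \<longleftrightarrow> of_nat (2 * n) = (of_nat (2 * (k + j)) :: complex)"
    by (auto simp: algebra_simps)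
  then show "of_nat n - 2 * of_nat j = 2 * of_nat k - (of_nat n :: complex) \<longleftrightarrow> j = n - k"
    using \<open>k \<le> n\<close> unfolding of_nat_eq_iff by auto
qed

text \<open>Conjugation of the coefficients, which fixes exactly the real tensors; it is not
  quaternionic conjugation.\<close>

definition hconj :: "ht \<Rightarrow> ht" where "hconj X = to_ht (\<lambda>w. cnj (cf X w))"

lemma cf_cj [simp]: "cf (hconj X) w = cnj (cf X w)"
  by (simp add: hconj_def cf_mk cf_invalid)

lemma hconj_linear [simp]: "hconj 0 = 0" "hconj (X + Y) = hconj X + hconj Y" "hconj (c *\<^sub>c X) = cnj c *\<^sub>c hconj X"
  by (auto intro!: ht_eqI)

lemma hconj_sum: "hconj (\<Sum>i\<in>A. f i) = (\<Sum>i\<in>A. hconj (f i))"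
  by (induction A rule: infinite_finite_induct) simp_all

lemma hconj_mult [simp]: "hconj (X * Y) = hconj X * hconj Y"
proof (rule ht_eqI)
  fix w assume w: "valid w"
  have q: "cnj (qsgn i j) = qsgn i j" for i j by (simp add: qsgn_def)
  have "cnj (wsgn u v) = wsgn u v" for u v
    unfolding wsgn_def by (induction u v rule: list_induct2') (simp_all add: q)
  then show "cf (hconj (X * Y)) w = cf (hconj X * hconj Y) w"
    using w by (simp add: cf_times mulc_eq_sum)
qed

lemma hconj_pr [simp]: "hconj (hunit n) = hunit n"
  by (rule ht_eqI) (simp add: cf_pr)

lemma hconj_jn [simp]: "hconj (e2pow n) = e2pow n"
  by (rule ht_eqI) (simp add: cf_jn)

lemma hconj_wt: "hconj wt = (- 1) *\<^sub>c wt"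
proof -
  have "cnj (dcf j w) = dcf j w" for j w
    by (induction w) (auto simp: onec_def)
  then have "hconj (Esum 1) = Esum 1" by (intro ht_eqI) (simp add: Esum_def)
  then show ?thesis by (simp add: wt_def)
qed

text \<open>Conjugation negates \<open>wt\<close>, so the conjugate of \<open>wproj n j\<close> has
  the opposite weight; multiplying the conjugated decomposition of \<open>hunit n\<close> by
  \<open>wproj n (n - k)\<close> isolates the term j = k.\<close>

lemma hconj_P: "k \<le> n \<Longrightarrow> hconj (wproj n k) = wproj n (n - k)"
proof -
  assume k: "k \<le> n"
  have w: "wt * hconj (wproj n j) = (of_nat n - 2 * of_nat j) *\<^sub>c hconj (wproj n j)" for j
  proof -
    have "wt * hconj (wproj n j) = (- 1) *\<^sub>c hconj (wt * wproj n j)" by (simp add: hconj_wt)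
    also have "\<dots> = (of_nat n - 2 * of_nat j) *\<^sub>c hconj (wproj n j)" by (simp add: wt_P)
    finally show ?thesis .
  qed
  have d: "deg n (hconj (wproj n j))" for j
    using arg_cong[of _ _ hconj, OF deg_def[THEN iffD1, OF deg_P[of n j]]] by (simp add: deg_def)
  have e: "of_nat n - 2 * of_nat j = 2 * of_nat (n - k) - (of_nat n :: complex) \<longleftrightarrow> j = k" for j
  proof -
    have "of_nat n - 2 * of_nat j = 2 * of_nat (n - k) - (of_nat n :: complex) \<longleftrightarrow> of_nat (2 * k) = (of_nat (2 * j) :: complex)"
      using k by (auto simp: algebra_simps of_nat_diff)
    then show ?thesis unfolding of_nat_eq_iff by auto
  qed
  have "wproj n (n - k) = wproj n (n - k) * hconj (hunit n)" using deg_times_pr[OF deg_P] by simp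
  also have "\<dots> = (\<Sum>j\<le>n. wproj n (n - k) * hconj (wproj n j))"
    by (simp add: hconj_sum sum_distrib_left flip: sum_P)
  also have "\<dots> = (\<Sum>j\<le>n. if j = k then hconj (wproj n j) else 0)"
    by (intro sum.cong refl) (simp only: wproj_mult_weight_vector[OF d w] e)
  also have "\<dots> = hconj (wproj n k)" using k by simp
  finally show ?thesis ..
qed

section \<open>Translation from coordinates\<close>

lemma cf_mk_words: "u \<in> words n \<Longrightarrow> cf (to_ht x) u = x u"
  by (simp add: words_valid)

text \<open>The factor \<open>hunit n\<close> reflects that \<open>tmul n\<close> sets the
  coefficients at words of other lengths to 0.\<close>

lemma to_ht_tmul: "to_ht (tmul n x y) = hunit n * (to_ht x * to_ht y)"
proof (rule ht_eqI)
  fix w assume w: "valid w"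
  show "cf (to_ht (tmul n x y)) w = cf (hunit n * (to_ht x * to_ht y)) w"
  proof (cases "length w = n")
    case True
    have "mulc (cf (to_ht x)) (cf (to_ht y)) w = mulc x y w"
      using w by (intro mulc_cong) (auto simp: cf_mk_words)
    then show ?thesis using True w by (simp add: cf_pr_times cf_times tmul_eq_mulc words_valid)
  next
    case False
    then show ?thesis using w by (simp add: cf_pr_times tmul_def words_valid)
  qed
qed

lemma to_ht_tadd: "to_ht (tadd x y) = to_ht x + to_ht y"
  and to_ht_smul: "to_ht (smul c x) = c *\<^sub>c to_ht x"
  and to_ht_tzero: "to_ht tzero = 0"
  by (rule ht_eqI; simp add: tadd_def smul_def tzero_def)+

lemma to_ht_tone: "to_ht (tone n) = hunit n"
  by (simp add: hunit_def)

lemma to_ht_lincomb: "to_ht (\<lambda>w. \<Sum>i\<in>A. c i * x i w) = (\<Sum>i\<in>A. c i *\<^sub>c to_ht (x i))"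
  by (rule ht_eqI) (simp add: cf_sum)

lemma to_ht_perm_act: "\<sigma> permutes {..<n} \<Longrightarrow> to_ht (perm_act n \<sigma> x) = permute n \<sigma> (to_ht x)"
  by (rule ht_eqI) (auto simp: cf_act perm_act_def permute_list_def cf_mk valid_permute_list[unfolded permute_list_def])

lemma to_ht_symz: "to_ht (symz n x) = symmetrize n (to_ht x)"
proof (rule ht_eqI)
  fix w assume w: "valid w"
  have "perm_act n \<sigma> x w = cf (permute n \<sigma> (to_ht x)) w" if "\<sigma> permutes {..<n}" for \<sigma>
    using w by (simp flip: to_ht_perm_act[OF that])
  then show "cf (to_ht (symz n x)) w = cf (symmetrize n (to_ht x)) w"
    using w by (simp add: symmetrize_eq symz_def cf_sum)
qed

lemma to_ht_tconc: "to_ht (tconc p x y) = tcat p (to_ht x) (to_ht y)"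
  by (rule ht_eqI) (simp add: cf_tc tconc_def valid_takeD valid_dropD)

lemma to_ht_tpow: "to_ht (tpow d x k) = tcatpow d (to_ht x) k"
  by (induction k) (simp_all add: to_ht_tone to_ht_tconc)

lemma ptens_append: "ptens (qs @ rs) = tconc (length qs) (ptens qs) (ptens rs)"
proof
  fix w
  show "ptens (qs @ rs) w = tconc (length qs) (ptens qs) (ptens rs) w"
  proof (cases "length w = length qs + length rs")
    case True
    then obtain u v where "w = u @ v" "length u = length qs" "length v = length rs"
      by (metis append_take_drop_id length_append length_drop length_take add_diff_cancel_left' le_add1 min.absorb2)
    then show ?thesis by (auto simp: ptens_def tconc_def)
  next
    case False
    then show ?thesis by (auto simp: ptens_def tconc_def)
  qed
qed

lemma to_ht_ptens_replicate: "to_ht (ptens (replicate k q)) = tcatpow 1 (letter q) k"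
proof (induction k)
  case 0
  have "ptens [] = (tone 0 :: complex tensor)" by (auto simp: ptens_def tone_def)
  then show ?case by (simp add: to_ht_tone)
next
  case (Suc k)
  then show ?case using ptens_append[of "[q]" "replicate k q"] by (simp add: to_ht_tconc letter_def)
qed

lemma tens_iff: "x \<in> tens n \<longleftrightarrow> (\<forall>w. \<not> (length w = n \<and> valid w) \<longrightarrow> x w = 0)"
  by (simp add: tens_def words_valid)

lemma deg_mk: "x \<in> tens n \<Longrightarrow> deg n (to_ht x)"
  by (auto simp: deg_iff tens_iff cf_mk)

lemma to_ht_inj: "x \<in> tens n \<Longrightarrow> y \<in> tens n \<Longrightarrow> to_ht x = to_ht y \<Longrightarrow> x = y"
proof
  fix w assume "x \<in> tens n" "y \<in> tens n" "to_ht x = to_ht y"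
  then show "x w = y w" by (cases "valid w") (metis cf_mk_valid, simp add: tens_iff)
qed

lemma tens_tmul [simp]: "tmul n x y \<in> tens n"
  by (simp add: tens_def tmul_def)

lemma to_ht_tmul_tens: "x \<in> tens n \<Longrightarrow> to_ht (tmul n x y) = to_ht x * to_ht y"
  using deg_mk[of x n] by (simp add: to_ht_tmul deg_def flip: mult.assoc)

lemma perm_act_tens:
  assumes "x \<in> tens n" "\<sigma> permutes {..<n}" shows "perm_act n \<sigma> x \<in> tens n"
  using assms by (auto simp: tens_iff perm_act_def valid_permute_list[unfolded permute_list_def])

lemma symz_tens: "x \<in> tens n \<Longrightarrow> symz n x \<in> tens n"
  using perm_act_tens[of x n] unfolding symz_def by (auto simp: tens_iff intro!: sum.neutral)

lemma SymT_iff: "x \<in> SymT n \<longleftrightarrow> x \<in> tens n \<and> symm n (to_ht x)"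
proof -
  have "perm_act n \<sigma> x = x \<longleftrightarrow> permute n \<sigma> (to_ht x) = to_ht x" if "x \<in> tens n" "\<sigma> permutes {..<n}" for \<sigma>
    using to_ht_inj[OF perm_act_tens[OF that] that(1)] that(2) by (auto simp flip: to_ht_perm_act)
  then show ?thesis by (auto simp: SymT_def symm_def deg_mk)
qed

lemma tone_tens [simp]: "tone n \<in> tens n"
  by (auto simp: tens_iff tone_def)

lemma tadd_tens [simp]: "x \<in> tens n \<Longrightarrow> y \<in> tens n \<Longrightarrow> tadd x y \<in> tens n"
  and smul_tens [simp]: "x \<in> tens n \<Longrightarrow> smul c x \<in> tens n"
  and tzero_tens [simp]: "tzero \<in> tens n"
  by (auto simp: tens_iff tadd_def smul_def tzero_def)

lemma lincomb_tens:
  fixes c :: "'i \<Rightarrow> 'a::field"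
  shows "(\<And>i. i \<in> A \<Longrightarrow> x i \<in> tens n) \<Longrightarrow> (\<lambda>w. \<Sum>i\<in>A. c i * x i w) \<in> tens n"
  by (auto simp: tens_iff intro!: sum.neutral)

lemma tconc_tens: "x \<in> tens p \<Longrightarrow> y \<in> tens q \<Longrightarrow> tconc p x y \<in> tens (p + q)"
proof -
  assume *: "x \<in> tens p" "y \<in> tens q"
  show ?thesis unfolding tens_iff
  proof (intro allI impI)
    fix w assume "\<not> (length w = p + q \<and> valid w)"
    moreover have "valid w \<longleftrightarrow> valid (take p w) \<and> valid (drop p w)"
      by (metis append_take_drop_id valid_simps(3))
    ultimately show "tconc p x y w = 0"
      using * by (auto simp: tens_iff tconc_def)
  qed
qed

lemma tpow_tens: "x \<in> tens d \<Longrightarrow> tpow d x k \<in> tens (d * k)"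
  by (induction k) (auto dest: tconc_tens)

lemma ptens_tens: "length qs = n \<Longrightarrow> ptens qs \<in> tens n"
  by (auto simp: tens_iff ptens_def valid_def)

lemma sqH_tens: "sqH \<in> tens 2" and sqHc_tens: "sqHc \<in> tens 2"
  by (auto simp: tens_iff sqH_def sqHc_def)

section \<open>Extension of scalars from real to complex tensors\<close>

definition ofr :: "real tensor \<Rightarrow> complex tensor" where
  "ofr x = (\<lambda>w. complex_of_real (x w))"

lemma ofr_inj: "ofr x = ofr y \<Longrightarrow> x = y"
  by (auto simp: ofr_def fun_eq_iff)

lemma of_real_wsgn: "complex_of_real (wsgn u v) = wsgn u v"
  unfolding wsgn_def by (induction u v rule: list_induct2') (simp_all add: qsgn_def)

lemma ofr_tmul: "ofr (tmul n x y) = tmul n (ofr x) (ofr y)"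
  by (auto simp: ofr_def tmul_def fun_eq_iff of_real_wsgn intro!: sum.cong)

lemma ofr_simps:
  "ofr (tadd x y) = tadd (ofr x) (ofr y)" "ofr (smul c x) = smul (complex_of_real c) (ofr x)"
  "ofr tzero = tzero" "ofr (tone n) = tone n" "ofr (tconc p x y) = tconc p (ofr x) (ofr y)"
  "ofr (perm_act n \<sigma> x) = perm_act n \<sigma> (ofr x)" "ofr (symz n x) = symz n (ofr x)"
  "ofr sqH = sqH" "ofr sqHc = sqHc" "ofr triH = triH"
  by (auto simp: ofr_def tadd_def smul_def tzero_def tone_def tconc_def perm_act_def symz_def
      sqH_def sqHc_def triH_def fun_eq_iff intro!: sum.cong)

lemma ofr_tpow: "ofr (tpow d x k) = tpow d (ofr x) k"
  by (induction k) (simp_all add: ofr_simps)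

lemma ofr_lincomb: "ofr (\<lambda>w. \<Sum>i\<in>A. c i * x i w) = (\<lambda>w. \<Sum>i\<in>A. complex_of_real (c i) * ofr (x i) w)"
  by (simp add: ofr_def)

lemma ofr_ptens_qe2: "ofr (ptens (replicate n qe2)) = ptens (replicate n qe2)"
proof -
  have "complex_of_real (prod_list (map2 (\<lambda>q j. q j) (replicate k qe2) w)) =
      prod_list (map2 (\<lambda>q j. q j) (replicate k qe2) w)" for k w
  proof (induction k arbitrary: w)
    case (Suc k)
    then show ?case by (cases w) (auto simp: qe2_def)
  qed simp
  then show ?thesis by (auto simp: ofr_def ptens_def fun_eq_iff)
qed

lemma ofr_tens_iff: "ofr x \<in> tens n \<longleftrightarrow> x \<in> tens n"
  by (simp add: ofr_def tens_def)

lemma ofr_SymT_iff: "ofr x \<in> SymT n \<longleftrightarrow> x \<in> SymT n"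
  by (auto simp: SymT_def ofr_tens_iff dest: ofr_inj simp flip: ofr_simps)

lemma ofr_eH: "ofr (eH n l) = eH n l"
proof -
  have b: "complex_of_real (betaH n m) = betaH n m" for m by (simp add: betaH_def)
  have "ofr (foldr (\<lambda>m. tmul n (F m)) ms z) = foldr (\<lambda>m. tmul n (ofr (F m))) ms (ofr z)"
    for F :: "nat \<Rightarrow> real tensor" and ms z
    by (induction ms) (simp_all add: ofr_tmul)
  then show ?thesis by (simp add: eH_def ofr_simps triHn_def b del: upt_Suc)
qed

section \<open>The Casimir element in terms of the given diagonal element\<close>

lemma casimir_D: "(- 4) *\<^sub>c casimir = Esum 1 * Esum 1 + Esum 2 * Esum 2 + Esum 3 * Esum 3"
  unfolding casimir_def Esum_eq
  by (rule ht_eqI; simp add: distrib_left distrib_right left_diff_distrib right_diff_distrib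
      up_dn scl_distribs; simp add: algebra_simps)

text \<open>Of the n^2 terms of the square, n have both letters in the same position and give -1
  each; the other n(n-1) agree after symmetrization.\<close>

lemma Esum_D_pr:
  assumes "j < 4" "j \<noteq> 0" "n \<ge> 2"
  shows "Esum j * (Esum j * hunit n) = (of_nat n * of_nat (n - 1)) *\<^sub>c symmetrize n (tcat 2 (tcat 1 (uletter j) (uletter j)) (hunit (n - 2)))
     - of_nat n *\<^sub>c hunit n"
proof -
  obtain m where m: "n = Suc (Suc m)" using assms(3) by (auto simp: numeral_2_eq_2 dest!: le_Suc_ex)
  have Dj: "Esum j * uletter j = (- 1) *\<^sub>c hunit 1"
    unfolding One_nat_def uletter_0[symmetric]
    using assms(1,2) by (simp add: Esum_lt letter_linear, intro letter_cong, simp only: less4) (elim disjE; simp)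
  have "Esum j * hunit n = symmetrize n (Esum j * hunit n)"
    using symmetrize_symm[OF symm_D_mult[OF assms(2) symm_pr[of n]]] by simp
  also have "\<dots> = of_nat n *\<^sub>c symmetrize n (tcat 1 (uletter j) (hunit (n - 1)))"
    by (rule symmetrize_D_pr[OF assms(1,2)])
  finally have "Esum j * (Esum j * hunit n) = of_nat n *\<^sub>c symmetrize n (Esum j * tcat 1 (uletter j) (hunit (n - 1)))"
    using assms(2) by (simp add: Esum_sy)
  also have "Esum j * tcat 1 (uletter j) (hunit (n - 1)) = (- 1) *\<^sub>c hunit n + tcat 1 (uletter j) (Esum j * hunit (n - 1))"
    using Esum_tc[OF assms(1,2), of 1 "uletter j" "hunit (n - 1)"] tcat_pr[of 1 "Suc m"] m by (simp add: Dj)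
  also have "symmetrize n \<dots> = (- 1) *\<^sub>c hunit n + symmetrize n (tcat 1 (uletter j) (symmetrize (n - 1) (Esum j * hunit (n - 1))))"
  proof -
    have "symmetrize n (tcat 1 (uletter j) (symmetrize (n - 1) (Esum j * hunit (n - 1)))) = symmetrize n (tcat 1 (uletter j) (Esum j * hunit (n - 1)))"
      by (rule symmetrize_tc_right) (use m in simp)
    then show ?thesis by (simp add: symmetrize_add symmetrize_symm)
  qed
  also have "symmetrize (n - 1) (Esum j * hunit (n - 1)) = of_nat (n - 1) *\<^sub>c symmetrize (n - 1) (tcat 1 (uletter j) (hunit (n - 2)))"
    using symmetrize_D_pr[OF assms(1,2), of "n - 1"] m by simp
  also have "symmetrize n (tcat 1 (uletter j) (of_nat (n - 1) *\<^sub>c symmetrize (n - 1) (tcat 1 (uletter j) (hunit (n - 2))))) =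
      of_nat (n - 1) *\<^sub>c symmetrize n (tcat 1 (uletter j) (tcat 1 (uletter j) (hunit (n - 2))))"
    using symmetrize_tc_right[of n 1 "n - 1" "uletter j" "tcat 1 (uletter j) (hunit (n - 2))"] m by simp
  also have "tcat 1 (uletter j) (tcat 1 (uletter j) (hunit (n - 2))) = tcat 2 (tcat 1 (uletter j) (uletter j)) (hunit (n - 2))"
    using tcat_assoc[of 1 1 "uletter j" "uletter j" "hunit (n - 2)"] by (simp add: numeral_2_eq_2)
  finally show ?thesis by (simp add: scl_distribs flip: minus_eq_scl)
qed

lemma to_ht_triH: "4 *\<^sub>c to_ht triH = hunit 2 + tcat 1 (uletter 1) (uletter 1) + tcat 1 (uletter 2) (uletter 2) + tcat 1 (uletter 3) (uletter 3)"
proof -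
  have cf_le: "cf (uletter k) u = (if u = [k] then 1 else 0)" if "k < 4" for k u
    using that by (cases u) (auto simp: letter_def cf_mk ptens_def)
  have uletter: "tcat 1 (uletter k) (uletter k) = to_ht (\<lambda>w. if w = [k, k] then 1 else 0)" if "k < 4" for k :: nat
  proof (rule ht_eqI)
    fix w assume "valid w"
    then show "cf (tcat 1 (uletter k) (uletter k)) w = cf (to_ht (\<lambda>w. if w = [k, k] then 1 else 0)) w"
      by (cases w) (simp_all add: cf_tc cf_le[OF that])
  qed
  note uletter = uletter[of 1, simplified] uletter[of 2, simplified] uletter[of 3, simplified]
  have "(\<exists>i<4. w = [i, i]) \<longleftrightarrow> w = [0, 0] \<or> w = [1, 1] \<or> w = [2, 2] \<or> w = [3, 3]" for w :: "nat list"
    by (auto simp: less4)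
  moreover have "replicate 2 0 = [0, 0::nat]" by (simp add: numeral_2_eq_2)
  ultimately show ?thesis
    by (intro ht_eqI) (simp add: uletter triH_def cf_pr)
qed

text \<open>Sum of \<open>Esum_D_pr\<close> over the three letters: the units add up to
  \<open>n(n-1) + 3n = n(n+2)\<close>, and the squares to -4 times the Casimir element.\<close>

lemma to_ht_triHn:
  assumes "n \<ge> 2"
  shows "(4 * of_nat n * of_nat (n - 1)) *\<^sub>c to_ht (triHn n) = (of_nat n * (of_nat n + 2)) *\<^sub>c hunit n - 4 *\<^sub>c (casimir * hunit n)"
proof -
  define q where "q = (of_nat n * of_nat (n - 1) :: complex)"
  define T where "T X = symmetrize n (tcat 2 X (hunit (n - 2)))" for X
  have T_pr: "T (hunit 2) = hunit n"
    using tcat_pr[of 2 "n - 2"] le_add_diff_inverse[OF assms] by (simp only: T_def symmetrize_symm symm_pr)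
  have "4 *\<^sub>c to_ht (triHn n) = T (4 *\<^sub>c to_ht triH)"
    by (simp add: triHn_def to_ht_symz to_ht_tconc to_ht_tone T_def)
  also have "\<dots> = hunit n + T (tcat 1 (uletter 1) (uletter 1)) + T (tcat 1 (uletter 2) (uletter 2)) + T (tcat 1 (uletter 3) (uletter 3))"
    unfolding to_ht_triH T_pr[symmetric] by (simp add: T_def tcat_add symmetrize_add)
  finally have "q *\<^sub>c (4 *\<^sub>c to_ht (triHn n)) = q *\<^sub>c hunit n + q *\<^sub>c T (tcat 1 (uletter 1) (uletter 1)) +
      q *\<^sub>c T (tcat 1 (uletter 2) (uletter 2)) + q *\<^sub>c T (tcat 1 (uletter 3) (uletter 3))"
    by (simp add: scl_distribs)
  moreover have "q *\<^sub>c T (tcat 1 (uletter j) (uletter j)) = Esum j * (Esum j * hunit n) + of_nat n *\<^sub>c hunit n" if "j < 4" "j \<noteq> 0" for j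
    using Esum_D_pr[OF that assms] by (simp add: T_def q_def)
  ultimately have "q *\<^sub>c (4 *\<^sub>c to_ht (triHn n)) = q *\<^sub>c hunit n + (3 * of_nat n) *\<^sub>c hunit n
      + (Esum 1 * (Esum 1 * hunit n) + Esum 2 * (Esum 2 * hunit n) + Esum 3 * (Esum 3 * hunit n))"
    by (auto intro!: ht_eqI simp: algebra_simps)
  also have "Esum 1 * (Esum 1 * hunit n) + Esum 2 * (Esum 2 * hunit n) + Esum 3 * (Esum 3 * hunit n) = (- 4) *\<^sub>c (casimir * hunit n)"
    using arg_cong[OF casimir_D, of "\<lambda>x. x * hunit n"] by (simp add: distrib_right mult.assoc)
  also have "q *\<^sub>c hunit n + (3 * of_nat n) *\<^sub>c hunit n + (- 4) *\<^sub>c (casimir * hunit n) =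
     (of_nat n * (of_nat n + 2)) *\<^sub>c hunit n - 4 *\<^sub>c (casimir * hunit n)"
    using assms by (intro ht_eqI) (simp add: q_def of_nat_diff algebra_simps)
  finally show ?thesis by (simp add: q_def mult_ac)
qed

lemma to_ht_eH:
  assumes "n \<ge> 1" "(n + 1) div 2 \<le> l" "l \<le> n"
  shows "to_ht (eH n l) = isoproj n l"
proof (cases "n = 1")
  case True
  then have "idx n l = []" using assms by (auto simp: idx_def)
  then show ?thesis using True by (simp add: eH_def to_ht_tone isoproj_def)
next
  case False
  then have n2: "n \<ge> 2" using assms(1) by simp
  define q where "q = (of_nat n * of_nat (n - 1) :: complex)"
  have q0: "q \<noteq> 0" using n2 by (simp add: q_def)
  \<comment> \<open>The affine map carrying the Casimir element to \<open>triHn n\<close> carries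
    \<open>casval n m\<close> to \<open>betaH n m\<close>, so both interpolations have the same
    factors.\<close>
  have beta: "betaH n m = (of_nat n * (of_nat n + 2) / 4 - casval n m) / q" if "m \<le> n" for m
  proof -
    have "betaH n m = (of_nat (2 * (n - m) * (2 * m + 2)) / (4 * q) :: complex)"
      by (simp add: betaH_def q_def)
    also have "of_nat (2 * (n - m) * (2 * m + 2)) = (4 * (of_nat n * (of_nat n + 2) / 4 - casval n m) :: complex)"
      using that by (simp add: casval_def of_nat_diff field_simps)
    also have "4 * (of_nat n * (of_nat n + 2) / 4 - casval n m) / (4 * q) = (of_nat n * (of_nat n + 2) / 4 - casval n m) / q"
      by (rule mult_divide_mult_cancel_left) simp
    finally show ?thesis .
  qed
  have T: "to_ht (triHn n) = (1 / (4 * q)) *\<^sub>c ((of_nat n * (of_nat n + 2)) *\<^sub>c hunit n - 4 *\<^sub>c (casimir * hunit n))"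
    using to_ht_triHn[OF n2, symmetric] q0 by (simp add: q_def)
  define F where "F m = smul (1 / (betaH n l - betaH n m)) (tadd (triHn n) (smul (- betaH n m) (tone n :: complex tensor)))" for m
  have F: "to_ht (F m) = (1 / (casval n l - casval n m)) *\<^sub>c (casfac n m * hunit n)" if "m \<le> n" for m
  proof -
    have "to_ht (triHn n) - betaH n m *\<^sub>c hunit n = (- 1 / q) *\<^sub>c (casfac n m * hunit n)"
      unfolding T beta[OF that] casfac_def
      by (rule ht_eqI) (use q0 in \<open>simp add: left_diff_distrib field_simps\<close>)
    moreover have "betaH n l - betaH n m = - (casval n l - casval n m) / q"
      unfolding beta[OF that] beta[OF assms(3)] by (simp add: diff_divide_distrib)
    moreover have "to_ht (F m) = (1 / (betaH n l - betaH n m)) *\<^sub>c (to_ht (triHn n) - betaH n m *\<^sub>c hunit n)"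
      by (rule ht_eqI) (simp add: F_def to_ht_smul to_ht_tadd to_ht_tone)
    moreover have "- (1 / (casval n m - casval n l)) = 1 / (casval n l - casval n m)"
      by (metis minus_diff_eq minus_divide_right)
    ultimately show ?thesis using q0 by simp
  qed
  have "to_ht (foldr (\<lambda>m acc. tmul n (F m) acc) ms (tone n)) =
      prod_list (map (\<lambda>m. 1 / (casval n l - casval n m)) ms) *\<^sub>c (casprod n ms * hunit n)" if "set ms \<subseteq> {..n}" for ms
    using that
  proof (induction ms)
    case (Cons m ms)
    have "hunit n * (casfac n m * hunit n * (casprod n ms * hunit n)) = casfac n m * (casprod n ms * hunit n)"
      using hunit_commute[of "casprod n ms" n] hunit_commute[of "casfac n m" n] hunit_idem[of n] by (metis mult.assoc)
    then show ?case using Cons F[of m] by (simp add: to_ht_tmul mult.assoc)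
  qed (simp add: to_ht_tone)
  from this[of "idx n l"] show ?thesis
    unfolding isoproj_def using False by (simp add: eH_def idx_def F_def subset_iff del: upt_Suc)
qed

lemma eH_tens: "(eH n l :: 'a::field tensor) \<in> tens n"
proof (cases "n = 1")
  case False
  have "foldr (\<lambda>m. tmul n (F m)) ms (tone n) \<in> tens n"
    for F :: "nat \<Rightarrow> 'a::field tensor" and ms
    by (cases ms) simp_all
  then show ?thesis using False by (simp add: eH_def)
qed (simp add: eH_def)

section \<open>Primitivity\<close>

text \<open>Primitivity as a statement about the corner of g: an idempotent fixed by g on both sides
  is 0 or g. In the real case Q selects the real tensors.\<close>

definition primitive_in :: "nat \<Rightarrow> nat \<Rightarrow> (ht \<Rightarrow> bool) \<Rightarrow> ht \<Rightarrow> bool" where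
  "primitive_in n l Q g \<longleftrightarrow>
    (\<forall>y. symm n y \<longrightarrow> Q y \<longrightarrow> y * isoproj n l = y \<longrightarrow> y * y = y \<longrightarrow> g * y = y \<longrightarrow> y * g = y \<longrightarrow> y = 0 \<or> y = g)"

lemma idempotent_multiple:
  assumes "g * g = g" "y = c *\<^sub>c g" "y * y = y"
  shows "y = 0 \<or> y = (g::ht)"
proof -
  have "(c * c) *\<^sub>c g = c *\<^sub>c g" using assms(3) unfolding assms(2) by (simp add: assms(1))
  then have "c * c = c \<or> g = 0" by (simp only: scl_eq_scl_iff)
  then show ?thesis using assms(2) by auto
qed

context
  fixes n l k :: nat and p p' e J :: ht
  assumes l: "(n + 1) div 2 \<le> l" "l \<le> n" and k: "k \<le> n"
  defines "p \<equiv> wproj n k" and "p' \<equiv> wproj n (n - k)" and "e \<equiv> isoproj n l" and "J \<equiv> e2pow n"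
begin

lemma pe_simps: "p * p = p" "p' * p' = p'" "e * e = e" "e * p = p * e" "e * p' = p' * e" "e * J = J * e"
  "p * J = J * p'" "p' * J = J * p"
proof -
  show "p * p = p" "p' * p' = p'" by (simp_all add: p_def p'_def wproj_mult_P)
  show "e * e = e" unfolding e_def by (rule isoproj_idem[OF l])
  show "e * p = p * e" "e * p' = p' * e" unfolding e_def p_def p'_def by (rule isoproj_P)+
  show "e * J = J * e" unfolding e_def J_def by (rule isoproj_central) simp
  show "p * J = J * p'" unfolding p_def p'_def J_def by (rule wproj_jn[OF k])
  show "p' * J = J * p" unfolding p_def p'_def J_def using wproj_jn[of "n - k" n] k by simp
qed

lemma pe_orth: "2 * k \<noteq> n \<Longrightarrow> p * p' = 0" "2 * k \<noteq> n \<Longrightarrow> p' * p = 0"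
  using k by (auto simp: p_def p'_def wproj_mult_P)

text \<open>Rewriting to the normal form \<open>J\<close>, then \<open>p\<close> or
  \<open>p'\<close>, then \<open>e\<close>; the trailing x is what right-nested products
  require.\<close>

lemma pe_nf:
  "e * (e * x) = e * x" "p * (p * x) = p * x" "p' * (p' * x) = p' * x"
  "e * (p * x) = p * (e * x)" "e * (p' * x) = p' * (e * x)" "e * (J * x) = J * (e * x)"
  "p * (J * x) = J * (p' * x)" "p' * (J * x) = J * (p * x)"
  "2 * k \<noteq> n \<Longrightarrow> p * (p' * x) = 0" "2 * k \<noteq> n \<Longrightarrow> p' * (p * x) = 0"
  by (simp_all add: pe_simps pe_orth flip: mult.assoc)

lemmas pe_normal = mult.assoc pe_simps pe_nf pe_orth

lemma pe_corner: "symm n s \<Longrightarrow> \<exists>c. p * (s * (p * e)) = c *\<^sub>c (p * e)"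
  using corner_scalar[OF l, of s k] by (simp add: p_def e_def mult.assoc)

lemma pe_symm: "symm n p" "symm n p'" "symm n e" "symm n J"
  by (simp_all add: p_def p'_def e_def J_def)

lemma primitive_weight: "primitive_in n l Q (p * e)"
  unfolding primitive_in_def
proof (intro allI impI)
  fix y assume y: "symm n y" "y * y = y" "p * e * y = y" "y * (p * e) = y"
  obtain c where c: "p * ((e * y) * (p * e)) = c *\<^sub>c (p * e)"
    using pe_corner[of "e * y"] y(1) by (auto simp: symm_mult pe_symm)
  have "y = p * e * (y * (p * e))" using y by simp
  also have "\<dots> = c *\<^sub>c (p * e)" using c by (simp add: mult.assoc)
  finally have "y = c *\<^sub>c (p * e)" .
  moreover have "p * e * (p * e) = p * e"
    by (simp add: pe_normal)
  ultimately show "y = 0 \<or> y = p * e" using y(2) by (intro idempotent_multiple)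
qed

text \<open>Writing g as half of \<open>u * p * u * e\<close> with
  \<open>u = hunit n + d *\<^sub>c J\<close> puts p in the middle, so that the corner of g is
  reduced to the one-dimensional corner of p.\<close>

lemma primitive_half:
  assumes "even n" "2 * k \<noteq> n" "d * d = 1"
  defines "g \<equiv> (p + p') * ((1/2) *\<^sub>c (hunit n + d *\<^sub>c J)) * e"
  assumes idem: "g * g = g"
  shows "primitive_in n l Q g"
  unfolding primitive_in_def
proof (intro allI impI)
  define u where "u = hunit n + d *\<^sub>c J"
  have su: "symm n u" by (simp add: u_def pe_symm)
  have JJ: "J * J = hunit n" using e2pow_sq[of n] assms(1) by (simp add: J_def)
  have prs: "hunit n * x = x" "x * hunit n = x" if "symm n x" for x
    using symm_deg[OF that] deg_times_pr by (auto simp: deg_def)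
  have "u * J = J + d *\<^sub>c (J * J)" by (simp add: u_def distrib_right prs pe_symm)
  then have uJ: "u * J = d *\<^sub>c u" using assms(3) by (simp add: JJ u_def scl_distribs)
  have pu: "p * u = p + d *\<^sub>c (J * p')" "p' * u = p' + d *\<^sub>c (J * p)"
    by (simp_all add: u_def distrib_left prs pe_symm pe_simps)
  have up: "u * p = p + d *\<^sub>c (J * p)" "u * p' = p' + d *\<^sub>c (J * p')"
    by (simp_all add: u_def distrib_right prs pe_symm)
  \<comment> \<open>The off-diagonal part \<open>d *\<^sub>c (J * p')\<close> of
    \<open>p * u\<close> is absorbed by u, because \<open>u * J = d *\<^sub>c u\<close> and
    \<open>d * d = 1\<close>.\<close>
  have upu: "u * (p * u) = (p + p') * u"
  proof -
    have "u * (p * u) = u * p + d *\<^sub>c (u * J * p')" by (simp add: pu distrib_left mult.assoc)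
    also have "\<dots> = u * p + u * p'" using assms(3) by (simp add: uJ)
    also have "\<dots> = (p + p') * u" by (simp add: distrib_right pu up add_ac)
    finally show ?thesis .
  qed
  have eu: "e * u = u * e" by (simp add: e_def isoproj_central su)
  have g: "g = (1/2) *\<^sub>c (u * (p * (u * e)))"
    unfolding g_def u_def[symmetric] by (simp add: mult.assoc flip: upu)
  fix y assume y: "symm n y" "y * y = y" "g * y = y" "y * g = y"
  obtain c where c: "p * ((u * (e * (y * u))) * (p * e)) = c *\<^sub>c (p * e)"
    using pe_corner[of "u * (e * (y * u))"] y(1) su by (auto simp: symm_mult pe_symm)
  have "y = g * (y * g)" using y by simp
  also have "\<dots> = (1/4) *\<^sub>c (u * (p * (u * (e * (y * (u * (p * (u * e))))))))"
    by (simp add: g mult.assoc)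
  also have "\<dots> = (1/4) *\<^sub>c (u * (p * ((u * (e * (y * u))) * (p * e))) * u)"
    by (simp add: mult.assoc eu)
  also have "\<dots> = (c / 2) *\<^sub>c g"
    unfolding c by (simp add: g mult.assoc eu)
  finally show "y = 0 \<or> y = g" using y(2) idem by (intro idempotent_multiple)
qed

text \<open>Compression by p on both sides removes p' and both terms with J, leaving half of
  \<open>p * e\<close>.\<close>

lemma half_neq_0:
  assumes "2 * k \<noteq> n" "p * e \<noteq> 0"
  shows "(p + p') * ((1/2) *\<^sub>c (hunit n + d *\<^sub>c J)) * e \<noteq> 0"
proof
  assume 0: "(p + p') * ((1/2) *\<^sub>c (hunit n + d *\<^sub>c J)) * e = 0"
  have prs: "p * hunit n = p" "p' * hunit n = p'" by (simp_all add: p_def p'_def deg_times_pr)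
  have "(p + p') * ((1/2) *\<^sub>c (hunit n + d *\<^sub>c J)) * e =
     (1/2) *\<^sub>c ((p + p' + d *\<^sub>c (J * p' + J * p)) * e)"
    by (simp add: distrib_left distrib_right prs pe_simps scl_distribs add_ac)
  then have "p * ((p + p' + d *\<^sub>c (J * p' + J * p)) * e) * p = 0" using 0 by simp
  moreover have "p * ((p + p' + d *\<^sub>c (J * p' + J * p)) * e) * p = p * e"
    using assms(1) by (simp add: distrib_left distrib_right pe_normal)
  ultimately show False using assms(2) by simp
qed

lemma hconj_pe: assumes "hconj e = e" shows "hconj p = p'" "hconj J = J"
  using k by (simp_all add: p_def p'_def J_def hconj_P)

text \<open>Relative to p and p', an element fixed by conjugation is a 2 by 2 matrix whose first row
  a, c determines the second by conjugation: a quaternion. If c were nonzero,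
  \<open>y * y = y\<close> would make \<open>|a|^2 + |c|^2\<close> vanish; for c = 0 the scalar a is
  0 or 1.\<close>

lemma primitive_pair:
  assumes "odd n" "p * e \<noteq> 0" "hconj e = e" and Q: "\<And>y. Q y \<Longrightarrow> hconj y = y"
  shows "primitive_in n l Q ((p + p') * e)"
  unfolding primitive_in_def
proof (intro allI impI)
  have k2: "2 * k \<noteq> n" using assms(1) by auto
  have JJ: "J * J = (- 1) *\<^sub>c hunit n" using e2pow_sq[of n] assms(1) by (simp add: J_def)
  have prp: "hunit n * p = p" "hunit n * p' = p'" "p * hunit n = p" "p' * hunit n = p'"
    using deg_P deg_times_pr by (auto simp: p_def p'_def deg_def)
  have JpJ: "J * (p * J) = (- 1) *\<^sub>c p'"
    by (simp add: pe_simps) (simp add: JJ prp flip: mult.assoc)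
  have Jp'J: "J * (p' * J) = (- 1) *\<^sub>c p"
    by (simp add: pe_simps) (simp add: JJ prp flip: mult.assoc)
  fix y assume y: "symm n y" "Q y" "y * isoproj n l = y" "y * y = y" "(p + p') * e * y = y" "y * ((p + p') * e) = y"
  have ye: "y * e = y" using y(3) by (simp add: e_def)
  have cjp': "hconj p' = p" using k by (simp add: p_def p'_def hconj_P)
  have cjs: "hconj p = p'" "hconj J = J" "hconj p' = p" "hconj y = y" using hconj_pe assms(3) cjp' Q y(2) by auto
  have ey: "e * y = y" using ye isoproj_central[OF y(1), of l] by (simp add: e_def)
  obtain a where a: "p * (y * (p * e)) = a *\<^sub>c (p * e)" using pe_corner[OF y(1)] by auto
  obtain b where b: "p * ((y * J) * (p * e)) = b *\<^sub>c (p * e)"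
    using pe_corner[of "y * J"] y(1) by (auto simp: symm_mult pe_symm)
  \<comment> \<open>The sign comes from \<open>J * (p * J) = (- 1) *\<^sub>c p'\<close>, by which p'
    is replaced with p.\<close>
  define c where "c = - b"
  have A: "p * y * p = a *\<^sub>c (p * e)"
  proof -
    have "p * y * p = p * (y * e) * p" by (simp add: ye)
    also have "\<dots> = p * (y * (p * e))" by (simp add: pe_normal)
    finally show ?thesis using a by simp
  qed
  have B: "p * y * p' = c *\<^sub>c (p * J * e)"
  proof -
    have "p * y * p' = (- 1) *\<^sub>c (p * (y * e) * (J * (p * J)))" by (simp add: ye JpJ)
    also have "\<dots> = (- 1) *\<^sub>c (p * ((y * J) * (p * e)) * J)"
      by (simp only: mult.assoc pe_simps(4,6) pe_nf(4,6))
    also have "\<dots> = c *\<^sub>c (p * J * e)" unfolding b by (simp add: c_def pe_normal)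
    finally show ?thesis .
  qed
  \<comment> \<open>Conjugation fixes y and J and exchanges p with p', so it turns the first row
    into the second.\<close>
  have A': "p' * y * p' = cnj a *\<^sub>c (p' * e)"
    using arg_cong[OF A, of hconj] by (simp add: cjs assms(3))
  have B': "p' * y * p = cnj c *\<^sub>c (p' * J * e)"
    using arg_cong[OF B, of hconj] by (simp add: cjs assms(3))
  have yq: "y = (p + p') * y * (p + p')"
  proof -
    have "y = (p + p') * (e * y)" using y(5) by (simp add: mult.assoc)
    moreover have "y = (y * e) * (p + p')" using y(6) by (simp add: mult.assoc distrib_left distrib_right pe_simps)
    ultimately show ?thesis unfolding ey ye by simp
  qed
  have py: "p * y = a *\<^sub>c (p * e) + c *\<^sub>c (p * J * e)"
  proof -
    have "p * y = p * (p + p') * y * (p + p')" by (subst yq) (simp only: mult.assoc)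
    also have "p * (p + p') = p" by (simp add: distrib_left pe_simps pe_orth k2)
    finally show ?thesis by (simp add: distrib_left A B)
  qed
  have p'y: "p' * y = cnj a *\<^sub>c (p' * e) + cnj c *\<^sub>c (p' * J * e)"
  proof -
    have "p' * y = p' * (p + p') * y * (p + p')" by (subst yq) (simp only: mult.assoc)
    also have "p' * (p + p') = p'" by (simp add: distrib_left pe_simps pe_orth k2)
    finally show ?thesis by (simp add: distrib_left A' B' add.commute)
  qed
  \<comment> \<open>The first row of \<open>y * y = y\<close>, in which the coefficients of
    \<open>p * e\<close> and of \<open>p * J * e\<close> are compared.\<close>
  have "p * y = p * y * y" using y(4) by (simp add: mult.assoc)
  also have "\<dots> = a *\<^sub>c (p * (e * y)) + c *\<^sub>c (J * (p' * (e * y)))"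
    unfolding py by (simp add: distrib_right pe_normal)
  also have "\<dots> = a *\<^sub>c (a *\<^sub>c (p * e) + c *\<^sub>c (p * J * e)) + c *\<^sub>c (J * (cnj a *\<^sub>c (p' * e) + cnj c *\<^sub>c (p' * J * e)))"
    by (simp only: ey py p'y)
  also have "\<dots> = (a * a - c * cnj c) *\<^sub>c (p * e) + (a * c + c * cnj a) *\<^sub>c (p * J * e)"
  proof -
    have "J * (p' * e) = p * J * e" by (simp add: pe_normal)
    moreover have "J * (p' * J * e) = (J * (p' * J)) * e" by (simp only: mult.assoc)
    then have "J * (p' * J * e) = (- 1) *\<^sub>c (p * e)" by (simp only: Jp'J scl_mult_left)
    ultimately show ?thesis
      by (intro ht_eqI) (simp add: distrib_left, simp add: algebra_simps)
  qed
  finally have eq: "a *\<^sub>c (p * e) + c *\<^sub>c (p * J * e) = (a * a - c * cnj c) *\<^sub>c (p * e) + (a * c + c * cnj a) *\<^sub>c (p * J * e)"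
    unfolding py .
  have pJep: "p * J * e * p = 0"
    using k2 by (simp add: pe_normal)
  have pep: "p * e * p = p * e" by (simp add: pe_normal)
  have "(a * a - c * cnj c) *\<^sub>c (p * e) = a *\<^sub>c (p * e)"
    using arg_cong[OF eq, of "\<lambda>x. x * p"] by (simp add: distrib_right pJep pep)
  then have e1: "a * a - c * cnj c = a" using assms(2) by (simp only: scl_eq_scl_iff simp_thms)
  from eq have e2': "(a * c + c * cnj a) *\<^sub>c (p * J * e) = c *\<^sub>c (p * J * e)"
    unfolding e1 add_left_cancel by (rule sym)
  have "p * J * e \<noteq> 0"
  proof
    assume "p * J * e = 0"
    then have "(p * J * e) * J = 0" by simp
    moreover have "(p * J * e) * J = (- 1) *\<^sub>c (p * e)"
    proof -
      have "(p * J * e) * J = p * (J * J) * e" by (simp only: mult.assoc pe_simps(6) pe_nf(6))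
      then show ?thesis by (simp add: JJ prp)
    qed
    ultimately show False using assms(2) by simp
  qed
  with e2' have e2: "a * c + c * cnj a = c" by (simp only: scl_eq_scl_iff simp_thms)
  \<comment> \<open>A nonzero c cancels in \<open>a * c + c * cnj a = c\<close>, so a has real part
    1/2, and then the other equation says \<open>|a|^2 + |c|^2 = 0\<close>.\<close>
  have c0: "c = 0"
  proof (rule ccontr)
    assume "c \<noteq> 0"
    then have s: "a + cnj a = 1" using e2 mult_cancel_left[of c "a + cnj a" 1] by (simp add: algebra_simps)
    then have cnj_a: "cnj a = 1 - a" by (simp add: algebra_simps)
    have "a * cnj a = a - a * a" unfolding cnj_a by (simp add: right_diff_distrib)
    then have "a * cnj a + c * cnj c = 0" using e1 by (simp add: algebra_simps)
    then have "complex_of_real ((cmod a)\<^sup>2 + (cmod c)\<^sup>2) = 0"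
      by (simp only: complex_norm_square of_real_add) 
    then have "(cmod a)\<^sup>2 + (cmod c)\<^sup>2 = 0" by (simp only: of_real_eq_0_iff)
    with \<open>c \<noteq> 0\<close> show False by (simp add: sum_power2_eq_zero_iff)
  qed
  have "y = p * y + p' * y"
  proof -
    have "y = (p + p') * (e * y)" using y(5) by (simp add: mult.assoc)
    then show ?thesis by (simp add: ey distrib_right)
  qed
  then have yy: "y = a *\<^sub>c (p * e) + cnj a *\<^sub>c (p' * e)" by (simp add: py p'y c0)
  have "a * a = a" using e1 c0 by simp
  then have "a = 0 \<or> a = 1" by auto
  then show "y = 0 \<or> y = (p + p') * e" using yy by (auto simp: distrib_right)
qed

end

text \<open>Serves both fields: \<open>emb\<close> is \<open>to_ht\<close> for complex tensors and
  its composition with the inclusion of real coefficients for real ones. Everything left to check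
  takes place in the ring \<open>ht\<close>.\<close>

lemma complete_POI_embedding:
  fixes emb :: "'a::field tensor \<Rightarrow> ht" and f :: "'i \<Rightarrow> 'a tensor"
  assumes emb_inj: "\<And>x y. x \<in> tens n \<Longrightarrow> y \<in> tens n \<Longrightarrow> emb x = emb y \<Longrightarrow> x = y"
    and emb_tmul: "\<And>x y. x \<in> tens n \<Longrightarrow> emb (tmul n x y) = emb x * emb y"
    and emb_tadd: "\<And>x y. emb (tadd x y) = emb x + emb y"
    and emb_tzero: "emb tzero = 0"
    and emb_sum: "emb (\<lambda>w. \<Sum>i\<in>I. f i w) = (\<Sum>i\<in>I. emb (f i))"
    and emb_SymT: "\<And>x. x \<in> SymT n \<Longrightarrow> symm n (emb x)"
    and emb_eH: "emb (eH n l) = isoproj n l"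
    and Q: "\<And>x. Q (emb x)"
    and l: "(n + 1) div 2 \<le> l" "l \<le> n"
    and I: "finite I" "card I = N"
    and s: "\<And>i. i \<in> I \<Longrightarrow> s i \<in> SymT n" and f: "\<And>i. i \<in> I \<Longrightarrow> f i = tmul n (s i) (eH n l)"
    and orth: "\<And>i j. i \<in> I \<Longrightarrow> j \<in> I \<Longrightarrow> i \<noteq> j \<Longrightarrow> emb (f i) * emb (f j) = 0"
    and ne: "\<And>i. i \<in> I \<Longrightarrow> emb (f i) \<noteq> 0"
    and sum: "(\<Sum>i\<in>I. emb (f i)) = isoproj n l"
    and prim: "\<And>i. i \<in> I \<Longrightarrow> primitive_in n l Q (emb (f i))"
  shows "complete_POI n (SlH n l) (eH n l) f I N"
proof -
  have SymT_tens: "x \<in> tens n" if "x \<in> SymT n" for x :: "'a tensor" using that by (simp add: SymT_def)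
  have SlH_tens: "x \<in> tens n" if "x \<in> SlH n l" for x :: "'a tensor" using that by (auto simp: SlH_def)
  have SlH_emb: "symm n (emb x) \<and> emb x * isoproj n l = emb x" if x: "x \<in> SlH n l" for x
  proof -
    from x obtain t where t: "t \<in> SymT n" "x = tmul n t (eH n l)" by (auto simp: SlH_def)
    then have "emb x = emb t * isoproj n l" by (simp add: emb_tmul SymT_tens emb_eH)
    then show ?thesis using emb_SymT[OF t(1)] l by (simp add: symm_mult mult.assoc isoproj_idem)
  qed
  have fS: "f i \<in> SlH n l" if "i \<in> I" for i using s[OF that] f[OF that] by (auto simp: SlH_def)
  note ft = SlH_tens[OF fS]
  have sq: "emb (f i) * emb (f i) = emb (f i)" if i: "i \<in> I" for i
  proof -
    \<comment> \<open>Multiplying by the unit, written as the sum of all members, leaves only the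
      square; thus idempotency follows from orthogonality.\<close>
    have "emb (f i) = (\<Sum>j\<in>I. emb (f i) * emb (f j))"
      using SlH_emb[OF fS[OF i]] by (simp add: sum flip: sum_distrib_left)
    also have "\<dots> = (\<Sum>j\<in>I. if j = i then emb (f i) * emb (f j) else 0)"
      using orth i by (intro sum.cong) auto
    also have "\<dots> = emb (f i) * emb (f i)" using i I by simp
    finally show ?thesis ..
  qed
  have idem: "idem n x \<longleftrightarrow> emb x * emb x = emb x" if "x \<in> tens n" for x
    using that emb_inj[of "tmul n x x" x] emb_tmul[of x x] by (auto simp: idem_def)
  have zero: "x = tzero \<longleftrightarrow> emb x = 0" if "x \<in> tens n" for x
    using that emb_inj[of x tzero] emb_tzero by auto
  have orth': "tmul n (f i) (f j) = tzero" if "i \<in> I" "j \<in> I" "i \<noteq> j" for i j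
    using orth[OF that] ft that by (simp add: zero emb_tmul)
  have prim': "prim_idem n (SlH n l) (f i)" if i: "i \<in> I" for i
    unfolding prim_idem_def
  proof (intro conjI notI)
    show "f i \<in> SlH n l" by (rule fS[OF i])
    show "idem n (f i)" using idem[OF ft[OF i]] sq[OF i] by simp
    show "f i = tzero \<Longrightarrow> False" using zero[OF ft[OF i]] ne[OF i] by simp
    assume "\<exists>y z. y \<in> SlH n l \<and> z \<in> SlH n l \<and> idem n y \<and> idem n z \<and> y \<noteq> tzero \<and> z \<noteq> tzero \<and>
            tmul n y z = tzero \<and> tmul n z y = tzero \<and> f i = tadd y z"
    then obtain y z where yz: "y \<in> SlH n l" "z \<in> SlH n l" "idem n y" "idem n z" "y \<noteq> tzero" "z \<noteq> tzero"
      "tmul n y z = tzero" "tmul n z y = tzero" "f i = tadd y z" by blast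
    note yt = SlH_tens[OF yz(1)] and zt = SlH_tens[OF yz(2)]
    have o: "emb y * emb z = 0" "emb z * emb y = 0"
      using yz(7,8) emb_tmul[OF yt, of z] emb_tmul[OF zt, of y] emb_tzero by simp_all
    have yy: "emb y * emb y = emb y" using idem[OF yt] yz(3) by simp
    have g: "emb (f i) = emb y + emb z" using yz(9) by (simp add: emb_tadd)
    \<comment> \<open>A summand of an orthogonal decomposition lies in the corner, so
      \<open>primitive_in\<close> applies to it.\<close>
    have "emb (f i) * emb y = emb y" "emb y * emb (f i) = emb y"
      by (simp_all add: g distrib_left distrib_right o yy)
    then have "emb y = 0 \<or> emb y = emb (f i)"
      using prim[OF i] SlH_emb[OF yz(1)] yy Q[of y] unfolding primitive_in_def by blast
    then show False using zero[OF yt] zero[OF zt] yz(5,6) g by auto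
  qed
  have "inj_on f I"
  proof (rule inj_onI, rule ccontr)
    fix i j assume "i \<in> I" "j \<in> I" "f i = f j" "i \<noteq> j"
    then show False using orth[of i j] sq[of i] ne[of i] by simp
  qed
  moreover have "(\<lambda>w. \<Sum>i\<in>I. f i w) = eH n l"
  proof (rule emb_inj)
    show "(\<lambda>w. \<Sum>i\<in>I. f i w) \<in> tens n"
      using ft by (auto simp: tens_iff intro!: sum.neutral)
    show "emb (\<lambda>w. \<Sum>i\<in>I. f i w) = emb (eH n l)" by (simp add: emb_sum sum emb_eH)
  qed (rule eH_tens)
  ultimately show ?thesis
    unfolding complete_POI_def using I prim' orth' by blast
qed

lemma sum_P_el:
  assumes "(n + 1) div 2 \<le> l" "l \<le> n"
  shows "(\<Sum>k\<in>{n - l..l}. wproj n k * isoproj n l) = isoproj n l"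
proof -
  have "isoproj n l = (\<Sum>k\<le>n. wproj n k * isoproj n l)" by (rule deg_eq_sum_P) simp
  also have "\<dots> = (\<Sum>k\<in>{n - l..l}. wproj n k * isoproj n l)"
    using assms by (intro sum.mono_neutral_right) (auto intro!: wproj_el_eq_0)
  finally show ?thesis ..
qed

text \<open>Pairs k with n - k; for even n the middle index n/2 is its own partner and stays
  alone.\<close>

lemma sum_reflect:
  fixes a :: "nat \<Rightarrow> 'b::comm_monoid_add"
  assumes "(n + 1) div 2 \<le> l" "l \<le> n"
  shows "(\<Sum>k\<in>{n - l..l}. a k) =
    (\<Sum>k\<in>{n - l..<(n + 1) div 2}. a k + a (n - k)) + (if even n then a (n div 2) else 0)"
proof -
  let ?B = "{n - l..<(n + 1) div 2}" and ?B' = "{n div 2 + 1..l}"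
  have "(\<Sum>k\<in>?B. a (n - k)) = (\<Sum>k\<in>?B'. a k)"
    by (rule sum.reindex_bij_witness[of _ "\<lambda>k. n - k" "\<lambda>k. n - k"]) (use assms in auto)
  then have *: "(\<Sum>k\<in>?B. a k + a (n - k)) = (\<Sum>k\<in>?B. a k) + (\<Sum>k\<in>?B'. a k)"
    by (simp add: sum.distrib)
  have d: "(\<Sum>k\<in>?B \<union> ?B'. a k) = (\<Sum>k\<in>?B. a k) + (\<Sum>k\<in>?B'. a k)"
    by (rule sum.union_disjoint) auto
  show ?thesis
  proof (cases "even n")
    case True
    then have eq: "{n - l..l} = insert (n div 2) (?B \<union> ?B')" using assms by auto
    have "n div 2 \<notin> ?B \<union> ?B'" using True by auto
    then have "sum a (insert (n div 2) (?B \<union> ?B')) = a (n div 2) + sum a (?B \<union> ?B')"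
      by (intro sum.insert) simp_all
    then show ?thesis unfolding eq * d using True by (simp add: add.commute)
  next
    case False
    then have eq: "{n - l..l} = ?B \<union> ?B'" using assms by (auto elim!: oddE)
    show ?thesis unfolding eq * d using False by simp
  qed
qed


lemma sum_pairs_el:
  assumes "(n + 1) div 2 \<le> l" "l \<le> n"
  shows "(\<Sum>k\<in>{n - l..<(n + 1) div 2}. (wproj n k + wproj n (n - k)) * isoproj n l)
    + (if even n then wproj n (n div 2) * isoproj n l else 0) = isoproj n l"
  using sum_reflect[OF assms, of "\<lambda>k. wproj n k * isoproj n l"] sum_P_el[OF assms]
  by (simp add: distrib_right)

section \<open>The three families of idempotents\<close>

lemma theoremA_complex:
  fixes n l :: nat
  assumes "n \<ge> 1" and l: "(n + 1) div 2 \<le> l" "l \<le> n"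
  shows "complete_POI n (SlH n l :: complex tensor set) (eH n l)
      (\<lambda>k. tmul n (smul (of_nat (n choose k))
              (symz n (ptens (replicate k qa @ replicate (n - k) qac)))) (eH n l))
      {n - l..l} (2 * l - n + 1)"
proof -
  let ?s = "\<lambda>k. smul (of_nat (n choose k)) (symz n (ptens (replicate k qa @ replicate (n - k) qac)))"
  have s: "?s k \<in> tens n" "to_ht (?s k) = wproj n k" if "k \<le> n" for k
  proof -
    show "?s k \<in> tens n" using that by (intro smul_tens symz_tens ptens_tens) simp
    show "to_ht (?s k) = wproj n k"
      by (simp add: to_ht_smul to_ht_symz ptens_append to_ht_tconc to_ht_ptens_replicate wproj_def wmono_def la_def lc_def)
  qed
  have f: "to_ht (tmul n (?s k) (eH n l)) = wproj n k * isoproj n l" if "k \<in> {n - l..l}" for k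
    using s[of k] that l assms by (simp add: to_ht_tmul_tens to_ht_eH)
  show ?thesis
  proof (rule complete_POI_embedding[where emb = to_ht and Q = "\<lambda>_. True" and s = ?s])
    show "to_ht (\<lambda>w. \<Sum>i\<in>{n - l..l}. tmul n (?s i) (eH n l) w) = (\<Sum>i\<in>{n - l..l}. to_ht (tmul n (?s i) (eH n l)))"
      using to_ht_lincomb[of "\<lambda>_. 1"] by simp
    show "?s i \<in> SymT n" if "i \<in> {n - l..l}" for i
      using s[of i] that l by (simp add: SymT_iff)
    show "to_ht (tmul n (?s i) (eH n l)) * to_ht (tmul n (?s j) (eH n l)) = 0"
      if "i \<in> {n - l..l}" "j \<in> {n - l..l}" "i \<noteq> j" for i j
    proof -
      have "wproj n i * isoproj n l * (wproj n j * isoproj n l) = wproj n i * wproj n j * (isoproj n l * isoproj n l)"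
        using isoproj_P[of n l j] by (metis mult.assoc)
      then show ?thesis using that by (simp only: f wproj_mult_P) simp
    qed
    show "to_ht (tmul n (?s i) (eH n l)) \<noteq> 0" if "i \<in> {n - l..l}" for i
      using that l unfolding f[OF that] by (intro wproj_el_neq_0) auto
    show "(\<Sum>i\<in>{n - l..l}. to_ht (tmul n (?s i) (eH n l))) = isoproj n l"
      using sum_P_el[OF l] by (simp add: f)
    show "primitive_in n l (\<lambda>_. True) (to_ht (tmul n (?s i) (eH n l)))" if "i \<in> {n - l..l}" for i
      using that l unfolding f[OF that] by (intro primitive_weight) auto
  qed (use assms l in \<open>auto simp: to_ht_inj to_ht_tmul_tens to_ht_tadd to_ht_tzero SymT_iff to_ht_eH\<close>)
qed


lemma wmono_pair: "k \<le> n \<Longrightarrow> of_nat (n choose k) *\<^sub>c (wmono n k + wmono n (n - k)) = wproj n k + wproj n (n - k)"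
  by (simp add: wproj_def scl_distribs binomial_symmetric[of k n])

lemma pair_mult_pair:
  assumes "2 * j < n" "2 * k < n"
  shows "(wproj n j + wproj n (n - j)) * (wproj n k + wproj n (n - k)) = (if j = k then wproj n k + wproj n (n - k) else 0)"
  using assms by (auto simp: distrib_left distrib_right wproj_mult_P)

lemma pair_el_commute: "isoproj n l * (wproj n k + wproj n (n - k)) = (wproj n k + wproj n (n - k)) * isoproj n l"
  by (simp add: distrib_left distrib_right isoproj_P)

abbreviation cR :: "real tensor \<Rightarrow> ht" where "cR x \<equiv> to_ht (ofr x)"

lemma hconj_cR: "hconj (cR x) = cR x"
  by (rule ht_eqI) (simp add: ofr_def)

lemma cR_inj: "x \<in> tens n \<Longrightarrow> y \<in> tens n \<Longrightarrow> cR x = cR y \<Longrightarrow> x = y"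
  using to_ht_inj[of "ofr x" n "ofr y"] by (auto simp: ofr_tens_iff dest: ofr_inj)

lemma cR_tmul: "x \<in> tens n \<Longrightarrow> cR (tmul n x y) = cR x * cR y"
  by (simp add: ofr_tmul to_ht_tmul_tens ofr_tens_iff)

lemma cR_SymT: "x \<in> SymT n \<longleftrightarrow> x \<in> tens n \<and> symm n (cR x)"
  using ofr_SymT_iff[of x n] by (simp add: SymT_iff ofr_tens_iff)

lemma cR_sum: "cR (\<lambda>w. \<Sum>i\<in>A. f i w) = (\<Sum>i\<in>A. cR (f i))"
  using to_ht_lincomb[of "\<lambda>_. 1" "\<lambda>i. ofr (f i)" A] by (simp add: ofr_def)

lemma cR_lincomb:
  "cR (smul b (\<lambda>w. \<Sum>i\<in>A. c i * x i w)) = (\<Sum>i\<in>A. of_real (b * c i) *\<^sub>c cR (x i))"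
  by (simp add: ofr_simps ofr_lincomb to_ht_smul to_ht_lincomb scl_sum)

lemmas complete_POI_real = complete_POI_embedding[where emb = cR and Q = "\<lambda>y. hconj y = y",
  OF cR_inj cR_tmul _ _ cR_sum _ _ hconj_cR]

lemma theoremA_odd:
  fixes n l :: nat
  assumes "n \<ge> 1" and l: "(n + 1) div 2 \<le> l" "l \<le> n" and n: "odd n"
  shows "complete_POI n (SlH n l :: real tensor set) (eH n l)
      (\<lambda>k. tmul n
         (smul (of_nat (n choose k) * (real (n - 2 * k) / 2 ^ k))
           (\<lambda>w. \<Sum>i = 0..(n - 1) div 2 - k.
              (- 1 / 2) ^ i * (real ((n - 2 * k - i) choose i) / real (n - 2 * k - i)) *
              symz n (tconc (n - 2 * k - 2 * i) (tone (n - 2 * k - 2 * i)) (tpow 2 sqH (k + i))) w))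
         (eH n l))
      {n - l..(n - 1) div 2} ((2 * l - n + 1) div 2)"
proof -
  define I where "I = {n - l..(n - 1) div 2}"
  define s :: "nat \<Rightarrow> real tensor" where "s k = smul (of_nat (n choose k) * (real (n - 2 * k) / 2 ^ k))
           (\<lambda>w. \<Sum>i = 0..(n - 1) div 2 - k.
              (- 1 / 2) ^ i * (real ((n - 2 * k - i) choose i) / real (n - 2 * k - i)) *
              symz n (tconc (n - 2 * k - 2 * i) (tone (n - 2 * k - 2 * i)) (tpow 2 sqH (k + i))) w)" for k
  have eH: "cR (eH n l) = isoproj n l" using assms by (simp add: ofr_eH to_ht_eH)
  have Ik: "2 * k < n" "k \<le> n" "n - l \<le> k" "k \<le> l" if "k \<in> I" for k
    using that n l by (auto simp: I_def elim!: oddE)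
  have I_eq: "I = {n - l..<(n + 1) div 2}" using n by (auto simp: I_def elim!: oddE)
  have s_tens: "s k \<in> tens n" if "k \<in> I" for k
    unfolding s_def
  proof (intro smul_tens lincomb_tens symz_tens)
    fix i assume i: "i \<in> {0..(n - 1) div 2 - k}"
    have "n - 2 * k - 2 * i + 2 * (k + i) = n" using i Ik[OF that] n by (auto elim!: oddE)
    then show "tconc (n - 2 * k - 2 * i) (tone (n - 2 * k - 2 * i)) (tpow 2 sqH (k + i)) \<in> tens n"
      using tconc_tens[OF tone_tens tpow_tens[OF sqH_tens], of "n - 2 * k - 2 * i" "k + i"] by simp
  qed
  have s: "cR (s k) = wproj n k + wproj n (n - k)" if "k \<in> I" for k
  proof -
    \<comment> \<open>For odd n the given bound is the range \<open>N div 2\<close> of Waring's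
      formula with \<open>N = n - 2 * k\<close>.\<close>
    have r: "{0..(n - 1) div 2 - k} = {..(n - 2 * k) div 2}"
      using n by (auto elim!: oddE)
    have "cR (s k) = (\<Sum>i\<le>(n - 2 * k) div 2. of_nat (n choose k) *\<^sub>c (waring (n - 2 * k) i * (1 / 2 ^ k) * (- 1 / 2) ^ i) *\<^sub>c
      symmetrize n (tcat (n - 2 * k - 2 * i) (hunit (n - 2 * k - 2 * i)) (tcatpow 2 (to_ht sqH) (k + i))))"
      unfolding s_def cR_lincomb r
      by (intro sum.cong refl)
         (simp add: ofr_simps ofr_tpow to_ht_symz to_ht_tconc to_ht_tone to_ht_tpow waring_def mult_ac)
    also have "\<dots> = of_nat (n choose k) *\<^sub>c (wmono n k + wmono n (n - k))"
      by (simp only: odd_formula[OF Ik(1)[OF that], symmetric] scl_sum)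
    finally show ?thesis by (simp add: wmono_pair Ik(2)[OF that])
  qed
  have f: "cR (tmul n (s k) (eH n l)) = (wproj n k + wproj n (n - k)) * isoproj n l" if "k \<in> I" for k
    using s[OF that] s_tens[OF that] by (simp add: cR_tmul eH)
  have "complete_POI n (SlH n l :: real tensor set) (eH n l) (\<lambda>k. tmul n (s k) (eH n l)) I ((2 * l - n + 1) div 2)"
  proof (rule complete_POI_real[where s = s])
    show "s i \<in> SymT n" if "i \<in> I" for i
      using s[OF that] s_tens[OF that] by (simp add: cR_SymT)
    show "card I = (2 * l - n + 1) div 2" using n l by (auto simp: I_def elim!: oddE)
    show "cR (tmul n (s i) (eH n l)) * cR (tmul n (s j) (eH n l)) = 0"
      if "i \<in> I" "j \<in> I" "i \<noteq> j" for i j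
    proof -
      have "(wproj n i + wproj n (n - i)) * isoproj n l * ((wproj n j + wproj n (n - j)) * isoproj n l) =
          (wproj n i + wproj n (n - i)) * (wproj n j + wproj n (n - j)) * (isoproj n l * isoproj n l)"
        using pair_el_commute[of n l j] by (metis mult.assoc)
      then show ?thesis using that Ik by (simp only: f pair_mult_pair) simp
    qed
    show "cR (tmul n (s i) (eH n l)) \<noteq> 0" if "i \<in> I" for i
    proof
      assume "cR (tmul n (s i) (eH n l)) = 0"
      then have "wproj n i * ((wproj n i + wproj n (n - i)) * isoproj n l) = 0" using f[OF that] by simp
      moreover have "wproj n i * ((wproj n i + wproj n (n - i)) * isoproj n l) = wproj n i * isoproj n l"
      proof -
        have "i \<noteq> n - i" using Ik[OF that] by auto
        then show ?thesis by (simp add: distrib_left wproj_mult_P flip: mult.assoc)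
      qed
      ultimately show False using wproj_el_neq_0[OF l] Ik[OF that] by simp
    qed
    show "(\<Sum>i\<in>I. cR (tmul n (s i) (eH n l))) = isoproj n l"
      using sum_pairs_el[OF l] unfolding if_not_P[OF n] add_0_right I_eq[symmetric] by (simp add: f)
    show "primitive_in n l (\<lambda>y. hconj y = y) (cR (tmul n (s i) (eH n l)))" if "i \<in> I" for i
      unfolding f[OF that]
      using wproj_el_neq_0[OF l] Ik[OF that] hconj_cR[of "eH n l"]
      by (intro primitive_pair l n) (simp_all add: eH)
  qed (use l eH cR_SymT in \<open>auto simp: ofr_simps to_ht_tadd to_ht_tzero I_def\<close>)
  then show ?thesis unfolding s_def I_def .
qed

lemma theoremA_even:
  fixes n l :: nat
  assumes "n \<ge> 1" and l: "(n + 1) div 2 \<le> l" "l \<le> n" and n: "even n"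
  shows "complete_POI n (SlH n l :: real tensor set) (eH n l)
      (\<lambda>j. case j of
         None \<Rightarrow> tmul n (smul ((1 / 2) ^ (n div 2) * of_nat (n choose (n div 2)))
                     (symz n (tpow 2 sqH (n div 2)))) (eH n l)
       | Some (k, \<delta>) \<Rightarrow> tmul n (tmul n
           (smul (of_nat (n choose k) * (real (n div 2 - k) / 2 ^ k))
             (\<lambda>w. \<Sum>i = 0..(n div 2 - k) div 2.
                (- 1 / 4) ^ i * (real ((n div 2 - k - i) choose i) / real (n div 2 - k - i)) *
                symz n (tconc (2 * (k + 2 * i)) (tpow 2 sqH (k + 2 * i))
                                (tpow 2 sqHc (n div 2 - k - 2 * i))) w))
           (smul (1 / 2) (tadd (tone n) (smul (of_int \<delta>) (ptens (replicate n qe2))))))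
           (eH n l))
      (insert None (Some ` ({n - l..<n div 2} \<times> {-1, 1::int})))
      (2 * l - n + 1)"
proof -
  define h where "h = n div 2"
  have nh: "n = 2 * h" using n by (simp add: h_def)
  have hl: "h \<le> l" "n - l \<le> h" using l nh by auto
  define K where "K = {n - l..<h}"
  define I where "I = insert None (Some ` (K \<times> {-1, 1::int}))"
  define s0 :: "real tensor" where "s0 = smul ((1 / 2) ^ h * of_nat (n choose h)) (symz n (tpow 2 sqH h))"
  define s1 :: "nat \<Rightarrow> real tensor" where "s1 k = smul (of_nat (n choose k) * (real (h - k) / 2 ^ k))
             (\<lambda>w. \<Sum>i = 0..(h - k) div 2.
                (- 1 / 4) ^ i * (real ((h - k - i) choose i) / real (h - k - i)) *
                symz n (tconc (2 * (k + 2 * i)) (tpow 2 sqH (k + 2 * i))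
                                (tpow 2 sqHc (h - k - 2 * i))) w)" for k
  define s2 :: "int \<Rightarrow> real tensor" where
    "s2 \<delta> = smul (1 / 2) (tadd (tone n) (smul (of_int \<delta>) (ptens (replicate n qe2))))" for \<delta>
  define s where "s j = (case j of None \<Rightarrow> s0 | Some (k, \<delta>) \<Rightarrow> tmul n (s1 k) (s2 \<delta>))" for j
  have eH: "cR (eH n l) = isoproj n l" using assms by (simp add: ofr_eH to_ht_eH)
  have Kk: "2 * k < n" "k \<le> n" "n - l \<le> k" "k \<le> l" "k < h" if "k \<in> K" for k
    using that nh hl by (auto simp: K_def)
  have s0: "s0 \<in> tens n" "cR s0 = wproj n h"
  proof -
    show "s0 \<in> tens n" unfolding s0_def
      using tpow_tens[OF sqH_tens, of h] by (intro smul_tens symz_tens) (simp add: nh)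
    have "cR s0 = of_nat (n choose h) *\<^sub>c ((1 / 2) ^ h *\<^sub>c symmetrize n (tcatpow 2 (to_ht sqH) h))"
      by (simp add: s0_def ofr_simps ofr_tpow to_ht_smul to_ht_symz to_ht_tpow mult.commute)
    then show "cR s0 = wproj n h" unfolding wproj_def nh middle_formula .
  qed
  have s1: "s1 k \<in> tens n" "cR (s1 k) = wproj n k + wproj n (n - k)" if "k \<in> K" for k
  proof -
    show "s1 k \<in> tens n"
      unfolding s1_def
    proof (intro smul_tens lincomb_tens symz_tens)
      fix i assume i: "i \<in> {0..(h - k) div 2}"
      have "2 * (k + 2 * i) + 2 * (h - k - 2 * i) = n" using i Kk[OF that] nh by auto
      then show "tconc (2 * (k + 2 * i)) (tpow 2 sqH (k + 2 * i)) (tpow 2 sqHc (h - k - 2 * i)) \<in> tens n"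
        using tconc_tens[OF tpow_tens[OF sqH_tens] tpow_tens[OF sqHc_tens], of "k + 2 * i" "h - k - 2 * i"] by simp
    qed
    have "cR (s1 k) = (\<Sum>i\<le>(h - k) div 2. of_nat (n choose k) *\<^sub>c (waring (h - k) i * (1 / 2 ^ k) * (- 1 / 4) ^ i) *\<^sub>c
      symmetrize n (tcat (2 * (k + 2 * i)) (tcatpow 2 (to_ht sqH) (k + 2 * i)) (tcatpow 2 (to_ht sqHc) (h - k - 2 * i))))"
      unfolding s1_def cR_lincomb atLeast0AtMost
      by (intro sum.cong refl)
         (simp add: ofr_simps ofr_tpow to_ht_symz to_ht_tconc to_ht_tpow waring_def mult_ac)
    also have "\<dots> = of_nat (n choose k) *\<^sub>c (wmono n k + wmono n (n - k))"
      by (simp only: even_formula[OF nh Kk(5)[OF that], symmetric] scl_sum)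
    finally show "cR (s1 k) = wproj n k + wproj n (n - k)" by (simp add: wmono_pair Kk(2)[OF that])
  qed
  define W where "W \<delta> = (1/2) *\<^sub>c (hunit n + of_int \<delta> *\<^sub>c e2pow n)" for \<delta> :: int
  have s2: "s2 \<delta> \<in> tens n" "cR (s2 \<delta>) = W \<delta>" for \<delta>
  proof -
    show "s2 \<delta> \<in> tens n" unfolding s2_def by (intro smul_tens tadd_tens tone_tens ptens_tens) simp
    have "letter qe2 = uletter 2" by (rule letter_cong) (simp add: qe2_def)
    then show "cR (s2 \<delta>) = W \<delta>"
      by (simp add: s2_def W_def ofr_simps ofr_ptens_qe2 to_ht_smul to_ht_tadd to_ht_tone to_ht_ptens_replicate e2pow_def)
  qed
  have symm_W: "symm n (W \<delta>)" for \<delta> by (simp add: W_def)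
  have prj: "hunit n * e2pow n = e2pow n" "e2pow n * hunit n = e2pow n"
    using symm_deg[OF symm_jn[of n]] deg_times_pr by (auto simp: deg_def)
  have JJ: "e2pow n * e2pow n = hunit n" using e2pow_sq[of n] n by simp
  \<comment> \<open>For even n the element \<open>e2pow n\<close> squares to 1, so half of 1 plus or
    minus it are orthogonal idempotents.\<close>
  have WW: "W \<delta> * W \<epsilon> = (if \<delta> = \<epsilon> then W \<delta> else 0)" if "\<delta> \<in> {-1, 1}" "\<epsilon> \<in> {-1, 1}" for \<delta> \<epsilon>
    unfolding W_def
    by (rule ht_eqI) (use that in \<open>auto simp: distrib_left distrib_right prj JJ\<close>)
  have W_sum: "W (-1) + W 1 = hunit n"
    unfolding W_def by (rule ht_eqI) (simp add: field_simps)
  define q where "q k = wproj n k + wproj n (n - k)" for k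
  have symm_q: "symm n (q k)" for k by (simp add: q_def)
  have qJ: "q k * e2pow n = e2pow n * q k" if "k \<le> n" for k
    using wproj_jn[OF that] wproj_jn[of "n - k" n] that by (simp add: q_def distrib_left distrib_right add.commute)
  have qW: "q k * W \<delta> = W \<delta> * q k" if "k \<le> n" for k \<delta>
    using qJ[OF that] deg_times_pr[OF symm_deg[OF symm_q[of k]]] symm_deg[OF symm_q[of k]]
    by (simp add: W_def distrib_left distrib_right deg_def)
  have eW: "isoproj n l * W \<delta> = W \<delta> * isoproj n l" for \<delta> by (rule isoproj_central[OF symm_W])
  have eq: "isoproj n l * q k = q k * isoproj n l" for k by (rule isoproj_central[OF symm_q])
  have f0: "cR (tmul n (s None) (eH n l)) = wproj n h * isoproj n l"
    using s0 by (simp add: s_def cR_tmul eH)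
  have f1: "cR (tmul n (s (Some (k, \<delta>))) (eH n l)) = q k * W \<delta> * isoproj n l" if "k \<in> K" for k \<delta>
    using s1[OF that] s2 by (simp add: s_def cR_tmul eH q_def)
  \<comment> \<open>\<open>q k\<close>, \<open>W \<delta>\<close> and \<open>isoproj n l\<close>
    commute with one another, so a product of two members splits into separate products.\<close>
  have prod: "q j * W \<delta> * isoproj n l * (q k * W \<epsilon> * isoproj n l) = (q j * q k) * (W \<delta> * W \<epsilon>) * isoproj n l"
    if "k \<le> n" for j k \<delta> \<epsilon>
  proof -
    have "q j * W \<delta> * isoproj n l * (q k * W \<epsilon> * isoproj n l) = q j * W \<delta> * (isoproj n l * q k) * W \<epsilon> * isoproj n l"
      by (simp only: mult.assoc)
    also have "\<dots> = q j * (W \<delta> * q k) * (isoproj n l * W \<epsilon>) * isoproj n l"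
      by (simp only: eq mult.assoc)
    also have "\<dots> = q j * (q k * W \<delta>) * W \<epsilon> * (isoproj n l * isoproj n l)"
      unfolding eW qW[OF that, symmetric] by (simp only: mult.assoc)
    also have "\<dots> = (q j * q k) * (W \<delta> * W \<epsilon>) * isoproj n l"
      by (simp only: isoproj_idem[OF l] mult.assoc)
    finally show ?thesis .
  qed
  have qq: "q j * q k = (if j = k then q k else 0)" if "j \<in> K" "k \<in> K" for j k
    using that Kk by (simp add: q_def pair_mult_pair)
  \<comment> \<open>Neither k nor its mirror index n - k is the middle index, so the middle
    idempotent is orthogonal to all pairs.\<close>
  have "n - k \<noteq> h" "k \<noteq> h" if "k \<in> K" for k using Kk[OF that] nh by auto
  then have qP: "q k * wproj n h = 0" "wproj n h * q k = 0" if "k \<in> K" for k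
    using that by (auto simp: q_def distrib_left distrib_right wproj_mult_P)
  have I_cases: "i = None \<or> (\<exists>k \<delta>. i = Some (k, \<delta>) \<and> k \<in> K \<and> \<delta> \<in> {-1, 1})" if "i \<in> I" for i
    using that by (auto simp: I_def)
  have "complete_POI n (SlH n l :: real tensor set) (eH n l) (\<lambda>j. tmul n (s j) (eH n l)) I (2 * l - n + 1)"
  proof (rule complete_POI_real[where s = s])
    show "s i \<in> SymT n" if "i \<in> I" for i
      using I_cases[OF that] s0 s1 s2
      by (auto simp: s_def cR_SymT cR_tmul symm_W intro!: symm_mult)
    \<comment> \<open>One middle element, and two signs for each of the \<open>h - (n - l)\<close>
      pairs.\<close>
    have "card I = 1 + card (K \<times> {-1, 1::int})"
      unfolding I_def by (subst card_insert_disjoint) (auto simp: K_def card_image)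
    then show "card I = 2 * l - n + 1" using nh hl l by (simp add: K_def card_cartesian_product)
    show "cR (tmul n (s i) (eH n l)) * cR (tmul n (s j) (eH n l)) = 0"
      if ij: "i \<in> I" "j \<in> I" "i \<noteq> j" for i j
    proof -
      have o1: "wproj n h * isoproj n l * (q k * W \<delta> * isoproj n l) = 0" if "k \<in> K" for k \<delta>
      proof -
        have "wproj n h * isoproj n l * (q k * W \<delta> * isoproj n l) = wproj n h * (isoproj n l * q k) * W \<delta> * isoproj n l"
          by (simp only: mult.assoc)
        also have "\<dots> = (wproj n h * q k) * isoproj n l * W \<delta> * isoproj n l"
          by (simp only: eq mult.assoc)
        finally show ?thesis using qP that by simp
      qed
      have o2: "q k * W \<delta> * isoproj n l * (wproj n h * isoproj n l) = 0" if "k \<in> K" for k \<delta>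
      proof -
        have "q k * W \<delta> * isoproj n l * (wproj n h * isoproj n l) = W \<delta> * q k * (isoproj n l * wproj n h) * isoproj n l"
          using qW[OF Kk(2)[OF that]] by (simp only: mult.assoc)
        also have "\<dots> = W \<delta> * (q k * wproj n h) * isoproj n l * isoproj n l"
          by (simp only: isoproj_P mult.assoc)
        finally show ?thesis using qP that by simp
      qed
      have o3: "q k * W \<delta> * isoproj n l * (q m * W \<epsilon> * isoproj n l) = 0"
        if "k \<in> K" "m \<in> K" "\<delta> \<in> {-1, 1}" "\<epsilon> \<in> {-1, 1}" "(k, \<delta>) \<noteq> (m, \<epsilon>)" for k m \<delta> \<epsilon>
        using that unfolding prod[OF Kk(2)[OF that(2)]] qq[OF that(1,2)] WW[OF that(3,4)] by auto
      consider "i = None" "j = None" | k \<delta> where "i = None" "j = Some (k, \<delta>)" "k \<in> K"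
        | k \<delta> where "j = None" "i = Some (k, \<delta>)" "k \<in> K"
        | k \<delta> m \<epsilon> where "i = Some (k, \<delta>)" "j = Some (m, \<epsilon>)" "k \<in> K" "m \<in> K" "\<delta> \<in> {-1, 1}" "\<epsilon> \<in> {-1, 1}"
        using I_cases[OF ij(1)] I_cases[OF ij(2)] by blast
      then show ?thesis
      proof cases
        case 1
        then show ?thesis using ij by simp
      next
        case (2 k \<delta>)
        then show ?thesis using o1 by (simp only: f0 f1)
      next
        case (3 k \<delta>)
        then show ?thesis using o2 by (simp only: f0 f1)
      next
        case (4 k \<delta> m \<epsilon>)
        then have "(k, \<delta>) \<noteq> (m, \<epsilon>)" using ij by auto
        then show ?thesis using o3 4 by (simp only: f1)
      qed
    qed
    have half: "q k * W \<delta> * isoproj n l = (wproj n k + wproj n (n - k)) * ((1/2) *\<^sub>c (hunit n + of_int \<delta> *\<^sub>c e2pow n)) * isoproj n l" for k \<delta>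
      by (simp only: q_def W_def)
    show "cR (tmul n (s i) (eH n l)) \<noteq> 0" if "i \<in> I" for i
      using I_cases[OF that]
    proof (elim disjE exE conjE)
      assume "i = None"
      then show ?thesis using f0 wproj_el_neq_0[OF l] hl by simp
    next
      fix k \<delta> assume i: "i = Some (k, \<delta>)" "k \<in> K"
      have "q k * W \<delta> * isoproj n l \<noteq> 0" unfolding half
        using Kk[OF i(2)] wproj_el_neq_0[OF l] by (intro half_neq_0[OF l]) auto
      then show ?thesis using i f1 by simp
    qed
    show "(\<Sum>i\<in>I. cR (tmul n (s i) (eH n l))) = isoproj n l"
    proof -
      have "(\<Sum>i\<in>I. cR (tmul n (s i) (eH n l))) = wproj n h * isoproj n l + (\<Sum>(k, \<delta>)\<in>K \<times> {-1, 1}. cR (tmul n (s (Some (k, \<delta>))) (eH n l)))"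
        unfolding I_def by (subst sum.insert) (auto simp: K_def f0 sum.reindex case_prod_unfold)
      also have "(\<Sum>(k, \<delta>)\<in>K \<times> {-1, 1}. cR (tmul n (s (Some (k, \<delta>))) (eH n l))) =
          (\<Sum>k\<in>K. \<Sum>\<delta>\<in>{-1, 1}. q k * W \<delta> * isoproj n l)"
        unfolding sum.cartesian_product[symmetric] by (intro sum.cong refl) (rule f1)
      also have "\<dots> = (\<Sum>k\<in>K. q k * isoproj n l)"
      proof (intro sum.cong refl)
        fix k
        have "(\<Sum>\<delta>\<in>{-1, 1}. q k * W \<delta> * isoproj n l) = q k * (W (-1) + W 1) * isoproj n l"
          by (simp add: distrib_left distrib_right)
        then show "(\<Sum>\<delta>\<in>{-1, 1}. q k * W \<delta> * isoproj n l) = q k * isoproj n l"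
          using deg_times_pr[OF symm_deg[OF symm_q[of k]]] by (simp add: W_sum)
      qed
      finally show ?thesis
        using sum_pairs_el[OF l] n by (simp add: K_def q_def h_def add.commute)
    qed
    show "primitive_in n l (\<lambda>y. hconj y = y) (cR (tmul n (s i) (eH n l)))" if "i \<in> I" for i
      using I_cases[OF that]
    proof (elim disjE exE conjE)
      assume "i = None"
      \<comment> \<open>The middle projection is primitive among all complex tensors, hence among
        the real ones.\<close>
      then show ?thesis using f0 nh primitive_weight[OF l, of h] by simp
    next
      fix k \<delta> assume i: "i = Some (k, \<delta>)" "k \<in> K" "\<delta> \<in> {-1, 1}"
      have "q k * W \<delta> * isoproj n l * (q k * W \<delta> * isoproj n l) = q k * W \<delta> * isoproj n l"
        using Kk[OF i(2)] i qq WW by (simp only: prod) simp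
      then have "primitive_in n l (\<lambda>y. hconj y = y) (q k * W \<delta> * isoproj n l)"
        using Kk[OF i(2)] i(3) n unfolding half by (intro primitive_half l) auto
      then show ?thesis using i f1 by simp
    qed
  qed (use l eH cR_SymT in \<open>auto simp: ofr_simps to_ht_tadd to_ht_tzero I_def K_def\<close>)
  moreover have "(\<lambda>j. tmul n (s j) (eH n l)) = (\<lambda>j. case j of None \<Rightarrow> tmul n s0 (eH n l)
      | Some (k, \<delta>) \<Rightarrow> tmul n (tmul n (s1 k) (s2 \<delta>)) (eH n l))"
    by (auto simp: s_def fun_eq_iff split: option.split)
  ultimately show ?thesis unfolding I_def K_def s0_def s1_def s2_def h_def by simp
qed

theorem theoremA:
  fixes n l :: nat
  assumes "n \<ge> 1" and "(n + 1) div 2 \<le> l" and "l \<le> n"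
  shows
   "complete_POI n (SlH n l :: complex tensor set) (eH n l)
      (\<lambda>k. tmul n (smul (of_nat (n choose k))
              (symz n (ptens (replicate k qa @ replicate (n - k) qac)))) (eH n l))
      {n - l..l} (2 * l - n + 1)
   \<and> (odd n \<longrightarrow>
      complete_POI n (SlH n l :: real tensor set) (eH n l)
      (\<lambda>k. tmul n
         (smul (of_nat (n choose k) * (real (n - 2 * k) / 2 ^ k))
           (\<lambda>w. \<Sum>i = 0..(n - 1) div 2 - k.
              (- 1 / 2) ^ i * (real ((n - 2 * k - i) choose i) / real (n - 2 * k - i)) *
              symz n (tconc (n - 2 * k - 2 * i) (tone (n - 2 * k - 2 * i)) (tpow 2 sqH (k + i))) w))
         (eH n l))
      {n - l..(n - 1) div 2} ((2 * l - n + 1) div 2))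
   \<and> (even n \<longrightarrow>
      complete_POI n (SlH n l :: real tensor set) (eH n l)
      (\<lambda>j. case j of
         None \<Rightarrow> tmul n (smul ((1 / 2) ^ (n div 2) * of_nat (n choose (n div 2)))
                     (symz n (tpow 2 sqH (n div 2)))) (eH n l)
       | Some (k, \<delta>) \<Rightarrow> tmul n (tmul n
           (smul (of_nat (n choose k) * (real (n div 2 - k) / 2 ^ k))
             (\<lambda>w. \<Sum>i = 0..(n div 2 - k) div 2.
                (- 1 / 4) ^ i * (real ((n div 2 - k - i) choose i) / real (n div 2 - k - i)) *
                symz n (tconc (2 * (k + 2 * i)) (tpow 2 sqH (k + 2 * i))
                                (tpow 2 sqHc (n div 2 - k - 2 * i))) w))
           (smul (1 / 2) (tadd (tone n) (smul (of_int \<delta>) (ptens (replicate n qe2))))))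
           (eH n l))
      (insert None (Some ` ({n - l..<n div 2} \<times> {-1, 1::int})))
      (2 * l - n + 1))"
  using theoremA_complex[OF assms] theoremA_odd[OF assms] theoremA_even[OF assms] by blast

end
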